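(* Let $\varphi$ be a sentence of the language of set theory of the form $(\forall^{\mathrm{Ord}} x)\,\psi(x)$, where $\psi(x)$ is upwards absolute for models of $\mathrm{ZF}$ with the same ordinals. Then $\mathrm{ZF}\vdash\varphi$ if and only if $\mathrm{ZFC}\vdash\varphi$.
   Context: Ordinal bounded quantifiers: $(\exists^{\mathrm{Ord}} x)\,\chi(x)$ abbreviates $\exists x\,(x\subseteq \mathrm{Ord}^{<\omega}\wedge \chi(x))$, i.e. $x$ ranges over sets of finite tuples of ordinals (sets all of whose elements are functions with domain a finite ordinal and range a set of ordinals); dually $(\forall^{\mathrm{Ord}} x)\,\chi(x)$ abbreviates $\forall x\,(x\subseteq \mathrm{Ord}^{<\omega}\rightarrow \chi(x))$. A formula $\psi(x)$ is upwards absolute for models of $\mathrm{ZF}$ with the same ordinals if whenever $M\subseteq V$ are models of $\mathrm{ZF}$ with the same ordinals, $M$ transitive in $V$, and $a\in M$ with $M\models\psi(a)$, then $V\models\psi(a)$. *)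

theory Defs
  imports Main
begin

section \<open>First-order language of set theory\<close>

text \<open>Variables are de Bruijn indices: under a quantifier, index 0 is the bound variable and the
  variable called \<open>i\<close> outside is called \<open>Suc i\<close>. There are no terms other than variables.\<close>

datatype fm =
    Mem nat nat  (infix \<open>\<^bold>\<in>\<close> 50)
  | Eq nat nat   (infix \<open>\<^bold>=\<close> 50)
  | Fls          (\<open>\<^bold>\<bottom>\<close>)
  | Imp fm fm    (infixr \<open>\<^bold>\<longrightarrow>\<close> 25)
  | Forall fm

definition Neg :: "fm \<Rightarrow> fm"  (\<open>\<^bold>\<not> _\<close> [40] 40)
  where "(\<^bold>\<not> p) = (p \<^bold>\<longrightarrow> \<^bold>\<bottom>)"

definition Or :: "fm \<Rightarrow> fm \<Rightarrow> fm"  (infixr \<open>\<^bold>\<or>\<close> 30)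
  where "(p \<^bold>\<or> q) = (\<^bold>\<not> p \<^bold>\<longrightarrow> q)"

definition And :: "fm \<Rightarrow> fm \<Rightarrow> fm"  (infixr \<open>\<^bold>\<and>\<close> 35)
  where "(p \<^bold>\<and> q) = (\<^bold>\<not> (p \<^bold>\<longrightarrow> \<^bold>\<not> q))"

definition Iff :: "fm \<Rightarrow> fm \<Rightarrow> fm"  (infixr \<open>\<^bold>\<longleftrightarrow>\<close> 25)
  where "(p \<^bold>\<longleftrightarrow> q) = ((p \<^bold>\<longrightarrow> q) \<^bold>\<and> (q \<^bold>\<longrightarrow> p))"

definition Exists :: "fm \<Rightarrow> fm"
  where "Exists p = (\<^bold>\<not> Forall (\<^bold>\<not> p))"

text \<open>Bounded quantifiers: the index \<open>i\<close> of the bound is read outside the quantifier.\<close>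

definition ForallIn :: "nat \<Rightarrow> fm \<Rightarrow> fm"
  where "ForallIn i p = Forall (0 \<^bold>\<in> Suc i \<^bold>\<longrightarrow> p)"

definition ExistsIn :: "nat \<Rightarrow> fm \<Rightarrow> fm"
  where "ExistsIn i p = Exists (0 \<^bold>\<in> Suc i \<^bold>\<and> p)"

primrec fv :: "fm \<Rightarrow> nat set" where
  "fv (i \<^bold>\<in> j) = {i, j}"
| "fv (i \<^bold>= j) = {i, j}"
| "fv \<^bold>\<bottom> = {}"
| "fv (p \<^bold>\<longrightarrow> q) = fv p \<union> fv q"
| "fv (Forall p) = {i. Suc i \<in> fv p}"

definition sentence :: "fm \<Rightarrow> bool"
  where "sentence p \<longleftrightarrow> fv p = {}"

text \<open>Simultaneous capture-avoiding renaming of the free variables.\<close>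

primrec ren :: "(nat \<Rightarrow> nat) \<Rightarrow> fm \<Rightarrow> fm" where
  "ren r (i \<^bold>\<in> j) = (r i \<^bold>\<in> r j)"
| "ren r (i \<^bold>= j) = (r i \<^bold>= r j)"
| "ren r \<^bold>\<bottom> = \<^bold>\<bottom>"
| "ren r (p \<^bold>\<longrightarrow> q) = (ren r p \<^bold>\<longrightarrow> ren r q)"
| "ren r (Forall p) = Forall (ren (case_nat 0 (Suc \<circ> r)) p)"

text \<open>\<open>shift k p\<close> makes room for a variable with index \<open>k\<close> that does not occur in \<open>p\<close>.\<close>

definition shift :: "nat \<Rightarrow> fm \<Rightarrow> fm"
  where "shift k = ren (\<lambda>i. if i < k then i else Suc i)"

text \<open>The instance of \<open>Forall p\<close> at the variable \<open>j\<close>.\<close>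

definition inst :: "nat \<Rightarrow> fm \<Rightarrow> fm"
  where "inst j = ren (case_nat j id)"

definition Exists1 :: "fm \<Rightarrow> fm"
  where "Exists1 p = Exists (Forall (shift 1 p \<^bold>\<longleftrightarrow> 0 \<^bold>= 1))"


section \<open>Provability\<close>

text \<open>Natural deduction for classical first-order logic with equality (nonempty domains).
  The context may be infinite.\<close>

inductive proves :: "fm set \<Rightarrow> fm \<Rightarrow> bool"  (infix \<open>\<turnstile>\<close> 20) where
  Assm:    "p \<in> \<Gamma> \<Longrightarrow> \<Gamma> \<turnstile> p"
| ImpI:    "insert p \<Gamma> \<turnstile> q \<Longrightarrow> \<Gamma> \<turnstile> (p \<^bold>\<longrightarrow> q)"
| ImpE:    "\<Gamma> \<turnstile> (p \<^bold>\<longrightarrow> q) \<Longrightarrow> \<Gamma> \<turnstile> p \<Longrightarrow> \<Gamma> \<turnstile> q"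
| Contr:   "insert (\<^bold>\<not> p) \<Gamma> \<turnstile> \<^bold>\<bottom> \<Longrightarrow> \<Gamma> \<turnstile> p"
| ForallI: "shift 0 ` \<Gamma> \<turnstile> p \<Longrightarrow> \<Gamma> \<turnstile> Forall p"
| ForallE: "\<Gamma> \<turnstile> Forall p \<Longrightarrow> \<Gamma> \<turnstile> inst j p"
| EqI:     "\<Gamma> \<turnstile> (i \<^bold>= i)"
| EqE:     "\<Gamma> \<turnstile> (i \<^bold>= j) \<Longrightarrow> \<Gamma> \<turnstile> inst i p \<Longrightarrow> \<Gamma> \<turnstile> inst j p"


section \<open>Basic set-theoretic formulas\<close>

definition fm_empty :: "nat \<Rightarrow> fm"
  where "fm_empty x = Forall (\<^bold>\<not> 0 \<^bold>\<in> Suc x)"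

definition fm_subset :: "nat \<Rightarrow> nat \<Rightarrow> fm"
  where "fm_subset x y = ForallIn x (0 \<^bold>\<in> Suc y)"

text \<open>\<open>y = x \<union> {x}\<close>\<close>
definition fm_succ :: "nat \<Rightarrow> nat \<Rightarrow> fm"
  where "fm_succ x y = Forall (0 \<^bold>\<in> Suc y \<^bold>\<longleftrightarrow> 0 \<^bold>\<in> Suc x \<^bold>\<or> 0 \<^bold>= Suc x)"

text \<open>\<open>z = {x, y}\<close>\<close>
definition fm_upair :: "nat \<Rightarrow> nat \<Rightarrow> nat \<Rightarrow> fm"
  where "fm_upair x y z = Forall (0 \<^bold>\<in> Suc z \<^bold>\<longleftrightarrow> 0 \<^bold>= Suc x \<^bold>\<or> 0 \<^bold>= Suc y)"

text \<open>\<open>z = {{x, x}, {x, y}}\<close>\<close>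
definition fm_opair :: "nat \<Rightarrow> nat \<Rightarrow> nat \<Rightarrow> fm"
  where "fm_opair x y z =
    Exists (Exists (fm_upair (x+2) (x+2) 1 \<^bold>\<and> fm_upair (x+2) (y+2) 0 \<^bold>\<and> fm_upair 1 0 (z+2)))"

text \<open>\<open>\<langle>x, y\<rangle> \<in> r\<close>\<close>
definition fm_related :: "nat \<Rightarrow> nat \<Rightarrow> nat \<Rightarrow> fm"
  where "fm_related x y r = ExistsIn r (fm_opair (x+1) (y+1) 0)"

definition fm_function :: "nat \<Rightarrow> fm"
  where "fm_function f =
    (ForallIn f (Exists (Exists (fm_opair 1 0 2))) \<^bold>\<and>
     Forall (Forall (Forall (fm_related 2 1 (f+3) \<^bold>\<and> fm_related 2 0 (f+3) \<^bold>\<longrightarrow> 1 \<^bold>= 0))))"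

definition fm_domain :: "nat \<Rightarrow> nat \<Rightarrow> fm"
  where "fm_domain f d = Forall (0 \<^bold>\<in> Suc d \<^bold>\<longleftrightarrow> Exists (fm_related 1 0 (f+2)))"

text \<open>A transitive set strictly well-ordered by membership; the conjuncts after transitivity of
  \<open>x\<close> say that membership on \<open>x\<close> is irreflexive, transitive and total, and that every nonempty
  subset of \<open>x\<close> has a least element.\<close>

definition fm_ordinal :: "nat \<Rightarrow> fm"
  where "fm_ordinal x =
    (ForallIn x (fm_subset 0 (x+1)) \<^bold>\<and>
     ForallIn x (\<^bold>\<not> 0 \<^bold>\<in> 0) \<^bold>\<and>
     ForallIn x (ForallIn (x+1) (ForallIn (x+2) (2 \<^bold>\<in> 1 \<^bold>\<and> 1 \<^bold>\<in> 0 \<^bold>\<longrightarrow> 2 \<^bold>\<in> 0))) \<^bold>\<and>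
     ForallIn x (ForallIn (x+1) (1 \<^bold>\<in> 0 \<^bold>\<or> 1 \<^bold>= 0 \<^bold>\<or> 0 \<^bold>\<in> 1)) \<^bold>\<and>
     Forall (fm_subset 0 (x+1) \<^bold>\<and> \<^bold>\<not> fm_empty 0 \<^bold>\<longrightarrow> ExistsIn 0 (ForallIn 1 (1 \<^bold>= 0 \<^bold>\<or> 1 \<^bold>\<in> 0))))"

definition fm_zero_or_succ :: "nat \<Rightarrow> fm"
  where "fm_zero_or_succ x = (fm_empty x \<^bold>\<or> Exists (fm_succ 0 (x+1)))"

text \<open>An ordinal is finite iff no limit ordinal is less than or equal to it.\<close>

definition fm_finite_ordinal :: "nat \<Rightarrow> fm"
  where "fm_finite_ordinal x =
    (fm_ordinal x \<^bold>\<and> fm_zero_or_succ x \<^bold>\<and> ForallIn x (fm_zero_or_succ 0))"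

text \<open>\<open>f \<in> Ord\<^sup><\<^sup>\<omega>\<close>\<close>
definition fm_ord_tuple :: "nat \<Rightarrow> fm"
  where "fm_ord_tuple f =
    (fm_function f \<^bold>\<and>
     Exists (fm_finite_ordinal 0 \<^bold>\<and> fm_domain (f+1) 0) \<^bold>\<and>
     Forall (Forall (fm_related 1 0 (f+2) \<^bold>\<longrightarrow> fm_ordinal 0)))"

text \<open>The ordinal bounded quantifier; the variable it binds has index 0 in \<open>p\<close>.\<close>

definition ForallOrd :: "fm \<Rightarrow> fm"
  where "ForallOrd p = Forall (ForallIn 0 (fm_ord_tuple 0) \<^bold>\<longrightarrow> p)"


section \<open>The theories ZF and ZFC\<close>

definition ax_extensionality :: fm
  where "ax_extensionality = Forall (Forall (Forall (0 \<^bold>\<in> 2 \<^bold>\<longleftrightarrow> 0 \<^bold>\<in> 1) \<^bold>\<longrightarrow> 1 \<^bold>= 0))"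

definition ax_foundation :: fm
  where "ax_foundation = Forall (\<^bold>\<not> fm_empty 0 \<^bold>\<longrightarrow> ExistsIn 0 (\<^bold>\<not> ExistsIn 0 (0 \<^bold>\<in> 2)))"

definition ax_pairing :: fm
  where "ax_pairing = Forall (Forall (Exists (fm_upair 2 1 0)))"

definition ax_union :: fm
  where "ax_union = Forall (Exists (Forall (0 \<^bold>\<in> 1 \<^bold>\<longleftrightarrow> ExistsIn 2 (1 \<^bold>\<in> 0))))"

definition ax_power_set :: fm
  where "ax_power_set = Forall (Exists (Forall (0 \<^bold>\<in> 1 \<^bold>\<longleftrightarrow> fm_subset 0 2)))"

definition ax_infinity :: fm
  where "ax_infinity = Exists (ExistsIn 0 (fm_empty 0) \<^bold>\<and> ForallIn 0 (ExistsIn 1 (fm_succ 1 0)))"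

text \<open>\<open>\<forall>a. \<exists>b. \<forall>x. x \<in> b \<longleftrightarrow> x \<in> a \<and> p\<close>, where in \<open>p\<close> the variables \<open>x\<close>, \<open>a\<close> and the
  parameters have the indices 0, 1 and 2, 3, \dots\<close>

definition ax_separation :: "fm \<Rightarrow> fm"
  where "ax_separation p = Forall (Exists (Forall (0 \<^bold>\<in> 1 \<^bold>\<longleftrightarrow> 0 \<^bold>\<in> 2 \<^bold>\<and> shift 1 p)))"

text \<open>\<open>\<forall>a. (\<forall>x\<in>a. \<exists>!y. p) \<longrightarrow> (\<exists>b. \<forall>x\<in>a. \<exists>y\<in>b. p)\<close>, where in \<open>p\<close> the variables \<open>y\<close>, \<open>x\<close>, \<open>a\<close> and
  the parameters have the indices 0, 1, 2 and 3, 4, \dots\<close>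

definition ax_replacement :: "fm \<Rightarrow> fm"
  where "ax_replacement p = Forall (ForallIn 0 (Exists1 p) \<^bold>\<longrightarrow> Exists (ForallIn 1 (ExistsIn 1 (shift 2 p))))"

text \<open>Every set of nonempty pairwise disjoint sets has a transversal.\<close>

definition ax_choice :: fm
  where "ax_choice =
    Forall (ForallIn 0 (\<^bold>\<not> fm_empty 0) \<^bold>\<and> ForallIn 0 (ForallIn 1 (\<^bold>\<not> 1 \<^bold>= 0 \<^bold>\<longrightarrow> \<^bold>\<not> ExistsIn 1 (0 \<^bold>\<in> 1)))
      \<^bold>\<longrightarrow> Exists (ForallIn 1 (Exists1 (0 \<^bold>\<in> 1 \<^bold>\<and> 0 \<^bold>\<in> 2))))"

definition universal_closures :: "fm \<Rightarrow> fm set"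
  where "universal_closures p = {(Forall ^^ n) p | n. sentence ((Forall ^^ n) p)}"

definition ZF :: "fm set"
  where "ZF =
    {ax_extensionality, ax_foundation, ax_pairing, ax_union, ax_power_set, ax_infinity}
    \<union> (\<Union>p. universal_closures (ax_separation p))
    \<union> (\<Union>p. universal_closures (ax_replacement p))"

definition ZFC :: "fm set"
  where "ZFC = insert ax_choice ZF"


section \<open>Models and absoluteness\<close>

text \<open>A structure consists of a carrier \<open>M\<close> and a membership relation \<open>E\<close>, which matters only
  on \<open>M\<close>; it need not be the real membership relation of any universe.\<close>

primrec sat :: "'a set \<Rightarrow> ('a \<Rightarrow> 'a \<Rightarrow> bool) \<Rightarrow> (nat \<Rightarrow> 'a) \<Rightarrow> fm \<Rightarrow> bool" where
  "sat M E e (i \<^bold>\<in> j) \<longleftrightarrow> E (e i) (e j)"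
| "sat M E e (i \<^bold>= j) \<longleftrightarrow> e i = e j"
| "sat M E e \<^bold>\<bottom> \<longleftrightarrow> False"
| "sat M E e (p \<^bold>\<longrightarrow> q) \<longleftrightarrow> (sat M E e p \<longrightarrow> sat M E e q)"
| "sat M E e (Forall p) \<longleftrightarrow> (\<forall>x\<in>M. sat M E (case_nat x e) p)"

definition is_model :: "'a set \<Rightarrow> ('a \<Rightarrow> 'a \<Rightarrow> bool) \<Rightarrow> fm set \<Rightarrow> bool"
  where "is_model M E T \<longleftrightarrow> M \<noteq> {} \<and> (\<forall>p\<in>T. \<forall>e. range e \<subseteq> M \<longrightarrow> sat M E e p)"

text \<open>\<open>M \<Turnstile> p(a)\<close> for a formula \<open>p\<close> whose only free variable has index 0.\<close>

definition sat_at :: "'a set \<Rightarrow> ('a \<Rightarrow> 'a \<Rightarrow> bool) \<Rightarrow> fm \<Rightarrow> 'a \<Rightarrow> bool"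
  where "sat_at M E p a \<longleftrightarrow> sat M E (\<lambda>_. a) p"

definition ordinals :: "'a set \<Rightarrow> ('a \<Rightarrow> 'a \<Rightarrow> bool) \<Rightarrow> 'a set"
  where "ordinals M E = {a \<in> M. sat_at M E (fm_ordinal 0) a}"

definition transitive_in :: "'a set \<Rightarrow> 'a set \<Rightarrow> ('a \<Rightarrow> 'a \<Rightarrow> bool) \<Rightarrow> bool"
  where "transitive_in M V E \<longleftrightarrow> M \<subseteq> V \<and> (\<forall>x\<in>M. \<forall>y\<in>V. E y x \<longrightarrow> y \<in> M)"

text \<open>HOL cannot quantify over all types inside a formula, so the type that the carriers of the
  models are drawn from is an explicit parameter. Over a finite type the property is vacuous,
  because ZF has no finite models.\<close>

definition upwards_absolute :: "'a itself \<Rightarrow> fm \<Rightarrow> bool"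
  where "upwards_absolute (_ :: 'a itself) p \<longleftrightarrow>
    (\<forall>(V :: 'a set) M E.
      is_model V E ZF \<and> is_model M E ZF \<and> transitive_in M V E \<and> ordinals M E = ordinals V E
      \<longrightarrow> (\<forall>a\<in>M. sat_at M E p a \<longrightarrow> sat_at V E p a))"

end

theory Submission
  imports Defs "HOL-Library.Countable"
begin

text \<open>If ZF does not prove the sentence, the completeness theorem gives a model \<open>V\<close> of ZF with a
  set \<open>X\<close> of finite tuples of ordinals such that \<open>V \<Turnstile> \<not> \<psi>(X)\<close>. Upwards absoluteness gives
  \<open>M \<Turnstile> \<not> \<psi>(X)\<close> for every transitive submodel \<open>M\<close> of ZF with the same ordinals and \<open>X \<in> M\<close>, so it
  suffices to find such an \<open>M\<close> that satisfies choice. We take the sets that are hereditarily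
  ordinal definable from \<open>X\<close>. To avoid formulas inside \<open>V\<close>, which may be ill-founded, ordinal
  definability is replaced by membership in the range of a definable injection from the ordinals
  whose range contains \<open>X\<close> and every level of the cumulative hierarchy and is closed under finitely
  many Goedel operations. The Goedel normal form makes this range closed under definability in
  \<open>V\<close>, whence every axiom of ZF holds in \<open>M\<close>; choice holds since a transversal is definable from
  the enumeration.\<close>


section \<open>Syntax and semantics\<close>

text \<open>The restriction to sets of ordinal tuples is what puts \<open>X\<close> into the inner
  model. \<open>X\<close> enters the enumeration by fiat, but hereditary membership also asks for
  its elements, and an arbitrary set may have elements that are not definable from it; a finite
  tuple of ordinals is definable from ordinals alone. The integers of \<open>V\<close> may be
  nonstandard, so two kinds of induction must be kept apart: formulas are treated by induction
  outside \<open>V\<close>, lengths of tuples and ordinals by induction inside \<open>V\<close>,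
  which is valid for definable predicates only. The predicates \<open>pd\<close> and
  \<open>pf\<close> record definability so that separation, replacement and induction of
  \<open>V\<close> can be applied to outer notions. Closure of the enumeration under the operations
  is forced by counting: a required value that never appeared would confine all later values to one
  level, and injectivity would then send a proper class of ordinals into a set. Closure under
  definability concerns truth in all of \<open>V\<close>, not in a level. Collection takes the place
  of reflection: the witnesses needed for the tuples over one level all occur in some larger
  level.\<close>

instance fm :: countable
  by countable_datatype

lemma finite_fv: "finite (fv p)"
proof (induction p)
  case (Forall p)
  then have "finite (Suc -` fv p)" by (simp add: finite_vimageI)
  then show ?case by (simp add: vimage_def)
qed auto

lemma ren_cong: "(\<And>i. i \<in> fv p \<Longrightarrow> r i = s i) \<Longrightarrow> ren r p = ren s p"
proof (induction p arbitrary: r s)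
  case (Forall p)
  have "ren (case_nat 0 (Suc \<circ> r)) p = ren (case_nat 0 (Suc \<circ> s)) p"
    by (rule Forall.IH) (use Forall.prems in \<open>auto split: nat.split\<close>)
  then show ?case by simp
next
  case (Imp p q)
  from Imp.IH(1)[of r s] Imp.IH(2)[of r s] Imp.prems show ?case by simp
qed auto

lemma ren_ren: "ren r (ren s p) = ren (r \<circ> s) p"
proof (induction p arbitrary: r s)
  case (Forall p)
  have "case_nat 0 (Suc \<circ> r) \<circ> case_nat 0 (Suc \<circ> s) = case_nat 0 (Suc \<circ> (r \<circ> s))"
    by (auto simp: fun_eq_iff split: nat.split)
  then show ?case by (simp add: Forall.IH comp_def id_def)
qed auto

lemma ren_id: "ren id p = p"
proof (induction p)
  case (Forall p)
  have "case_nat 0 (Suc \<circ> id) = id"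
    by (auto simp: fun_eq_iff split: nat.split)
  then show ?case by (simp only: ren.simps Forall.IH)
qed auto

lemma sat_ren: "sat M E e (ren r p) \<longleftrightarrow> sat M E (e \<circ> r) p"
proof (induction p arbitrary: e r)
  case (Forall p)
  have "case_nat x e \<circ> case_nat 0 (Suc \<circ> r) = case_nat x (e \<circ> r)" for x
    by (auto simp: fun_eq_iff split: nat.split)
  then show ?case by (simp add: Forall.IH comp_def id_def)
qed auto

lemma sat_cong: "(\<And>i. i \<in> fv p \<Longrightarrow> e i = e' i) \<Longrightarrow> sat M E e p \<longleftrightarrow> sat M E e' p"
proof (induction p arbitrary: e e')
  case (Forall p)
  have "sat M E (case_nat x e) p \<longleftrightarrow> sat M E (case_nat x e') p" for x
    by (rule Forall.IH) (use Forall.prems in \<open>auto split: nat.split\<close>)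
  then show ?case by simp
next
  case (Imp p q)
  from Imp.IH(1)[of e e'] Imp.IH(2)[of e e'] Imp.prems show ?case by simp
qed auto

lemma sat_shift: "sat M E e (shift k p) \<longleftrightarrow> sat M E (\<lambda>i. e (if i < k then i else Suc i)) p"
  by (simp add: shift_def sat_ren comp_def)

lemma sat_inst: "sat M E e (inst j p) \<longleftrightarrow> sat M E (case_nat (e j) e) p"
proof -
  have "e \<circ> case_nat j id = case_nat (e j) e"
    by (auto simp: fun_eq_iff split: nat.split)
  then show ?thesis by (simp add: inst_def sat_ren)
qed

lemma sat_connectives [simp]:
  "sat M E e (\<^bold>\<not> p) \<longleftrightarrow> \<not> sat M E e p"
  "sat M E e (p \<^bold>\<or> q) \<longleftrightarrow> sat M E e p \<or> sat M E e q"
  "sat M E e (p \<^bold>\<and> q) \<longleftrightarrow> sat M E e p \<and> sat M E e q"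
  "sat M E e (p \<^bold>\<longleftrightarrow> q) \<longleftrightarrow> (sat M E e p \<longleftrightarrow> sat M E e q)"
  "sat M E e (Exists p) \<longleftrightarrow> (\<exists>x\<in>M. sat M E (case_nat x e) p)"
  "sat M E e (ForallIn i p) \<longleftrightarrow> (\<forall>x\<in>M. E x (e i) \<longrightarrow> sat M E (case_nat x e) p)"
  "sat M E e (ExistsIn i p) \<longleftrightarrow> (\<exists>x\<in>M. E x (e i) \<and> sat M E (case_nat x e) p)"
  by (auto simp: Neg_def Or_def And_def Iff_def Exists_def ForallIn_def ExistsIn_def)

lemma case_nat_eta:
  fixes e :: "nat \<Rightarrow> 'a"
  shows "case_nat (e 0) (\<lambda>i. e (Suc i)) = e"
  by (auto simp: fun_eq_iff split: nat.split)

text \<open>An assignment splits into its head, over which the outermost quantifier ranges, and its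
  shifted tail, which is again an arbitrary assignment.\<close>

lemma sat_Foralls:
  "(\<forall>e. (\<forall>i. e i \<in> M) \<longrightarrow> sat M E e ((Forall ^^ n) p)) \<longleftrightarrow> (\<forall>e. (\<forall>i. e i \<in> M) \<longrightarrow> sat M E e p)"
  for M :: "'a set"
proof (induction n)
  case (Suc n)
  have "(\<forall>e. (\<forall>i. e i \<in> M) \<longrightarrow> sat M E e (Forall q)) \<longleftrightarrow> (\<forall>e. (\<forall>i. e i \<in> M) \<longrightarrow> sat M E e q)" for q
  proof (intro iffI allI impI)
    fix e :: "nat \<Rightarrow> 'a" assume *: "\<forall>e. (\<forall>i. e i \<in> M) \<longrightarrow> sat M E e (Forall q)" and e: "\<forall>i. e i \<in> M"
    have "sat M E (\<lambda>i. e (Suc i)) (Forall q)" using *[THEN spec, of "\<lambda>i. e (Suc i)"] e by simp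
    then have "sat M E (case_nat (e 0) (\<lambda>i. e (Suc i))) q" using e by simp
    then show "sat M E e q" by (simp only: case_nat_eta)
  next
    fix e :: "nat \<Rightarrow> 'a" assume *: "\<forall>e. (\<forall>i. e i \<in> M) \<longrightarrow> sat M E e q" and e: "\<forall>i. e i \<in> M"
    have "\<forall>i. case_nat x e i \<in> M" if "x \<in> M" for x using that e by (simp split: nat.split)
    then show "sat M E e (Forall q)" using * by simp
  qed
  with Suc show ?case by simp
qed simp

lemma fv_Foralls: "fv ((Forall ^^ n) p) = {i. i + n \<in> fv p}"
  by (induction n) auto

lemma universal_closures_nonempty: "\<exists>n. sentence ((Forall ^^ n) p)"
proof -
  obtain n where "\<forall>i\<in>fv p. i < n"
    using finite_fv finite_nat_set_iff_bounded by blast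
  then have "sentence ((Forall ^^ n) p)" by (force simp: sentence_def fv_Foralls)
  then show ?thesis ..
qed

text \<open>Only closures that are sentences are collected, so the left side has content because a
  long enough prefix binds the finitely many free variables.\<close>

lemma sat_universal_closures:
  "(\<forall>q\<in>universal_closures p. \<forall>e. (\<forall>i. e i \<in> M) \<longrightarrow> sat M E e q)
    \<longleftrightarrow> (\<forall>e. (\<forall>i. e i \<in> M) \<longrightarrow> sat M E e p)"
proof -
  obtain n where "(Forall ^^ n) p \<in> universal_closures p"
    using universal_closures_nonempty unfolding universal_closures_def by blast
  then have "(\<forall>e. (\<forall>i. e i \<in> M) \<longrightarrow> sat M E e p)"
    if "\<forall>q\<in>universal_closures p. \<forall>e. (\<forall>i. e i \<in> M) \<longrightarrow> sat M E e q"
    using that sat_Foralls by blast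
  moreover have "\<forall>q\<in>universal_closures p. \<forall>e. (\<forall>i. e i \<in> M) \<longrightarrow> sat M E e q"
    if "\<forall>e. (\<forall>i. e i \<in> M) \<longrightarrow> sat M E e p"
    using that sat_Foralls[of M E _ p] unfolding universal_closures_def by blast
  ultimately show ?thesis by blast
qed

section \<open>Soundness and completeness\<close>

lemma soundness:
  assumes "\<Gamma> \<turnstile> p" "\<forall>i. e i \<in> M" "\<And>q. q \<in> \<Gamma> \<Longrightarrow> sat M E e q"
  shows "sat M E e p"
  using assms
proof (induction arbitrary: e rule: proves.induct)
  case (ForallI \<Gamma> p)
  have "sat M E (case_nat x e) p" if "x \<in> M" for x
  proof (rule ForallI.IH)
    show "\<forall>i. case_nat x e i \<in> M" using that ForallI.prems by (simp split: nat.split)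
    show "sat M E (case_nat x e) q" if "q \<in> shift 0 ` \<Gamma>" for q
      using that ForallI.prems by (auto simp: sat_shift)
  qed
  then show ?case by simp
next
  case (ForallE \<Gamma> p j)
  then show ?case by (auto simp: sat_inst)
next
  case (EqE \<Gamma> i j p)
  then have "e i = e j" "sat M E e (inst i p)" by auto
  then show ?case by (simp add: sat_inst)
next
  case (Contr p \<Gamma>)
  have "sat M E e \<^bold>\<bottom>" if "\<not> sat M E e p"
    by (rule Contr.IH) (use that Contr.prems in auto)
  then show ?case by auto
qed auto

lemma weakening: "\<Gamma> \<turnstile> p \<Longrightarrow> \<Gamma> \<subseteq> \<Delta> \<Longrightarrow> \<Delta> \<turnstile> p"
proof (induction arbitrary: \<Delta> rule: proves.induct)
  case (ImpI p \<Gamma> q)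
  then show ?case by (meson insert_mono proves.ImpI)
next
  case (Contr p \<Gamma>)
  then show ?case by (meson insert_mono proves.Contr)
next
  case (ForallI \<Gamma> p)
  then show ?case by (meson image_mono proves.ForallI)
next
  case (EqE \<Gamma> i j p)
  then show ?case by (meson proves.EqE)
next
  case (ImpE \<Gamma> p q)
  then show ?case by (meson proves.ImpE)
qed (auto intro: proves.intros)

text \<open>Used in \<open>consistent_witness\<close> to move a fresh variable to the index that
  \<open>ForallI\<close> binds.\<close>

lemma proves_ren: "\<Gamma> \<turnstile> p \<Longrightarrow> ren r ` \<Gamma> \<turnstile> ren r p"
proof (induction arbitrary: r rule: proves.induct)
  case (Contr p \<Gamma>)
  from Contr.IH[of r] show ?case by (auto intro: proves.Contr simp: Neg_def)
next
  case (ForallI \<Gamma> p)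
  have "ren (case_nat 0 (Suc \<circ> r)) ` shift 0 ` \<Gamma> = shift 0 ` ren r ` \<Gamma>"
    by (auto simp: image_image shift_def ren_ren comp_def)
  with ForallI.IH[of "case_nat 0 (Suc \<circ> r)"] show ?case by (auto intro: proves.ForallI)
next
  case (ForallE \<Gamma> p j)
  have "ren r (inst j p) = inst (r j) (ren (case_nat 0 (Suc \<circ> r)) p)"
    unfolding inst_def ren_ren
    by (rule ren_cong) (auto split: nat.split)
  then show ?case using proves.ForallE[of "ren r ` \<Gamma>" _ "r j"] ForallE.IH[of r] by simp
next
  case (EqE \<Gamma> i j p)
  have *: "ren r (inst j p) = inst (r j) (ren (case_nat 0 (Suc \<circ> r)) p)" for j
    unfolding inst_def ren_ren
    by (rule ren_cong) (auto split: nat.split)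
  from EqE.IH[of r] show ?case unfolding * by (auto intro: proves.EqE)
qed (auto intro: proves.intros)

text \<open>Contexts may be infinite; this brings an inconsistency of the union of the Henkin chain
  down to a single stage.\<close>

lemma proves_finite: "\<Gamma> \<turnstile> p \<Longrightarrow> \<exists>\<Delta>. finite \<Delta> \<and> \<Delta> \<subseteq> \<Gamma> \<and> (\<Delta> \<turnstile> p)"
proof (induction rule: proves.induct)
  case (Assm p \<Gamma>)
  then show ?case by (intro exI[of _ "{p}"]) (auto intro: proves.Assm)
next
  case (ImpI p \<Gamma> q)
  then obtain \<Delta> where "finite \<Delta>" "\<Delta> \<subseteq> insert p \<Gamma>" "\<Delta> \<turnstile> q" by blast
  then have "finite (\<Delta> - {p})" "\<Delta> - {p} \<subseteq> \<Gamma>" "insert p (\<Delta> - {p}) \<turnstile> q"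
    by (auto intro: weakening)
  then show ?case using proves.ImpI by blast
next
  case (ImpE \<Gamma> p q)
  then obtain \<Delta> \<Delta>' where "finite \<Delta>" "\<Delta> \<subseteq> \<Gamma>" "\<Delta> \<turnstile> (p \<^bold>\<longrightarrow> q)" "finite \<Delta>'" "\<Delta>' \<subseteq> \<Gamma>" "\<Delta>' \<turnstile> p" by blast
  then show ?case
    by (intro exI[of _ "\<Delta> \<union> \<Delta>'"]) (auto intro: proves.ImpE[of _ p] weakening)
next
  case (Contr p \<Gamma>)
  then obtain \<Delta> where "finite \<Delta>" "\<Delta> \<subseteq> insert (\<^bold>\<not> p) \<Gamma>" "\<Delta> \<turnstile> \<^bold>\<bottom>" by blast
  then have "finite (\<Delta> - {\<^bold>\<not> p})" "\<Delta> - {\<^bold>\<not> p} \<subseteq> \<Gamma>" "insert (\<^bold>\<not> p) (\<Delta> - {\<^bold>\<not> p}) \<turnstile> \<^bold>\<bottom>"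
    by (auto intro: weakening)
  then show ?case using proves.Contr by blast
next
  case (ForallI \<Gamma> p)
  then obtain \<Delta> where "finite \<Delta>" "\<Delta> \<subseteq> shift 0 ` \<Gamma>" "\<Delta> \<turnstile> p" by blast
  moreover from this obtain \<Delta>' where "finite \<Delta>'" "\<Delta>' \<subseteq> \<Gamma>" "\<Delta> = shift 0 ` \<Delta>'"
    using finite_subset_image by metis
  ultimately show ?case by (auto intro: proves.ForallI)
next
  case (ForallE \<Gamma> p j)
  then show ?case by (auto intro: proves.ForallE)
next
  case (EqI \<Gamma> i)
  then show ?case by (auto intro: proves.EqI)
next
  case (EqE \<Gamma> i j p)
  then obtain \<Delta> \<Delta>' where "finite \<Delta>" "\<Delta> \<subseteq> \<Gamma>" "\<Delta> \<turnstile> (i \<^bold>= j)" "finite \<Delta>'" "\<Delta>' \<subseteq> \<Gamma>" "\<Delta>' \<turnstile> inst i p" by blast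
  then show ?case
    by (intro exI[of _ "\<Delta> \<union> \<Delta>'"]) (auto intro: proves.EqE[of _ i] weakening)
qed

section \<open>Henkin extensions and the term model\<close>

definition consistent :: "fm set \<Rightarrow> bool"
  where "consistent \<Gamma> \<longleftrightarrow> \<not> (\<Gamma> \<turnstile> \<^bold>\<bottom>)"

text \<open>If the new witness were refuted, the context would prove \<open>inst j q\<close>. The
  renaming \<open>?k\<close> sends \<open>j\<close> to 0 and raises all other variables, so it acts
  as \<open>shift 0\<close> on formulas without \<open>j\<close> and turns \<open>inst j q\<close>
  back into \<open>q\<close>. The renamed derivation is the premise of
  \<open>ForallI\<close>.\<close>

lemma consistent_witness:
  assumes "consistent (insert (\<^bold>\<not> Forall q) \<Delta>)" and fresh: "\<And>p. p \<in> insert (Forall q) \<Delta> \<Longrightarrow> j \<notin> fv p"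
  shows "consistent (insert (\<^bold>\<not> inst j q) (insert (\<^bold>\<not> Forall q) \<Delta>))"
  unfolding consistent_def
proof
  let ?\<Delta> = "insert (\<^bold>\<not> Forall q) \<Delta>" and ?k = "\<lambda>i. if i = j then 0 else Suc i"
  assume "insert (\<^bold>\<not> inst j q) ?\<Delta> \<turnstile> \<^bold>\<bottom>"
  then have "ren ?k ` ?\<Delta> \<turnstile> ren ?k (inst j q)"
    using proves.Contr proves_ren by blast
  moreover have "ren ?k ` ?\<Delta> = shift 0 ` ?\<Delta>"
  proof (rule image_cong)
    fix p assume "p \<in> ?\<Delta>"
    then have "j \<notin> fv p" using fresh[of p] fresh[of "Forall q"] by (auto simp: Neg_def)
    then show "ren ?k p = shift 0 p" unfolding shift_def by (intro ren_cong) auto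
  qed simp
  moreover have "ren ?k (inst j q) = ren id q"
    unfolding inst_def ren_ren
    by (rule ren_cong) (use fresh[of "Forall q"] in \<open>auto split: nat.split\<close>)
  ultimately have "?\<Delta> \<turnstile> Forall q" by (auto simp: ren_id intro: proves.ForallI)
  moreover have "?\<Delta> \<turnstile> (Forall q \<^bold>\<longrightarrow> \<^bold>\<bottom>)" by (auto intro: proves.Assm simp: Neg_def)
  ultimately show False using assms(1) proves.ImpE unfolding consistent_def by blast
qed

text \<open>The language has no constants, so variables act as Henkin witnesses and the model
  consists of variables modulo provable equality.\<close>

locale henkin =
  fixes \<Omega> :: "fm set"
  assumes consistent: "consistent \<Omega>"
    and maximal: "\<And>p. consistent (insert p \<Omega>) \<Longrightarrow> p \<in> \<Omega>"
    and witnesses: "\<And>q. (\<^bold>\<not> Forall q) \<in> \<Omega> \<Longrightarrow> \<exists>j. (\<^bold>\<not> inst j q) \<in> \<Omega>"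
begin

lemma proves_iff: "(\<Omega> \<turnstile> p) \<longleftrightarrow> p \<in> \<Omega>"
proof
  assume p: "\<Omega> \<turnstile> p"
  have "\<not> (insert p \<Omega> \<turnstile> \<^bold>\<bottom>)"
    using p consistent proves.ImpI proves.ImpE unfolding consistent_def by blast
  then show "p \<in> \<Omega>" by (simp add: maximal consistent_def)
qed (rule proves.Assm)

lemma neg_iff: "(\<^bold>\<not> p) \<in> \<Omega> \<longleftrightarrow> p \<notin> \<Omega>"
proof
  assume "(\<^bold>\<not> p) \<in> \<Omega>"
  then show "p \<notin> \<Omega>"
    using consistent proves.ImpE proves.Assm unfolding consistent_def Neg_def by blast
next
  assume "p \<notin> \<Omega>"
  then have "insert p \<Omega> \<turnstile> \<^bold>\<bottom>" using maximal unfolding consistent_def by blast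
  then show "(\<^bold>\<not> p) \<in> \<Omega>" using proves.ImpI proves_iff unfolding Neg_def by blast
qed

lemma imp_iff: "(p \<^bold>\<longrightarrow> q) \<in> \<Omega> \<longleftrightarrow> (p \<in> \<Omega> \<longrightarrow> q \<in> \<Omega>)"
proof (intro iffI impI)
  show "q \<in> \<Omega>" if "(p \<^bold>\<longrightarrow> q) \<in> \<Omega>" "p \<in> \<Omega>"
    using that proves.ImpE proves_iff by blast
  assume pq: "p \<in> \<Omega> \<longrightarrow> q \<in> \<Omega>"
  have "insert p \<Omega> \<turnstile> q"
  proof (cases "p \<in> \<Omega>")
    case True
    then show ?thesis using pq by (auto intro: proves.Assm)
  next
    case False
    then have "(p \<^bold>\<longrightarrow> \<^bold>\<bottom>) \<in> \<Omega>" using neg_iff[of p] by (simp add: Neg_def)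
    then have "insert (\<^bold>\<not> q) (insert p \<Omega>) \<turnstile> (p \<^bold>\<longrightarrow> \<^bold>\<bottom>)" by (intro proves.Assm) simp
    moreover have "insert (\<^bold>\<not> q) (insert p \<Omega>) \<turnstile> p" by (intro proves.Assm) simp
    ultimately show ?thesis by (rule proves.Contr[OF proves.ImpE])
  qed
  then show "(p \<^bold>\<longrightarrow> q) \<in> \<Omega>" using proves.ImpI proves_iff by blast
qed

lemma forall_iff: "Forall p \<in> \<Omega> \<longleftrightarrow> (\<forall>j. inst j p \<in> \<Omega>)"
  using proves.ForallE proves_iff witnesses neg_iff by blast

lemma eq_refl: "(i \<^bold>= i) \<in> \<Omega>"
  using proves.EqI proves_iff by blast

lemma eq_subst: "(i \<^bold>= j) \<in> \<Omega> \<Longrightarrow> inst i p \<in> \<Omega> \<Longrightarrow> inst j p \<in> \<Omega>"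
  using proves.EqE proves_iff by blast

lemma eq_sym: "(i \<^bold>= j) \<in> \<Omega> \<Longrightarrow> (j \<^bold>= i) \<in> \<Omega>"
  using eq_subst[of i j "0 \<^bold>= Suc i"] eq_refl by (simp add: inst_def)

lemma eq_trans: "(i \<^bold>= j) \<in> \<Omega> \<Longrightarrow> (j \<^bold>= k) \<in> \<Omega> \<Longrightarrow> (i \<^bold>= k) \<in> \<Omega>"
  using eq_subst[of j k "Suc i \<^bold>= 0"] by (simp add: inst_def)

lemma mem_cong: "(i \<^bold>= i') \<in> \<Omega> \<Longrightarrow> (j \<^bold>= j') \<in> \<Omega> \<Longrightarrow> (i \<^bold>\<in> j) \<in> \<Omega> \<Longrightarrow> (i' \<^bold>\<in> j') \<in> \<Omega>"
  using eq_subst[of i i' "0 \<^bold>\<in> Suc j"] eq_subst[of j j' "Suc i' \<^bold>\<in> 0"] by (simp add: inst_def)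

text \<open>The least representative of a class realizes the quotient inside the natural numbers,
  from where an injection carries it into the given type.\<close>

definition rep :: "nat \<Rightarrow> nat"
  where "rep i = (LEAST j. (i \<^bold>= j) \<in> \<Omega>)"

lemma rep_eq_iff: "rep i = rep j \<longleftrightarrow> (i \<^bold>= j) \<in> \<Omega>"
proof
  have *: "(i \<^bold>= rep i) \<in> \<Omega>" for i unfolding rep_def using eq_refl LeastI by metis
  show "(i \<^bold>= j) \<in> \<Omega>" if "rep i = rep j" using that * eq_sym eq_trans by metis
  assume "(i \<^bold>= j) \<in> \<Omega>"
  then have "(i \<^bold>= k) \<in> \<Omega> \<longleftrightarrow> (j \<^bold>= k) \<in> \<Omega>" for k using eq_sym eq_trans by blast
  then show "rep i = rep j" by (simp add: rep_def)
qed

text \<open>Generality in \<open>r\<close> lets the induction pass the quantifier: every element of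
  the carrier is named by a variable, so quantifying over the carrier amounts to quantifying over
  the instances \<open>inst j\<close>.\<close>

lemma truth:
  fixes f :: "nat \<Rightarrow> 'a"
  assumes "inj f"
  defines "g \<equiv> f \<circ> rep"
  defines "E \<equiv> \<lambda>a b. \<exists>i j. a = g i \<and> b = g j \<and> (i \<^bold>\<in> j) \<in> \<Omega>"
  shows "sat (range g) E (g \<circ> r) p \<longleftrightarrow> ren r p \<in> \<Omega>"
proof (induction p arbitrary: r)
  case (Mem i j)
  have g: "g i = g j \<longleftrightarrow> (i \<^bold>= j) \<in> \<Omega>" for i j
    using assms(1) by (auto simp: g_def inj_eq rep_eq_iff)
  have "E (g i) (g j) \<longleftrightarrow> (i \<^bold>\<in> j) \<in> \<Omega>" for i j
    unfolding E_def g using mem_cong eq_sym eq_refl by blast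
  then show ?case by simp
next
  case (Eq i j)
  show ?case using assms(1) by (auto simp: g_def inj_eq rep_eq_iff)
next
  case Fls
  then show ?case using consistent proves.Assm by (auto simp: consistent_def)
next
  case (Imp p q)
  then show ?case by (simp add: imp_iff)
next
  case (Forall p)
  have "sat (range g) E (case_nat (g j) (g \<circ> r)) p \<longleftrightarrow> inst j (ren (case_nat 0 (Suc \<circ> r)) p) \<in> \<Omega>" for j
  proof -
    have 1: "case_nat (g j) (g \<circ> r) = g \<circ> case_nat j r"
      by (auto simp: fun_eq_iff split: nat.split)
    have "inst j (ren (case_nat 0 (Suc \<circ> r)) p) = ren (case_nat j r) p"
      unfolding inst_def ren_ren by (rule ren_cong) (auto split: nat.split)
    then show ?thesis by (simp add: 1 Forall.IH)
  qed
  then show ?case by (simp add: forall_iff comp_def)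
qed

end

text \<open>Stage \<open>n\<close> decides the formula with code \<open>n\<close>, so countability
  of the syntax is what makes the limit maximal. Taking the least fresh variable makes the witness a
  function of the stage.\<close>

primrec henkin_chain :: "fm set \<Rightarrow> nat \<Rightarrow> fm set" where
  "henkin_chain \<Gamma> 0 = \<Gamma>"
| "henkin_chain \<Gamma> (Suc n) =
    (let \<Delta> = henkin_chain \<Gamma> n; p = from_nat n in
      if \<not> consistent (insert p \<Delta>) then \<Delta>
      else insert p \<Delta> \<union>
        {\<^bold>\<not> inst j q | j q. p = (\<^bold>\<not> Forall q) \<and> j = (LEAST j. \<forall>p\<in>insert p \<Delta>. j \<notin> fv p)})"

lemma henkin_extension:
  assumes "consistent \<Gamma>" "\<And>p. p \<in> \<Gamma> \<Longrightarrow> sentence p"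
  obtains \<Omega> where "henkin \<Omega>" "\<Gamma> \<subseteq> \<Omega>"
proof -
  let ?C = "henkin_chain \<Gamma>"
  let ?j = "\<lambda>p \<Delta>. (LEAST j. \<forall>p\<in>insert p \<Delta>. j \<notin> fv p)"
  have fresh: "\<forall>q\<in>insert p \<Delta>. ?j p \<Delta> \<notin> fv q" if "finite (\<Union>(fv ` \<Delta>))" for p \<Delta>
  proof -
    have "finite (\<Union>(fv ` insert p \<Delta>))" using that finite_fv by simp
    then have "\<exists>j. j \<notin> \<Union>(fv ` insert p \<Delta>)"
      using ex_new_if_finite infinite_UNIV_nat by blast
    then have "\<exists>j. \<forall>p\<in>insert p \<Delta>. j \<notin> fv p" by blast
    then show ?thesis using LeastI_ex[of "\<lambda>j. \<forall>p\<in>insert p \<Delta>. j \<notin> fv p"] by blast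
  qed
  have Suc1: "?C n \<subseteq> ?C (Suc n)" for n by (auto simp: Let_def)
  have mono: "?C m \<subseteq> ?C n" if "m \<le> n" for m n using that Suc1 lift_Suc_mono_le by metis
  \<comment> \<open>Finiteness of the free variables belongs to the invariant because it supplies
    the next fresh variable. It holds at the start because sentences have none, and each stage adds
    at most two formulas.\<close>
  have inv: "consistent (?C n) \<and> finite (\<Union>(fv ` ?C n))" for n
  proof (induction n)
    case 0
    have "\<Union>(fv ` \<Gamma>) = {}" using assms(2) by (auto simp: sentence_def)
    then have "finite (\<Union>(fv ` \<Gamma>))" by (metis finite.emptyI)
    then show ?case using assms(1) by simp
  next
    case (Suc n)
    let ?p = "from_nat n :: fm" and ?\<Delta> = "?C n"
    show ?case
    proof (cases "consistent (insert ?p ?\<Delta>)")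
      case con: True
      show ?thesis
      proof (cases "\<exists>q. ?p = (\<^bold>\<not> Forall q)")
        case True
        then obtain q where q: "?p = (\<^bold>\<not> Forall q)" ..
        have eq: "?C (Suc n) = insert (\<^bold>\<not> inst (?j ?p ?\<Delta>) q) (insert ?p ?\<Delta>)"
          using con q by (auto simp: Let_def Neg_def)
        have "consistent (insert (\<^bold>\<not> inst (?j ?p ?\<Delta>) q) (insert ?p ?\<Delta>))"
          unfolding q by (rule consistent_witness)
            (use con q fresh[of ?\<Delta> ?p] Suc in \<open>auto simp: Neg_def\<close>)
        then show ?thesis unfolding eq using Suc finite_fv by simp
      next
        case False
        then have "?C (Suc n) = insert ?p ?\<Delta>" using con by (auto simp: Let_def)
        then show ?thesis using con Suc finite_fv by simp
      qed
    next
      case False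
      then show ?thesis using Suc by simp
    qed
  qed
  define \<Omega> where "\<Omega> = (\<Union>n. ?C n)"
  have fin: "\<exists>n. \<Delta> \<subseteq> ?C n" if "finite \<Delta>" "\<Delta> \<subseteq> \<Omega>" for \<Delta>
    using that
  proof (induction rule: finite_induct)
    case (insert p \<Delta>)
    then obtain m n where "\<Delta> \<subseteq> ?C m" "p \<in> ?C n" by (auto simp: \<Omega>_def)
    then have "insert p \<Delta> \<subseteq> ?C (max m n)" using mono[of m "max m n"] mono[of n "max m n"] by auto
    then show ?case ..
  qed simp
  have "henkin \<Omega>"
  proof
    show "consistent \<Omega>"
      unfolding consistent_def
    proof
      assume "\<Omega> \<turnstile> \<^bold>\<bottom>"
      then obtain n where "?C n \<turnstile> \<^bold>\<bottom>" using proves_finite fin weakening by meson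
      then show False using inv by (auto simp: consistent_def)
    qed
    have con: "consistent (insert p (?C n))" if "consistent (insert p \<Omega>)" for p n
    proof -
      have "insert p (?C n) \<subseteq> insert p \<Omega>" by (auto simp: \<Omega>_def)
      then show ?thesis using that weakening unfolding consistent_def by blast
    qed
    show max: "p \<in> \<Omega>" if "consistent (insert p \<Omega>)" for p
    proof -
      have "p \<in> ?C (Suc (to_nat p))" using con[OF that, of "to_nat p"] by (simp add: Let_def)
      then show ?thesis unfolding \<Omega>_def by blast
    qed
    show "\<exists>j. (\<^bold>\<not> inst j q) \<in> \<Omega>" if "(\<^bold>\<not> Forall q) \<in> \<Omega>" for q
    proof -
      have "consistent (insert (\<^bold>\<not> Forall q) \<Omega>)"
        using that \<open>consistent \<Omega>\<close> by (simp add: insert_absorb)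
      then have "\<exists>j. (\<^bold>\<not> inst j q) \<in> ?C (Suc (to_nat (\<^bold>\<not> Forall q)))"
        using con[of "\<^bold>\<not> Forall q" "to_nat (\<^bold>\<not> Forall q)"] by (auto simp: Let_def)
      then show ?thesis by (auto simp: \<Omega>_def simp del: henkin_chain.simps)
    qed
  qed
  moreover have "?C 0 \<subseteq> \<Omega>" unfolding \<Omega>_def by blast
  then have "\<Gamma> \<subseteq> \<Omega>" by simp
  ultimately show ?thesis by (rule that)
qed

text \<open>The infinite type is needed only to inject the variables into it. A sentence is fixed by
  every renaming, so \<open>truth\<close> decides it under all assignments at once.\<close>

lemma completeness:
  assumes "\<not> (\<Gamma> \<turnstile> p)" "sentence p" "\<And>q. q \<in> \<Gamma> \<Longrightarrow> sentence q" and inf: "infinite (UNIV :: 'a set)"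
  obtains M :: "'a set" and E where "is_model M E (insert (\<^bold>\<not> p) \<Gamma>)"
proof -
  have "consistent (insert (\<^bold>\<not> p) \<Gamma>)"
    using assms(1) proves.Contr unfolding consistent_def by blast
  moreover have "sentence q" if "q \<in> insert (\<^bold>\<not> p) \<Gamma>" for q
    using that assms(2,3) by (auto simp: sentence_def Neg_def)
  ultimately obtain \<Omega> where \<Omega>: "henkin \<Omega>" "insert (\<^bold>\<not> p) \<Gamma> \<subseteq> \<Omega>"
    using henkin_extension by blast
  obtain f :: "nat \<Rightarrow> 'a" where f: "inj f"
    using infinite_countable_subset[OF inf] by blast
  interpret henkin \<Omega> by fact
  let ?g = "f \<circ> rep"
  have "is_model (range ?g) (\<lambda>a b. \<exists>i j. a = ?g i \<and> b = ?g j \<and> (i \<^bold>\<in> j) \<in> \<Omega>) (insert (\<^bold>\<not> p) \<Gamma>)"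
    unfolding is_model_def
  proof (intro conjI ballI allI impI)
    fix q and e :: "nat \<Rightarrow> 'a" assume q: "q \<in> insert (\<^bold>\<not> p) \<Gamma>" and e: "range e \<subseteq> range ?g"
    then have "\<forall>i. \<exists>j. e i = ?g j" by auto
    then obtain r where r: "\<And>i. e i = ?g (r i)" by metis
    have "ren r q = q"
    proof -
      have "fv q = {}"
        using q \<open>\<And>q. q \<in> insert (\<^bold>\<not> p) \<Gamma> \<Longrightarrow> sentence q\<close> unfolding sentence_def by blast
      then have "ren r q = ren id q" by (intro ren_cong) auto
      then show ?thesis by (simp add: ren_id)
    qed
    moreover have "e = ?g \<circ> r" using r by auto
    ultimately show "sat (range ?g) (\<lambda>a b. \<exists>i j. a = ?g i \<and> b = ?g j \<and> (i \<^bold>\<in> j) \<in> \<Omega>) e q"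
      using truth[OF f, of r q] q \<Omega>(2) by auto
  qed simp
  then show ?thesis by (rule that)
qed

section \<open>The axioms of ZF in terms of extensions\<close>

definition Env :: "'a set \<Rightarrow> (nat \<Rightarrow> 'a) set"
  where "Env V = {e. \<forall>i. e i \<in> V}"

lemma Env_nth: "e \<in> Env V \<Longrightarrow> e i \<in> V"
  by (simp add: Env_def)

lemma Env_case_nat [simp]: "case_nat x e \<in> Env V \<longleftrightarrow> x \<in> V \<and> e \<in> Env V"
  by (force simp: Env_def split: nat.split_asm nat.split)

lemma Env_const [simp]: "(\<lambda>_. a) \<in> Env V \<longleftrightarrow> a \<in> V"
  by (simp add: Env_def)

lemma Env_ren: "e \<in> Env V \<Longrightarrow> (\<lambda>i. e (k i)) \<in> Env V"
  by (simp add: Env_def)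

locale struct =
  fixes V :: "'a set" and E :: "'a \<Rightarrow> 'a \<Rightarrow> bool"
begin

definition ext :: "'a \<Rightarrow> 'a set"
  where "ext a = {x \<in> V. E x a}"

lemma ext_subset: "ext a \<subseteq> V"
  by (auto simp: ext_def)

lemma extD: "x \<in> ext a \<Longrightarrow> x \<in> V"
  by (simp add: ext_def)

lemma sat_empty: "e x \<in> V \<Longrightarrow> sat V E e (fm_empty x) \<longleftrightarrow> ext (e x) = {}"
  by (auto simp: fm_empty_def ext_def)

lemma sat_subset: "sat V E e (fm_subset x y) \<longleftrightarrow> ext (e x) \<subseteq> ext (e y)"
  by (auto simp: fm_subset_def ext_def)

lemma sat_succ:
  "e x \<in> V \<Longrightarrow> sat V E e (fm_succ x y) \<longleftrightarrow> ext (e y) = insert (e x) (ext (e x))"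
  by (auto simp: fm_succ_def ext_def)

lemma sat_upair:
  "e x \<in> V \<Longrightarrow> e y \<in> V \<Longrightarrow> sat V E e (fm_upair x y z) \<longleftrightarrow> ext (e z) = {e x, e y}"
  by (auto simp: fm_upair_def ext_def)

lemma sat_Exists1:
  "sat V E e (Exists1 p) \<longleftrightarrow> (\<exists>!y. y \<in> V \<and> sat V E (case_nat y e) p)"
proof -
  have "(\<lambda>i. case_nat y (case_nat x e) (if i < 1 then i else Suc i)) = case_nat y e" for x y
    by (auto simp: fun_eq_iff split: nat.split)
  then have "sat V E (case_nat y (case_nat x e)) (shift 1 p) \<longleftrightarrow> sat V E (case_nat y e) p" for x y
    by (simp add: sat_shift)
  then have "sat V E e (Exists1 p) \<longleftrightarrow> (\<exists>x\<in>V. \<forall>y\<in>V. sat V E (case_nat y e) p \<longleftrightarrow> y = x)"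
    by (simp add: Exists1_def)
  then show ?thesis by (auto 0 4)
qed

definition separation :: "fm \<Rightarrow> bool" where
  "separation p \<longleftrightarrow> (\<forall>e\<in>Env V. \<forall>a\<in>V. \<exists>b\<in>V.
    ext b = {x \<in> ext a. sat V E (case_nat x (case_nat a e)) p})"

definition replacement :: "fm \<Rightarrow> bool" where
  "replacement p \<longleftrightarrow> (\<forall>e\<in>Env V. \<forall>a\<in>V.
    (\<forall>x\<in>ext a. \<exists>!y. y \<in> V \<and> sat V E (case_nat y (case_nat x (case_nat a e))) p) \<longrightarrow>
    (\<exists>b\<in>V. \<forall>x\<in>ext a. \<exists>y\<in>ext b. sat V E (case_nat y (case_nat x (case_nat a e))) p))"

lemma sat_separation:
  "(\<forall>q\<in>universal_closures (ax_separation p). \<forall>e. (\<forall>i. e i \<in> V) \<longrightarrow> sat V E e q) \<longleftrightarrow> separation p"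
proof -
  have "(\<lambda>i. case_nat x (case_nat b (case_nat a e)) (if i < 1 then i else Suc i)) = case_nat x (case_nat a e)"
    for x a b and e :: "nat \<Rightarrow> 'a"
    by (auto simp: fun_eq_iff split: nat.split)
  then have "sat V E (case_nat x (case_nat b (case_nat a e))) (shift 1 p) \<longleftrightarrow> sat V E (case_nat x (case_nat a e)) p"
    for x a b e by (simp add: sat_shift)
  moreover have "ext b = {x \<in> ext a. Q x} \<longleftrightarrow> (\<forall>x\<in>V. E x b \<longleftrightarrow> E x a \<and> Q x)" for a b Q
    by (auto simp: ext_def)
  ultimately show ?thesis
    unfolding sat_universal_closures separation_def
    by (simp add: ax_separation_def Env_def eval_nat_numeral)
qed

lemma sat_replacement:
  "(\<forall>q\<in>universal_closures (ax_replacement p). \<forall>e. (\<forall>i. e i \<in> V) \<longrightarrow> sat V E e q) \<longleftrightarrow> replacement p"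
proof -
  have "(\<lambda>i. case_nat y (case_nat x (case_nat b (case_nat a e))) (if i < 2 then i else Suc i))
      = case_nat y (case_nat x (case_nat a e))"
    for x y a b and e :: "nat \<Rightarrow> 'a"
    by (auto simp: fun_eq_iff split: nat.split)
  then have "sat V E (case_nat y (case_nat x (case_nat b (case_nat a e)))) (shift 2 p)
      \<longleftrightarrow> sat V E (case_nat y (case_nat x (case_nat a e))) p"
    for x y a b e by (simp add: sat_shift)
  then show ?thesis
    unfolding sat_universal_closures replacement_def
    by (simp add: ax_replacement_def Env_def ext_def sat_Exists1 eval_nat_numeral)
      (simp add: Ball_def Bex_def conj_assoc imp_conjL)
qed

end

locale ZF_axioms = struct +
  assumes nonempty: "V \<noteq> {}"
    and extensionality: "\<And>a b. a \<in> V \<Longrightarrow> b \<in> V \<Longrightarrow> ext a = ext b \<Longrightarrow> a = b"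
    and foundation: "\<And>a. a \<in> V \<Longrightarrow> ext a \<noteq> {} \<Longrightarrow> \<exists>x\<in>ext a. ext x \<inter> ext a = {}"
    and pairing: "\<And>a b. a \<in> V \<Longrightarrow> b \<in> V \<Longrightarrow> \<exists>c\<in>V. ext c = {a, b}"
    and union: "\<And>a. a \<in> V \<Longrightarrow> \<exists>c\<in>V. ext c = \<Union>(ext ` ext a)"
    and power_set: "\<And>a. a \<in> V \<Longrightarrow> \<exists>c\<in>V. ext c = {x \<in> V. ext x \<subseteq> ext a}"
    and infinity: "\<exists>w\<in>V. (\<exists>z\<in>ext w. ext z = {}) \<and> (\<forall>x\<in>ext w. \<exists>y\<in>ext w. ext y = insert x (ext x))"
    and separation: "\<And>p. separation p"
    and replacement: "\<And>p. replacement p"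

context struct begin

lemma is_model_iff:
  assumes "V \<noteq> {}"
  shows "is_model V E ZF \<longleftrightarrow> ZF_axioms V E"
proof -
  obtain v where v: "v \<in> V" using assms by blast
  have S: "(\<forall>e. (\<forall>i. e i \<in> V) \<longrightarrow> sat V E e p) \<longleftrightarrow> A"
    if "\<And>e. (\<forall>i. e i \<in> V) \<Longrightarrow> sat V E e p \<longleftrightarrow> A" for p A
    using that that[of "\<lambda>_. v"] v by (intro iffI) auto
  have 1: "(\<forall>e. (\<forall>i. e i \<in> V) \<longrightarrow> sat V E e ax_extensionality)
      \<longleftrightarrow> (\<forall>a\<in>V. \<forall>b\<in>V. ext a = ext b \<longrightarrow> a = b)"
    by (rule S) (auto simp: ax_extensionality_def ext_def set_eq_iff eval_nat_numeral)
  have 2: "(\<forall>e. (\<forall>i. e i \<in> V) \<longrightarrow> sat V E e ax_foundation)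
      \<longleftrightarrow> (\<forall>a\<in>V. ext a \<noteq> {} \<longrightarrow> (\<exists>x\<in>ext a. ext x \<inter> ext a = {}))"
    by (rule S) (auto simp: ax_foundation_def sat_empty ext_def set_eq_iff eval_nat_numeral; blast)
  have 3: "(\<forall>e. (\<forall>i. e i \<in> V) \<longrightarrow> sat V E e ax_pairing)
      \<longleftrightarrow> (\<forall>a\<in>V. \<forall>b\<in>V. \<exists>c\<in>V. ext c = {a, b})"
    by (rule S) (auto simp: ax_pairing_def sat_upair eval_nat_numeral)
  have 4: "(\<forall>e. (\<forall>i. e i \<in> V) \<longrightarrow> sat V E e ax_union)
      \<longleftrightarrow> (\<forall>a\<in>V. \<exists>c\<in>V. ext c = \<Union>(ext ` ext a))"
  proof (rule S)
    have "ext c = \<Union>(ext ` ext a) \<longleftrightarrow> (\<forall>x\<in>V. E x c \<longleftrightarrow> (\<exists>y\<in>V. E y a \<and> E x y))" for a c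
      by (auto simp: ext_def)
    then show "sat V E e ax_union \<longleftrightarrow> (\<forall>a\<in>V. \<exists>c\<in>V. ext c = \<Union>(ext ` ext a))" for e
      by (simp add: ax_union_def eval_nat_numeral)
  qed
  have 5: "(\<forall>e. (\<forall>i. e i \<in> V) \<longrightarrow> sat V E e ax_power_set)
      \<longleftrightarrow> (\<forall>a\<in>V. \<exists>c\<in>V. ext c = {x \<in> V. ext x \<subseteq> ext a})"
  proof (rule S)
    have "ext c = {x \<in> V. ext x \<subseteq> ext a} \<longleftrightarrow> (\<forall>x\<in>V. E x c \<longleftrightarrow> ext x \<subseteq> ext a)" for a c
      by (auto simp: ext_def[of c])
    then show "sat V E e ax_power_set \<longleftrightarrow> (\<forall>a\<in>V. \<exists>c\<in>V. ext c = {x \<in> V. ext x \<subseteq> ext a})" for e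
      by (simp add: ax_power_set_def sat_subset eval_nat_numeral)
  qed
  have 6: "(\<forall>e. (\<forall>i. e i \<in> V) \<longrightarrow> sat V E e ax_infinity) \<longleftrightarrow> (\<exists>w\<in>V.
      (\<exists>z\<in>ext w. ext z = {}) \<and> (\<forall>x\<in>ext w. \<exists>y\<in>ext w. ext y = insert x (ext x)))"
  proof (rule S)
    have "(\<exists>x\<in>ext w. P x) \<longleftrightarrow> (\<exists>x\<in>V. E x w \<and> P x)" "(\<forall>x\<in>ext w. P x) \<longleftrightarrow> (\<forall>x\<in>V. E x w \<longrightarrow> P x)" for w P
      by (auto simp: ext_def)
    then show "sat V E e ax_infinity \<longleftrightarrow> (\<exists>w\<in>V. (\<exists>z\<in>ext w. ext z = {}) \<and>
        (\<forall>x\<in>ext w. \<exists>y\<in>ext w. ext y = insert x (ext x)))" for e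
      by (simp add: ax_infinity_def sat_empty sat_succ)
  qed
  have "is_model V E ZF \<longleftrightarrow> (\<forall>p\<in>ZF. \<forall>e. (\<forall>i. e i \<in> V) \<longrightarrow> sat V E e p)"
    using assms by (auto simp: is_model_def image_subset_iff)
  also have "\<dots> \<longleftrightarrow>
      (\<forall>a\<in>V. \<forall>b\<in>V. ext a = ext b \<longrightarrow> a = b) \<and>
      (\<forall>a\<in>V. ext a \<noteq> {} \<longrightarrow> (\<exists>x\<in>ext a. ext x \<inter> ext a = {})) \<and>
      (\<forall>a\<in>V. \<forall>b\<in>V. \<exists>c\<in>V. ext c = {a, b}) \<and>
      (\<forall>a\<in>V. \<exists>c\<in>V. ext c = \<Union>(ext ` ext a)) \<and>
      (\<forall>a\<in>V. \<exists>c\<in>V. ext c = {x \<in> V. ext x \<subseteq> ext a}) \<and>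
      (\<exists>w\<in>V. (\<exists>z\<in>ext w. ext z = {}) \<and> (\<forall>x\<in>ext w. \<exists>y\<in>ext w. ext y = insert x (ext x))) \<and>
      (\<forall>p. separation p) \<and> (\<forall>p. replacement p)"
    unfolding 1[symmetric] 2[symmetric] 3[symmetric] 4[symmetric] 5[symmetric] 6[symmetric]
      sat_separation[symmetric] sat_replacement[symmetric] ZF_def
    by blast
  also have "\<dots> \<longleftrightarrow> ZF_axioms V E"
    unfolding ZF_axioms_def using assms by (simp add: Ball_def)
  finally show ?thesis .
qed

end

section \<open>Definability with parameters\<close>

abbreviation asg :: "(nat \<Rightarrow> 'a) \<Rightarrow> (nat \<Rightarrow> nat + 'a) \<Rightarrow> nat \<Rightarrow> 'a"
  where "asg e r \<equiv> \<lambda>i. case_sum e (\<lambda>c. c) (r i)"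

context struct begin

text \<open>A predicate on assignments is definable from the parameters \<open>K\<close> if it is given by a formula
  each of whose free variables stands for a position in the assignment or for an element of \<open>K\<close>.\<close>

definition pd :: "'a set \<Rightarrow> ((nat \<Rightarrow> 'a) \<Rightarrow> bool) \<Rightarrow> bool" where
  "pd K P \<longleftrightarrow> (\<exists>p r. (\<forall>i c. r i = Inr c \<longrightarrow> c \<in> K \<and> c \<in> V) \<and>
    (\<forall>e\<in>Env V. P e \<longleftrightarrow> sat V E (asg e r) p))"

text \<open>Definability of the graph, with the value at position 0 and the arguments moved up by
  one, as under a quantifier.\<close>

definition pf :: "'a set \<Rightarrow> ((nat \<Rightarrow> 'a) \<Rightarrow> 'a) \<Rightarrow> bool" where
  "pf K t \<longleftrightarrow> (\<forall>e\<in>Env V. t e \<in> V) \<and> pd K (\<lambda>e. e 0 = t (\<lambda>i. e (Suc i)))"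

named_theorems pdi

lemma pdI:
  assumes "\<And>i c. r i = Inr c \<Longrightarrow> c \<in> K \<and> c \<in> V"
    and "\<And>e. e \<in> Env V \<Longrightarrow> P e \<longleftrightarrow> sat V E (asg e r) p"
  shows "pd K P"
  using assms unfolding pd_def by blast

lemma pdE:
  assumes "pd K P"
  obtains p r where "\<And>i c. r i = Inr c \<Longrightarrow> c \<in> K \<and> c \<in> V"
    and "\<And>e. e \<in> Env V \<Longrightarrow> P e \<longleftrightarrow> sat V E (asg e r) p"
  using assms unfolding pd_def by blast

lemma pd_cong: "pd K P \<Longrightarrow> (\<And>e. e \<in> Env V \<Longrightarrow> P e \<longleftrightarrow> Q e) \<Longrightarrow> pd K Q"
  by (simp add: pd_def)

text \<open>The parameters are tracked because two uses differ: existence of sets in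
  \<open>V\<close> allows arbitrary parameters, written \<open>UNIV\<close>, whereas membership in
  the enumerated class requires parameters from that class.\<close>

lemma pd_mono: "pd K P \<Longrightarrow> K \<subseteq> L \<Longrightarrow> pd L P"
  unfolding pd_def by blast

lemma pf_mono: "pf K t \<Longrightarrow> K \<subseteq> L \<Longrightarrow> pf L t"
  unfolding pf_def using pd_mono by blast

lemma pd_sat: "pd K (\<lambda>e. sat V E e p)"
  by (rule pdI[where r = Inl and p = p]) auto

lemma pd_subst_sum:
  assumes "pd K P" "\<And>i c. s i = Inr c \<Longrightarrow> c \<in> K \<and> c \<in> V"
  shows "pd K (\<lambda>e. P (asg e s))"
proof -
  from assms(1) obtain p r where r: "\<And>i c. r i = Inr c \<Longrightarrow> c \<in> K \<and> c \<in> V"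
    and p: "\<And>e. e \<in> Env V \<Longrightarrow> P e \<longleftrightarrow> sat V E (asg e r) p" by (rule pdE) blast
  show ?thesis
  proof (rule pdI[where r = "\<lambda>i. case_sum s Inr (r i)" and p = p])
    show "c \<in> K \<and> c \<in> V" if "case_sum s Inr (r i) = Inr c" for i c
      using that r assms(2) by (auto split: sum.split_asm)
    fix e assume e: "e \<in> Env V"
    have "asg e s \<in> Env V"
      using e assms(2) by (auto simp: Env_def split: sum.split)
    moreover have "(\<lambda>i. case_sum (asg e s) (\<lambda>c. c) (r i))
        = (\<lambda>i. case_sum e (\<lambda>c. c) (case_sum s Inr (r i)))"
      by (auto split: sum.split)
    ultimately show "P (asg e s)
        \<longleftrightarrow> sat V E (\<lambda>i. case_sum e (\<lambda>c. c) (case_sum s Inr (r i))) p"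
      using p by simp
  qed
qed

lemma pd_ren: "pd K P \<Longrightarrow> pd K (\<lambda>e. P (\<lambda>i. e (k i)))"
  using pd_subst_sum[of K P "\<lambda>i. Inl (k i)"] by simp

lemma pd_imp [pdi]:
  assumes "pd K P" "pd K Q"
  shows "pd K (\<lambda>e. P e \<longrightarrow> Q e)"
proof -
  from assms(1) obtain p r where r: "\<And>i c. r i = Inr c \<Longrightarrow> c \<in> K \<and> c \<in> V"
    and p: "\<And>e. e \<in> Env V \<Longrightarrow> P e \<longleftrightarrow> sat V E (asg e r) p" by (rule pdE) blast
  from assms(2) obtain q s where s: "\<And>i c. s i = Inr c \<Longrightarrow> c \<in> K \<and> c \<in> V"
    and q: "\<And>e. e \<in> Env V \<Longrightarrow> Q e \<longleftrightarrow> sat V E (asg e s) q" by (rule pdE) blast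
  \<comment> \<open>Interleaving the variables of the two formulas keeps their parameter slots
    apart.\<close>
  let ?t = "\<lambda>i. if even i then r (i div 2) else s (i div 2)"
  show ?thesis
  proof (rule pdI[where r = ?t and p = "ren (\<lambda>i. 2 * i) p \<^bold>\<longrightarrow> ren (\<lambda>i. Suc (2 * i)) q"])
    show "c \<in> K \<and> c \<in> V" if "?t i = Inr c" for i c
      using that r s by (auto split: if_split_asm)
    fix e assume "e \<in> Env V"
    then show "(P e \<longrightarrow> Q e) \<longleftrightarrow> sat V E (asg e ?t)
        (ren (\<lambda>i. 2 * i) p \<^bold>\<longrightarrow> ren (\<lambda>i. Suc (2 * i)) q)"
      by (simp add: p q sat_ren comp_def)
  qed
qed

lemma pd_bool [pdi]: "pd K (\<lambda>e. b)"
  using pd_sat[of K "\<^bold>\<bottom>"] pd_sat[of K "\<^bold>\<bottom> \<^bold>\<longrightarrow> \<^bold>\<bottom>"] by (cases b) auto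

lemma pd_not [pdi]: "pd K P \<Longrightarrow> pd K (\<lambda>e. \<not> P e)"
  using pd_imp[of K P "\<lambda>e. False"] pd_bool by simp

lemma pd_disj [pdi]: "pd K P \<Longrightarrow> pd K Q \<Longrightarrow> pd K (\<lambda>e. P e \<or> Q e)"
  using pd_imp[OF pd_not, of K P Q] by (auto simp: imp_conv_disj)

lemma pd_conj [pdi]: "pd K P \<Longrightarrow> pd K Q \<Longrightarrow> pd K (\<lambda>e. P e \<and> Q e)"
  using pd_not[OF pd_disj[OF pd_not pd_not], of K P Q] by simp

lemma pd_iff [pdi]: "pd K P \<Longrightarrow> pd K Q \<Longrightarrow> pd K (\<lambda>e. P e \<longleftrightarrow> Q e)"
  using pd_conj[OF pd_imp pd_imp, of K P Q Q P] by (simp add: iff_conv_conj_imp)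

lemma pd_all [pdi]:
  assumes "pd K (\<lambda>e. P (e 0) (\<lambda>i. e (Suc i)))"
  shows "pd K (\<lambda>e. \<forall>x\<in>V. P x e)"
proof -
  from assms obtain p r where r: "\<And>i c. r i = Inr c \<Longrightarrow> c \<in> K \<and> c \<in> V"
    and p: "\<And>e. e \<in> Env V \<Longrightarrow> P (e 0) (\<lambda>i. e (Suc i)) \<longleftrightarrow> sat V E (asg e r) p"
    by (rule pdE) blast
  \<comment> \<open>Several variables of \<open>p\<close> may stand for position 0, and
    \<open>?k\<close> identifies all of them with the bound variable. The value \<open>Inl 0\<close>
    at their slots is a dummy that is never read.\<close>
  let ?s = "\<lambda>i. case_sum (case_nat (Inl 0) Inl) Inr (r i)"
  let ?k = "\<lambda>i. if r i = Inl 0 then 0 else Suc i"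
  show ?thesis
  proof (rule pdI[where r = ?s and p = "Forall (ren ?k p)"])
    show "c \<in> K \<and> c \<in> V" if "?s i = Inr c" for i c
      using that r by (auto split: sum.split_asm nat.split_asm)
    fix e assume e: "e \<in> Env V"
    have "case_nat x (asg e ?s) \<circ> ?k = asg (case_nat x e) r" for x
      by (auto simp: fun_eq_iff split: sum.split nat.split)
    then show "(\<forall>x\<in>V. P x e) \<longleftrightarrow> sat V E (asg e ?s) (Forall (ren ?k p))"
      using p[of "case_nat x e" for x] e by (simp add: sat_ren)
  qed
qed

lemma pd_ex [pdi]: "pd K (\<lambda>e. P (e 0) (\<lambda>i. e (Suc i))) \<Longrightarrow> pd K (\<lambda>e. \<exists>x\<in>V. P x e)"
  using pd_not[OF pd_all[OF pd_not]] by simp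

text \<open>There are no terms in the language, so the value of \<open>t\<close> is named by an
  existential quantifier together with the definable graph.\<close>

lemma pd_subst:
  assumes "pd K Q" "pf K t"
  shows "pd K (\<lambda>e. Q (case_nat (t e) e))"
proof -
  have "pd K (\<lambda>e. e 0 = t (\<lambda>i. e (Suc i)) \<and> Q (case_nat (e 0) (\<lambda>i. e (Suc i))))"
    using assms by (simp only: case_nat_eta) (simp add: pd_conj pf_def)
  then have "pd K (\<lambda>e. \<exists>x\<in>V. x = t e \<and> Q (case_nat x e))"
    by (rule pd_ex)
  then show ?thesis
    by (rule pd_cong) (use assms in \<open>auto simp: pf_def\<close>)
qed

lemma pf_ren:
  assumes "pf K t"
  shows "pf K (\<lambda>e. t (\<lambda>i. e (k i)))"
  using assms pd_ren[of K "\<lambda>e. e 0 = t (\<lambda>i. e (Suc i))" "case_nat 0 (\<lambda>i. Suc (k i))"]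
  by (simp add: pf_def Env_ren)

lemma pf_in: "pf K t \<Longrightarrow> e \<in> Env V \<Longrightarrow> t e \<in> V"
  by (simp add: pf_def)

lemma pf_var [pdi]: "pf K (\<lambda>e. e i)"
  using pd_sat[of K "0 \<^bold>= Suc i"] by (simp add: pf_def Env_nth)

lemma pf_const: "c \<in> K \<Longrightarrow> c \<in> V \<Longrightarrow> pf K (\<lambda>e. c)"
proof -
  assume c: "c \<in> K" "c \<in> V"
  have "pd K (\<lambda>e. sat V E (\<lambda>i. case_sum e (\<lambda>c. c) (case_nat (Inl 0) (\<lambda>_. Inr c) i)) (0 \<^bold>= 1))"
    by (rule pd_subst_sum[OF pd_sat]) (use c in \<open>auto split: nat.split_asm\<close>)
  with c show ?thesis by (simp add: pf_def)
qed

lemma pf_param: "c \<in> V \<Longrightarrow> pf UNIV (\<lambda>e. c)"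
  by (simp add: pf_const)

lemma pd_subst1: "pd K (\<lambda>e. P (e 0)) \<Longrightarrow> pf K t \<Longrightarrow> pd K (\<lambda>e. P (t e))"
  using pd_subst[of K "\<lambda>e. P (e 0)" t] by simp

lemma pd_subst2:
  assumes "pd K (\<lambda>e. P (e 0) (e 1))" "pf K t" "pf K s"
  shows "pd K (\<lambda>e. P (t e) (s e))"
proof -
  have "pd K (\<lambda>e. P (t (\<lambda>i. e (Suc i))) (e 0))"
    using pd_subst[OF assms(1) pf_ren[OF assms(2), of Suc]] by simp
  from pd_subst[OF this assms(3)] show ?thesis by simp
qed

lemma pd_subst3:
  assumes "pd K (\<lambda>e. P (e 0) (e 1) (e 2))" "pf K t" "pf K s" "pf K u"
  shows "pd K (\<lambda>e. P (t e) (s e) (u e))"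
proof -
  have "pd K (\<lambda>e. P (t (\<lambda>i. e (Suc (Suc i)))) (e 0) (e 1))"
    using pd_subst[OF assms(1) pf_ren[OF assms(2), of "\<lambda>i. Suc (Suc i)"]] by (simp add: eval_nat_numeral)
  from pd_subst[OF this pf_ren[OF assms(3), of Suc]]
  have "pd K (\<lambda>e. P (t (\<lambda>i. e (Suc i))) (s (\<lambda>i. e (Suc i))) (e 0))" by simp
  from pd_subst[OF this assms(4)] show ?thesis by simp
qed

lemma pf_subst1:
  assumes "pf K (\<lambda>e. f (e 0))" "pf K t"
  shows "pf K (\<lambda>e. f (t e))"
proof -
  have "f x \<in> V" if "x \<in> V" for x using pf_in[OF assms(1), of "\<lambda>_. x"] that by (simp add: Env_def)
  moreover have "pd K (\<lambda>e. e 0 = f (e 1))" using assms(1) by (simp add: pf_def)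
  from pd_subst2[OF this pf_var pf_ren[OF assms(2)]]
  have "pd K (\<lambda>e. e 0 = f (t (\<lambda>i. e (Suc i))))" .
  ultimately show ?thesis using assms(2) by (simp add: pf_def)
qed

lemma pf_subst2:
  assumes "pf K (\<lambda>e. f (e 0) (e 1))" "pf K t" "pf K s"
  shows "pf K (\<lambda>e. f (t e) (s e))"
proof -
  have "f x y \<in> V" if "x \<in> V" "y \<in> V" for x y
    using pf_in[OF assms(1), of "case_nat x (\<lambda>_. y)"] that by (simp add: Env_def split: nat.split)
  moreover have "pd K (\<lambda>e. e 0 = f (e 1) (e 2))"
    using assms(1) by (simp add: pf_def eval_nat_numeral)
  from pd_subst3[OF this pf_var pf_ren[OF assms(2)] pf_ren[OF assms(3)]]
  have "pd K (\<lambda>e. e 0 = f (t (\<lambda>i. e (Suc i))) (s (\<lambda>i. e (Suc i))))" .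
  ultimately show ?thesis using assms(2,3) by (simp add: pf_def)
qed

lemma pd_E: "pf K t \<Longrightarrow> pf K s \<Longrightarrow> pd K (\<lambda>e. E (t e) (s e))"
  by (rule pd_subst2) (use pd_sat[of K "0 \<^bold>\<in> 1"] in simp)

lemma pd_eq [pdi]: "pf K t \<Longrightarrow> pf K s \<Longrightarrow> pd K (\<lambda>e. t e = s e)"
  by (rule pd_subst2) (use pd_sat[of K "0 \<^bold>= 1"] in simp)

lemma pd_mem_ext [pdi]: "pf K t \<Longrightarrow> pf K s \<Longrightarrow> pd K (\<lambda>e. t e \<in> ext (s e))"
  by (rule pd_cong[OF pd_E]) (auto simp: ext_def pf_in)

lemma pd_mem_V [pdi]: "pf K t \<Longrightarrow> pd K (\<lambda>e. t e \<in> V)"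
  by (rule pd_cong[OF pd_bool[of K True]]) (auto simp: pf_in)

lemma pd_all_ext [pdi]:
  assumes "pf K t" "pd K (\<lambda>e. P (e 0) (\<lambda>i. e (Suc i)))"
  shows "pd K (\<lambda>e. \<forall>x\<in>ext (t e). P x e)"
proof -
  have "pd K (\<lambda>e. \<forall>x\<in>V. x \<in> ext (t e) \<longrightarrow> P x e)"
    by (intro pdi assms pf_ren[OF assms(1), of Suc])
  then show ?thesis by (rule pd_cong) (auto simp: ext_def)
qed

lemma pd_ex_ext [pdi]:
  assumes "pf K t" "pd K (\<lambda>e. P (e 0) (\<lambda>i. e (Suc i)))"
  shows "pd K (\<lambda>e. \<exists>x\<in>ext (t e). P x e)"
proof -
  have "pd K (\<lambda>e. \<exists>x\<in>V. x \<in> ext (t e) \<and> P x e)"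
    by (intro pdi assms pf_ren[OF assms(1), of Suc])
  then show ?thesis by (rule pd_cong) (auto simp: ext_def)
qed

lemma pd_subset [pdi]:
  assumes "pf K t" "pf K s"
  shows "pd K (\<lambda>e. ext (t e) \<subseteq> ext (s e))"
proof -
  have "pd K (\<lambda>e. \<forall>x\<in>ext (t e). x \<in> ext (s e))"
    by (intro pdi assms pf_ren[OF assms(2), of Suc])
  then show ?thesis by (simp add: subset_eq)
qed

lemma pf_if [pdi]:
  assumes "pd K P" "pf K t" "pf K s"
  shows "pf K (\<lambda>e. if P e then t e else s e)"
proof -
  have "pd K (\<lambda>e. (P (\<lambda>i. e (Suc i)) \<longrightarrow> e 0 = t (\<lambda>i. e (Suc i))) \<and>
      (\<not> P (\<lambda>i. e (Suc i)) \<longrightarrow> e 0 = s (\<lambda>i. e (Suc i))))"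
    using assms(2,3) by (intro pd_conj pd_imp pd_not pd_ren[OF assms(1), of Suc]) (auto simp: pf_def)
  then have "pd K (\<lambda>e. e 0 = (if P (\<lambda>i. e (Suc i)) then t (\<lambda>i. e (Suc i)) else s (\<lambda>i. e (Suc i))))"
    by (rule pd_cong) auto
  then show ?thesis using assms by (simp add: pf_def)
qed

text \<open>Freezing the rest of an assignment as parameters makes one-variable principles such as
  \<open>isset_mu\<close> applicable for each assignment separately.\<close>

lemma pd_section:
  assumes "pd K P" "e \<in> Env V"
  shows "pd UNIV (\<lambda>e'. P (case_nat (e' 0) e))"
proof -
  have "pd UNIV (\<lambda>e'. P (\<lambda>i. case_sum e' (\<lambda>c. c) (case_nat (Inl 0) (\<lambda>i. Inr (e i)) i)))"
    using pd_mono[OF assms(1)] assms(2)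
    by (intro pd_subst_sum) (auto simp: Env_nth split: nat.split_asm)
  moreover have eq: "(\<lambda>i. case_sum e' (\<lambda>c. c) (case_nat (Inl 0) (\<lambda>i. Inr (e i)) i)) = case_nat (e' 0) e" for e'
    by (auto split: nat.split)
  ultimately show ?thesis unfolding eq by simp
qed

section \<open>Definable collections that are sets of the model\<close>

definition isset :: "'a set \<Rightarrow> bool"
  where "isset X \<longleftrightarrow> (\<exists>z\<in>V. ext z = X)"

definition mk :: "'a set \<Rightarrow> 'a"
  where "mk X = (SOME z. z \<in> V \<and> ext z = X)"

lemma isset_mk: "isset X \<Longrightarrow> mk X \<in> V \<and> ext (mk X) = X"
  unfolding isset_def mk_def by (rule someI_ex) blast

lemmas mk_in = isset_mk[THEN conjunct1] and ext_mk = isset_mk[THEN conjunct2]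

lemma isset_ext: "z \<in> V \<Longrightarrow> isset (ext z)"
  by (auto simp: isset_def)

end

context ZF_axioms begin

lemma mk_ext: "z \<in> V \<Longrightarrow> mk (ext z) = z"
  by (meson extensionality isset_ext isset_mk)

text \<open>By extensionality, being equal to this set is the first-order condition on its elements.
  Existence is required because otherwise no element satisfies that condition, whereas
  \<open>mk\<close> still returns some value.\<close>

lemma pf_mk:
  assumes "pd K (\<lambda>e. Q (e 0) (\<lambda>i. e (Suc i)))" "\<And>e. e \<in> Env V \<Longrightarrow> isset {x \<in> V. Q x e}"
  shows "pf K (\<lambda>e. mk {x \<in> V. Q x e})"
proof -
  have "pd K (\<lambda>e. \<forall>x\<in>V. x \<in> ext (e 0) \<longleftrightarrow> Q x (\<lambda>i. e (Suc i)))"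
    using pd_ren[OF assms(1), of "case_nat 0 (\<lambda>i. Suc (Suc i))"] by (intro pdi) simp
  then have "pd K (\<lambda>e. e 0 = mk {x \<in> V. Q x (\<lambda>i. e (Suc i))})"
  proof (rule pd_cong)
    fix e assume e: "e \<in> Env V"
    have "(\<forall>x\<in>V. x \<in> ext (e 0) \<longleftrightarrow> Q x (\<lambda>i. e (Suc i))) \<longleftrightarrow> ext (e 0) = {x \<in> V. Q x (\<lambda>i. e (Suc i))}"
      using ext_subset by blast
    then show "(\<forall>x\<in>V. x \<in> ext (e 0) \<longleftrightarrow> Q x (\<lambda>i. e (Suc i))) \<longleftrightarrow> e 0 = mk {x \<in> V. Q x (\<lambda>i. e (Suc i))}"
      using assms(2)[OF Env_ren[OF e, of Suc]] mk_ext[of "e 0"] e by (auto simp: ext_mk Env_nth)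
  qed
  then show ?thesis unfolding pf_def using assms(2) mk_in by blast
qed

lemma isset_sep:
  assumes a: "a \<in> V" and P: "pd UNIV (\<lambda>e. P (e 0))"
  shows "isset {x \<in> ext a. P x}"
proof -
  from P obtain p r where r: "\<And>i c. r i = Inr c \<Longrightarrow> c \<in> V"
    and p: "\<And>e. e \<in> Env V \<Longrightarrow> P (e 0) \<longleftrightarrow> sat V E (asg e r) p"
    by (rule pdE) blast
  \<comment> \<open>\<open>P\<close> reads position 0 only, so this becomes \<open>x\<close>, every
    other position may hold \<open>a\<close>, and each parameter gets a slot of its own behind these
    two.\<close>
  let ?k = "\<lambda>i. case r i of Inl 0 \<Rightarrow> 0 | Inl (Suc _) \<Rightarrow> 1 | Inr _ \<Rightarrow> Suc (Suc i)"
  let ?e = "\<lambda>i. case_sum (\<lambda>_. a) (\<lambda>c. c) (r i)"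
  have "?e \<in> Env V" using a r by (auto simp: Env_def split: sum.split)
  then obtain b where b: "b \<in> V" "ext b = {x \<in> ext a. sat V E (case_nat x (case_nat a ?e)) (ren ?k p)}"
    using separation[of "ren ?k p"] a unfolding separation_def by blast
  have "sat V E (case_nat x (case_nat a ?e)) (ren ?k p) \<longleftrightarrow> P x" if "x \<in> V" for x
  proof -
    have "case_nat x (case_nat a ?e) \<circ> ?k = asg (case_nat x (\<lambda>_. a)) r"
      by (auto simp: fun_eq_iff split: sum.split nat.split)
    then show ?thesis using p[of "case_nat x (\<lambda>_. a)"] that a by (simp add: sat_ren)
  qed
  then have "ext b = {x \<in> ext a. P x}" using b ext_subset by blast
  with b(1) show ?thesis by (auto simp: isset_def)
qed

lemma isset_subset:
  assumes "a \<in> V" "pd UNIV (\<lambda>e. P (e 0))" "\<And>x. x \<in> V \<Longrightarrow> P x \<Longrightarrow> x \<in> ext a"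
  shows "isset {x \<in> V. P x}"
proof -
  have "{x \<in> V. P x} = {x \<in> ext a. P x}" using assms(3) ext_subset by blast
  then show ?thesis using isset_sep assms(1,2) by simp
qed

lemma isset_image:
  assumes a: "a \<in> V" and f: "pf UNIV (\<lambda>e. f (e 0))"
  shows "isset (f ` ext a)"
proof -
  have fV: "f x \<in> V" if "x \<in> V" for x using pf_in[OF f, of "\<lambda>_. x"] that by (simp add: Env_def)
  have "pd UNIV (\<lambda>e. e 0 = f (e 1))" using f by (simp add: pf_def)
  then obtain p r where r: "\<And>i c. r i = Inr c \<Longrightarrow> c \<in> V"
    and p: "\<And>e. e \<in> Env V \<Longrightarrow> e 0 = f (e 1) \<longleftrightarrow> sat V E (asg e r) p"
    by (rule pdE) blast
  let ?k = "\<lambda>i. case r i of Inl 0 \<Rightarrow> 0 | Inl (Suc 0) \<Rightarrow> 1 | Inl (Suc (Suc _)) \<Rightarrow> 2 | Inr _ \<Rightarrow> Suc (Suc (Suc i))"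
  let ?e = "\<lambda>i. case_sum (\<lambda>_. a) (\<lambda>c. c) (r i)"
  have sat: "sat V E (case_nat y (case_nat x (case_nat a ?e))) (ren ?k p) \<longleftrightarrow> y = f x" if "x \<in> V" "y \<in> V" for x y
  proof -
    have "case_nat y (case_nat x (case_nat a ?e)) \<circ> ?k
        = asg (case_nat y (case_nat x (\<lambda>_. a))) r"
      by (rule ext) (simp add: eval_nat_numeral split: sum.split nat.split)
    then show ?thesis using p[of "case_nat y (case_nat x (\<lambda>_. a))"] that a by (simp add: sat_ren)
  qed
  have "?e \<in> Env V" using a r by (auto simp: Env_def split: sum.split)
  moreover have "\<forall>x\<in>ext a. \<exists>!y. y \<in> V \<and> sat V E (case_nat y (case_nat x (case_nat a ?e))) (ren ?k p)"
  proof
    fix x assume "x \<in> ext a"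
    then have "x \<in> V" by (rule extD)
    then show "\<exists>!y. y \<in> V \<and> sat V E (case_nat y (case_nat x (case_nat a ?e))) (ren ?k p)"
      using sat fV by (intro ex1I[of _ "f x"]) blast+
  qed
  ultimately obtain b where b: "b \<in> V"
      "\<forall>x\<in>ext a. \<exists>y\<in>ext b. sat V E (case_nat y (case_nat x (case_nat a ?e))) (ren ?k p)"
    using replacement[of "ren ?k p"] a unfolding replacement_def by blast
  have "f ` ext a = {y \<in> V. \<exists>x\<in>ext a. y = f x}" using fV extD by blast
  \<comment> \<open>The replacement axiom yields only a set \<open>b\<close> that meets the values;
    separation cuts the image out of it.\<close>
  also have "isset \<dots>"
  proof (rule isset_subset[OF b(1)])
    show "pd UNIV (\<lambda>e. \<exists>x\<in>ext a. e 0 = f x)"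
      by (intro pd_ex_ext pd_eq pf_param[OF a] pf_var pf_subst1[OF f])
    show "y \<in> ext b" if "\<exists>x\<in>ext a. y = f x" for y
    proof -
      from that obtain x where x: "x \<in> ext a" "y = f x" by blast
      with b(2) obtain y' where y': "y' \<in> ext b"
        "sat V E (case_nat y' (case_nat x (case_nat a ?e))) (ren ?k p)" by blast
      then have "y' = f x" using sat[of x y'] x(1) extD by blast
      with x y' show ?thesis by simp
    qed
  qed
  finally show ?thesis .
qed

section \<open>Elementary set theory inside a model\<close>

lemma mk_eqI: "z \<in> V \<Longrightarrow> ext z = X \<Longrightarrow> mk X = z"
  using mk_ext by blast

definition upair :: "'a \<Rightarrow> 'a \<Rightarrow> 'a"
  where "upair a b = mk {x \<in> V. x = a \<or> x = b}"

definition bigcup :: "'a \<Rightarrow> 'a"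
  where "bigcup a = mk {x \<in> V. \<exists>y\<in>ext a. x \<in> ext y}"

definition pow :: "'a \<Rightarrow> 'a"
  where "pow a = mk {x \<in> V. ext x \<subseteq> ext a}"

definition zero :: 'a
  where "zero = mk {x \<in> V. False}"

lemma isset_upair: "a \<in> V \<Longrightarrow> b \<in> V \<Longrightarrow> isset {x \<in> V. x = a \<or> x = b}"
  using pairing[of a b] by (auto simp: isset_def intro!: bexI)

lemma isset_bigcup: "a \<in> V \<Longrightarrow> isset {x \<in> V. \<exists>y\<in>ext a. x \<in> ext y}"
proof -
  assume "a \<in> V"
  moreover have "{x \<in> V. \<exists>y\<in>ext a. x \<in> ext y} = \<Union>(ext ` ext a)" by (auto simp: ext_def)
  ultimately show ?thesis using union[of a] by (auto simp: isset_def)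
qed

lemma isset_pow: "a \<in> V \<Longrightarrow> isset {x \<in> V. ext x \<subseteq> ext a}"
  using power_set by (auto simp: isset_def)

lemma isset_zero: "isset {x \<in> V. False}"
proof -
  obtain v where "v \<in> V" using nonempty by blast
  then show ?thesis using isset_subset[of v "\<lambda>_. False"] pd_bool by blast
qed

lemma upair_in [simp]: "a \<in> V \<Longrightarrow> b \<in> V \<Longrightarrow> upair a b \<in> V"
  and ext_upair [simp]: "a \<in> V \<Longrightarrow> b \<in> V \<Longrightarrow> ext (upair a b) = {a, b}"
  using isset_mk[OF isset_upair] by (auto simp: upair_def)

lemma bigcup_in [simp]: "a \<in> V \<Longrightarrow> bigcup a \<in> V"
  and ext_bigcup [simp]: "a \<in> V \<Longrightarrow> ext (bigcup a) = \<Union>(ext ` ext a)"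
  using isset_mk[OF isset_bigcup] ext_subset by (fastforce simp: bigcup_def)+

lemma pow_in [simp]: "a \<in> V \<Longrightarrow> pow a \<in> V"
  and ext_pow [simp]: "a \<in> V \<Longrightarrow> ext (pow a) = {x \<in> V. ext x \<subseteq> ext a}"
  using isset_mk[OF isset_pow] by (auto simp: pow_def)

lemma zero_in [simp]: "zero \<in> V" and ext_zero [simp]: "ext zero = {}"
  using isset_mk[OF isset_zero] by (auto simp: zero_def)

lemma pf_upair [pdi]: "pf K t \<Longrightarrow> pf K s \<Longrightarrow> pf K (\<lambda>e. upair (t e) (s e))"
  by (rule pf_subst2[of K upair]) (auto simp: upair_def intro!: pf_mk pdi isset_upair Env_nth)

lemma pf_bigcup [pdi]: "pf K t \<Longrightarrow> pf K (\<lambda>e. bigcup (t e))"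
  by (rule pf_subst1[of K bigcup]) (auto simp: bigcup_def intro!: pf_mk pdi isset_bigcup Env_nth)

lemma pf_zero [pdi]: "pf K (\<lambda>e. zero)"
  unfolding zero_def by (intro pf_mk pdi isset_zero)

definition cup :: "'a \<Rightarrow> 'a \<Rightarrow> 'a"
  where "cup a b = bigcup (upair a b)"

definition succ :: "'a \<Rightarrow> 'a"
  where "succ a = cup a (upair a a)"

definition opair :: "'a \<Rightarrow> 'a \<Rightarrow> 'a"
  where "opair a b = upair (upair a a) (upair a b)"

lemma cup_in [simp]: "a \<in> V \<Longrightarrow> b \<in> V \<Longrightarrow> cup a b \<in> V"
  and ext_cup [simp]: "a \<in> V \<Longrightarrow> b \<in> V \<Longrightarrow> ext (cup a b) = ext a \<union> ext b"
  and succ_in [simp]: "a \<in> V \<Longrightarrow> succ a \<in> V"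
  and ext_succ [simp]: "a \<in> V \<Longrightarrow> ext (succ a) = insert a (ext a)"
  and opair_in [simp]: "a \<in> V \<Longrightarrow> b \<in> V \<Longrightarrow> opair a b \<in> V"
  by (auto simp: cup_def succ_def opair_def)

lemma pf_cup [pdi]: "pf K t \<Longrightarrow> pf K s \<Longrightarrow> pf K (\<lambda>e. cup (t e) (s e))"
  unfolding cup_def by (intro pdi)

lemma pf_succ [pdi]: "pf K t \<Longrightarrow> pf K (\<lambda>e. succ (t e))"
  unfolding succ_def by (intro pdi)

lemma pf_opair [pdi]: "pf K t \<Longrightarrow> pf K s \<Longrightarrow> pf K (\<lambda>e. opair (t e) (s e))"
  unfolding opair_def by (intro pdi)

lemma ext_opair: "a \<in> V \<Longrightarrow> b \<in> V \<Longrightarrow> ext (opair a b) = {upair a a, upair a b}"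
  by (simp add: opair_def)

lemma opair_inject [simp]:
  assumes "a \<in> V" "b \<in> V" "c \<in> V" "d \<in> V"
  shows "opair a b = opair c d \<longleftrightarrow> a = c \<and> b = d"
proof
  assume "opair a b = opair c d"
  then have "ext ` ext (opair a b) = ext ` ext (opair c d)" by simp
  then have "{{a}, {a, b}} = {{c}, {c, d}}" using assms by (simp add: ext_opair)
  then show "a = c \<and> b = d" by (auto simp: doubleton_eq_iff)
qed simp

lemma not_mem_self: "x \<in> V \<Longrightarrow> x \<notin> ext x"
  using foundation[of "upair x x"] by auto

lemma not_mem_cycle: "y \<in> ext x \<Longrightarrow> x \<in> ext y \<Longrightarrow> False"
  using foundation[of "upair x y"] extD[of y x] extD[of x y] by auto

lemma not_mem_cycle3: "x \<in> ext y \<Longrightarrow> y \<in> ext z \<Longrightarrow> z \<in> ext x \<Longrightarrow> False"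
  using foundation[of "cup (upair x y) (upair z z)"] extD[of x y] extD[of y z] extD[of z x] by auto

lemma issetE: "isset X \<Longrightarrow> (\<And>z. z \<in> V \<Longrightarrow> ext z = X \<Longrightarrow> thesis) \<Longrightarrow> thesis"
  unfolding isset_def by blast

lemma isset_UN:
  assumes "a \<in> V" "pf UNIV (\<lambda>e. f (e 0))"
  shows "isset (\<Union>x\<in>ext a. ext (f x))"
proof -
  obtain b where b: "b \<in> V" "ext b = f ` ext a" using isset_image[OF assms] by (rule issetE)
  then have "ext (bigcup b) = (\<Union>x\<in>ext a. ext (f x))" by simp
  with b(1) show ?thesis unfolding isset_def using bigcup_in by blast
qed

definition cprod :: "'a \<Rightarrow> 'a \<Rightarrow> 'a"
  where "cprod a b = mk {u \<in> V. \<exists>x\<in>ext a. \<exists>y\<in>ext b. u = opair x y}"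

text \<open>Replacement gives the row over a fixed \<open>x\<close>; replacement and union then
  assemble the rows.\<close>

lemma isset_cprod:
  assumes "a \<in> V" "b \<in> V"
  shows "isset {u \<in> V. \<exists>x\<in>ext a. \<exists>y\<in>ext b. u = opair x y}"
proof -
  have iss: "isset {u \<in> V. \<exists>y\<in>ext b. u = opair x y}" if "x \<in> V" for x
  proof -
    have "pf UNIV (\<lambda>e. opair x (e 0))" by (intro pdi pf_param that)
    then have "isset (opair x ` ext b)" by (rule isset_image[OF assms(2)])
    moreover have "opair x ` ext b = {u \<in> V. \<exists>y\<in>ext b. u = opair x y}"
      using that extD opair_in by blast
    ultimately show ?thesis by simp
  qed
  have "pf UNIV (\<lambda>e. mk {u \<in> V. \<exists>y\<in>ext b. u = opair (e 0) y})"
    by (rule pf_mk, intro pdi pf_param assms) (rule iss, erule Env_nth)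
  then have "isset (\<Union>x\<in>ext a. ext (mk {u \<in> V. \<exists>y\<in>ext b. u = opair x y}))"
    by (rule isset_UN[OF assms(1)])
  moreover have "(\<Union>x\<in>ext a. ext (mk {u \<in> V. \<exists>y\<in>ext b. u = opair x y}))
      = {u \<in> V. \<exists>x\<in>ext a. \<exists>y\<in>ext b. u = opair x y}"
    using ext_mk[OF iss] extD by auto
  ultimately show ?thesis by simp
qed

lemma cprod_in [simp]: "a \<in> V \<Longrightarrow> b \<in> V \<Longrightarrow> cprod a b \<in> V"
  and ext_cprod: "a \<in> V \<Longrightarrow> b \<in> V \<Longrightarrow> ext (cprod a b) = {u \<in> V. \<exists>x\<in>ext a. \<exists>y\<in>ext b. u = opair x y}"
  using isset_mk[OF isset_cprod] by (auto simp: cprod_def)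

lemma opair_in_cprod [simp]:
  assumes "a \<in> V" "b \<in> V" "x \<in> V" "y \<in> V"
  shows "opair x y \<in> ext (cprod a b) \<longleftrightarrow> x \<in> ext a \<and> y \<in> ext b"
proof
  assume "opair x y \<in> ext (cprod a b)"
  then obtain x' y' where *: "x' \<in> ext a" "y' \<in> ext b" "opair x y = opair x' y'"
    using assms by (auto simp: ext_cprod)
  then show "x \<in> ext a \<and> y \<in> ext b" using assms extD[OF *(1)] extD[OF *(2)] by simp
qed (use assms in \<open>auto simp: ext_cprod\<close>)

lemma pf_cprod [pdi]: "pf K t \<Longrightarrow> pf K s \<Longrightarrow> pf K (\<lambda>e. cprod (t e) (s e))"
  by (rule pf_subst2[of K cprod]) (auto simp: cprod_def intro!: pf_mk pdi isset_cprod Env_nth)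

text \<open>With Kuratowski pairs both components sit two unions down, so one set bounds the domain
  and the range of any relation.\<close>

lemma opair_mem_bigcup:
  assumes "x \<in> V" "y \<in> V" "opair x y \<in> ext f" "f \<in> V"
  shows "x \<in> ext (bigcup (bigcup f)) \<and> y \<in> ext (bigcup (bigcup f))"
proof -
  have "upair x y \<in> ext (bigcup f)"
    using assms by (auto simp: ext_opair intro!: bexI[of _ "opair x y"])
  moreover have "ext (bigcup (bigcup f)) = \<Union>(ext ` ext (bigcup f))" using assms by (intro ext_bigcup bigcup_in)
  ultimately show ?thesis using assms by (auto simp del: ext_bigcup intro!: bexI[of _ "upair x y"])
qed

definition ran :: "'a \<Rightarrow> 'a"
  where "ran f = mk {y \<in> V. \<exists>x\<in>V. opair x y \<in> ext f}"

lemma isset_ran: "f \<in> V \<Longrightarrow> isset {y \<in> V. \<exists>x\<in>V. opair x y \<in> ext f}"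
  by (rule isset_subset[of "bigcup (bigcup f)"])
    (auto intro!: pdi pf_param simp del: ext_bigcup simp: opair_mem_bigcup)

lemma ran_in [simp]: "f \<in> V \<Longrightarrow> ran f \<in> V"
  and ext_ran: "f \<in> V \<Longrightarrow> ext (ran f) = {y \<in> V. \<exists>x\<in>V. opair x y \<in> ext f}"
  using isset_mk[OF isset_ran] by (auto simp: ran_def)

lemma pf_ran [pdi]: "pf K t \<Longrightarrow> pf K (\<lambda>e. ran (t e))"
  by (rule pf_subst1[of K ran]) (auto simp: ran_def intro!: pf_mk pdi isset_ran Env_nth)

section \<open>Ordinals\<close>

definition transitive :: "'a \<Rightarrow> bool"
  where "transitive a \<longleftrightarrow> (\<forall>x\<in>ext a. ext x \<subseteq> ext a)"

text \<open>Irreflexivity, transitivity of membership and least elements, which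
  \<open>fm_ordinal\<close> also demands, follow from foundation; see
  \<open>sat_ordinal\<close>.\<close>

definition Ord :: "'a set"
  where "Ord = {a \<in> V. transitive a \<and> (\<forall>x\<in>ext a. \<forall>y\<in>ext a. x \<in> ext y \<or> x = y \<or> y \<in> ext x)}"

lemma pd_transitive [pdi]: "pf K t \<Longrightarrow> pd K (\<lambda>e. transitive (t e))"
  by (rule pd_subst1[of K transitive]) (auto simp: transitive_def intro!: pdi)

lemma pd_Ord [pdi]: "pf K t \<Longrightarrow> pd K (\<lambda>e. t e \<in> Ord)"
  by (rule pd_subst1[of K "\<lambda>x. x \<in> Ord"]) (auto simp: Ord_def intro!: pdi)

lemma OrdI:
  assumes "a \<in> V" "\<And>x y. x \<in> ext a \<Longrightarrow> y \<in> ext x \<Longrightarrow> y \<in> ext a"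
    and "\<And>x y. x \<in> ext a \<Longrightarrow> y \<in> ext a \<Longrightarrow> x \<in> ext y \<or> x = y \<or> y \<in> ext x"
  shows "a \<in> Ord"
  using assms unfolding Ord_def transitive_def by blast

lemma Ord_subset: "a \<in> Ord \<Longrightarrow> x \<in> ext a \<Longrightarrow> ext x \<subseteq> ext a"
  by (simp add: Ord_def transitive_def)

lemma Ord_comparable:
  "a \<in> Ord \<Longrightarrow> x \<in> ext a \<Longrightarrow> y \<in> ext a \<Longrightarrow> x \<in> ext y \<or> x = y \<or> y \<in> ext x"
  by (simp add: Ord_def)

lemma Ord_in [simp]: "a \<in> Ord \<Longrightarrow> a \<in> V"
  by (simp add: Ord_def)

lemma Ord_elem: "a \<in> Ord \<Longrightarrow> x \<in> ext a \<Longrightarrow> x \<in> Ord"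
proof -
  assume a: "a \<in> Ord" and x: "x \<in> ext a"
  have "z \<in> ext x" if "y \<in> ext x" "z \<in> ext y" for y z
  proof -
    have "y \<in> ext a" "z \<in> ext a" using that a x Ord_subset by blast+
    then have "x \<in> ext z \<or> x = z \<or> z \<in> ext x" using a x Ord_comparable by blast
    then show ?thesis using that not_mem_cycle not_mem_cycle3 by blast
  qed
  then show "x \<in> Ord" using x Ord_subset[OF a x] Ord_comparable[OF a] by (intro OrdI) (blast intro: extD)+
qed

text \<open>A membership-minimal \<open>y\<close> in \<open>a\<close> outside \<open>d\<close>
  equals \<open>d\<close>. Minimality puts the elements of \<open>y\<close> into \<open>d\<close>;
  conversely an element of \<open>d\<close> not below \<open>y\<close> would force \<open>y\<close>
  into the transitive set \<open>d\<close>.\<close>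

lemma Ord_psubset:
  assumes "a \<in> Ord" "d \<in> V" "transitive d" "ext d \<subset> ext a"
  shows "d \<in> ext a"
proof -
  have "isset {x \<in> ext a. x \<notin> ext d}" by (rule isset_sep) (use assms in \<open>auto intro!: pdi pf_param\<close>)
  then obtain b where b: "b \<in> V" "ext b = {x \<in> ext a. x \<notin> ext d}" by (auto simp: isset_def)
  then obtain y where y: "y \<in> ext a" "y \<notin> ext d" "ext y \<inter> ext b = {}"
    using foundation[of b] assms(4) by auto
  have "ext y \<subseteq> ext d" using y b Ord_subset[OF assms(1) y(1)] by auto
  moreover have "ext d \<subseteq> ext y"
  proof
    fix z assume z: "z \<in> ext d"
    then have "z \<in> ext a" using assms(4) by blast
    then have "z \<in> ext y \<or> z = y \<or> y \<in> ext z" using assms(1) y(1) Ord_comparable by blast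
    then show "z \<in> ext y" using z y(2) assms(3) by (auto simp: transitive_def)
  qed
  ultimately have "y = d" using extensionality y(1) extD assms(2) by blast
  then show ?thesis using y(1) by simp
qed

text \<open>The intersection is transitive, so each of the two ordinals equals it or has it as an
  element. It cannot be an element of both, as it would then be an element of itself.\<close>

lemma Ord_linear:
  assumes "a \<in> Ord" "b \<in> Ord"
  shows "a \<in> ext b \<or> a = b \<or> b \<in> ext a"
proof -
  have "isset {x \<in> ext a. x \<in> ext b}" by (rule isset_sep) (use assms in \<open>auto intro!: pdi pf_param\<close>)
  then obtain d where d: "d \<in> V" "ext d = ext a \<inter> ext b" by (auto simp: isset_def)
  then have "transitive d" using Ord_subset assms unfolding transitive_def by blast
  then have "d = a \<or> d \<in> ext a" "d = b \<or> d \<in> ext b"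
    using Ord_psubset[of _ d] assms d extensionality[of d] by (metis Int_lower1 Ord_in psubsetI, metis Int_lower2 Ord_in psubsetI)
  then show ?thesis using d not_mem_self by auto
qed

lemma Ord_trans: "c \<in> Ord \<Longrightarrow> a \<in> ext b \<Longrightarrow> b \<in> ext c \<Longrightarrow> a \<in> ext c"
  using Ord_subset by blast

lemma Ord_least:
  assumes "pd UNIV (\<lambda>e. P (e 0))" "a \<in> Ord" "P a"
  shows "\<exists>b\<in>Ord. P b \<and> (\<forall>c\<in>ext b. \<not> P c)"
proof -
  obtain d where d: "d \<in> V" "ext d = {x \<in> ext a. P x}"
    using isset_sep[OF _ assms(1), of a] assms(2) by (auto simp: isset_def)
  show ?thesis
  proof (cases "ext d = {}")
    case True
    then show ?thesis using assms(2,3) d(2) by (intro bexI[of _ a]) auto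
  next
    case False
    then obtain b where b: "b \<in> ext a" "P b" "ext b \<inter> ext d = {}" using foundation[OF d(1)] d(2) by auto
    then have "\<forall>c\<in>ext b. \<not> P c" using d(2) Ord_subset[OF assms(2) b(1)] by blast
    then show ?thesis using b Ord_elem[OF assms(2)] by blast
  qed
qed

text \<open>Definability of \<open>P\<close> is essential, since \<open>E\<close> may be ill-founded
  from outside: foundation in \<open>V\<close> only concerns sets of \<open>V\<close>.\<close>

lemma Ord_induct:
  assumes "pd UNIV (\<lambda>e. P (e 0))" "a \<in> Ord"
    and "\<And>b. b \<in> Ord \<Longrightarrow> (\<And>c. c \<in> ext b \<Longrightarrow> P c) \<Longrightarrow> P b"
  shows "P a"
  using Ord_least[OF pd_not[OF assms(1)] assms(2)] assms(3) by blast

lemma succ_Ord [simp]: "a \<in> Ord \<Longrightarrow> succ a \<in> Ord"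
  by (rule OrdI) (auto dest: Ord_subset Ord_comparable)

lemma zero_Ord [simp]: "zero \<in> Ord"
  by (rule OrdI) auto

lemma bigcup_Ord:
  assumes "A \<in> V" "ext A \<subseteq> Ord"
  shows "bigcup A \<in> Ord"
proof -
  have "x \<in> Ord" if "x \<in> ext (bigcup A)" for x using that assms Ord_elem by auto
  moreover have "y \<in> ext (bigcup A)" if "x \<in> ext (bigcup A)" "y \<in> ext x" for x y
    using that assms Ord_subset by fastforce
  ultimately show ?thesis using assms(1) Ord_linear by (intro OrdI) (blast intro: bigcup_in)+
qed

lemma Ord_set_bound:
  assumes "A \<in> V" "ext A \<subseteq> Ord"
  shows "\<exists>b\<in>Ord. \<forall>a\<in>ext A. a \<in> ext b"
proof (rule bexI[of _ "succ (bigcup A)"])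
  have U: "bigcup A \<in> Ord" using assms by (rule bigcup_Ord)
  then show "succ (bigcup A) \<in> Ord" by simp
  have "a \<in> ext (succ (bigcup A))" if a: "a \<in> ext A" for a
  proof -
    have "bigcup A \<notin> ext a" using a assms(1) not_mem_self[of "bigcup A"] by auto
    then have "a = bigcup A \<or> a \<in> ext (bigcup A)" using Ord_linear[OF U, of a] a assms(2) by blast
    then show ?thesis using assms(1) by (simp del: ext_bigcup)
  qed
  then show "\<forall>a\<in>ext A. a \<in> ext (succ (bigcup A))" by blast
qed

lemma Ord_bound:
  assumes "A \<in> V" "pf UNIV (\<lambda>e. f (e 0))" "\<And>x. x \<in> ext A \<Longrightarrow> f x \<in> Ord"
  shows "\<exists>b\<in>Ord. \<forall>x\<in>ext A. f x \<in> ext b"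
proof -
  obtain B where B: "B \<in> V" "ext B = f ` ext A" using isset_image[OF assms(1,2)] by (rule issetE)
  have "ext B \<subseteq> Ord" unfolding B(2) using assms(3) by (rule image_subsetI)
  from Ord_set_bound[OF B(1) this] show ?thesis unfolding B(2) by simp
qed

lemma Ord_max:
  assumes "a \<in> Ord" "b \<in> Ord"
  shows "\<exists>c\<in>Ord. a \<in> ext c \<and> b \<in> ext c"
  using Ord_set_bound[of "upair a b"] assms by auto

text \<open>The least ordinal is the intersection of all candidates, which describes its elements by
  a formula. The first conjunct makes the collection empty, and so still a set, when there is no
  candidate.\<close>

abbreviation below :: "('a \<Rightarrow> bool) \<Rightarrow> 'a set"
  where "below Q \<equiv> {x \<in> V. (\<exists>y\<in>V. y \<in> Ord \<and> Q y) \<and> (\<forall>y\<in>V. y \<in> Ord \<longrightarrow> Q y \<longrightarrow> x \<in> ext y)}"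

text \<open>The least ordinal with property \<open>Q\<close>; the value is \<open>zero\<close> if there is none.\<close>

definition mu :: "('a \<Rightarrow> bool) \<Rightarrow> 'a"
  where "mu Q = mk (below Q)"

lemma mu_aux:
  assumes "b \<in> Ord" "Q b" "\<forall>c\<in>ext b. \<not> Q c"
  shows "below Q = ext b"
proof (intro equalityI subsetI)
  fix x assume x: "x \<in> ext b"
  have "x \<in> ext y" if "y \<in> Ord" "Q y" for y
    using Ord_linear[OF assms(1) that(1)] that assms x Ord_subset[OF that(1)] by blast
  then show "x \<in> below Q"
    using assms x extD by auto
qed (use assms in auto)

lemma mu:
  assumes "pd UNIV (\<lambda>e. Q (e 0))" "a \<in> Ord" "Q a"
  shows "mu Q \<in> Ord" "Q (mu Q)" "\<And>c. c \<in> ext (mu Q) \<Longrightarrow> \<not> Q c" "mu Q = a \<or> mu Q \<in> ext a"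
proof -
  obtain b where b: "b \<in> Ord" "Q b" "\<forall>c\<in>ext b. \<not> Q c" using Ord_least[of Q, OF assms] by blast
  then have "mu Q = b" unfolding mu_def mu_aux[OF b] by (simp add: mk_ext)
  then show "mu Q \<in> Ord" "Q (mu Q)" "\<And>c. c \<in> ext (mu Q) \<Longrightarrow> \<not> Q c" "mu Q = a \<or> mu Q \<in> ext a"
    using b Ord_linear[OF assms(2), of b] assms(3) by blast+
qed

lemma isset_mu:
  assumes "pd UNIV (\<lambda>e. Q (e 0))"
  shows "isset (below Q)"
proof (cases "\<exists>y\<in>Ord. Q y")
  case True
  then obtain b where b: "b \<in> Ord" "Q b" "\<forall>c\<in>ext b. \<not> Q c" using Ord_least[of Q, OF assms] by blast
  then show ?thesis unfolding mu_aux[OF b] by (simp add: isset_ext)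
next
  case False
  then have eq: "below Q = {x \<in> V. False}" by blast
  show ?thesis unfolding eq by (rule isset_zero)
qed

lemma pf_mu [pdi]:
  assumes Q: "pd K (\<lambda>e. Q (e 0) (\<lambda>i. e (Suc i)))"
  shows "pf K (\<lambda>e. mu (\<lambda>x. Q x e))"
proof -
  have 1: "pd K (\<lambda>e. Q (e 0) (\<lambda>i. e (Suc (Suc i))))"
    using pd_ren[OF Q, of "case_nat 0 (\<lambda>i. Suc (Suc i))"] by simp
  have 2: "isset (below (\<lambda>x. Q x e))"
    if "e \<in> Env V" for e
  proof -
    have "pd UNIV (\<lambda>e'. Q (e' 0) e)" using pd_section[OF Q that] by simp
    then show ?thesis by (rule isset_mu)
  qed
  show ?thesis unfolding mu_def by (intro pf_mk pdi 1 2)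
qed

section \<open>Transfinite recursion and the cumulative hierarchy\<close>

definition res :: "'a \<Rightarrow> 'a \<Rightarrow> 'a"
  where "res f d = mk {p \<in> V. p \<in> ext f \<and> (\<exists>z\<in>ext d. \<exists>y\<in>V. p = opair z y)}"

lemma isset_res: "f \<in> V \<Longrightarrow> d \<in> V \<Longrightarrow> isset {p \<in> V. p \<in> ext f \<and> (\<exists>z\<in>ext d. \<exists>y\<in>V. p = opair z y)}"
  by (rule isset_subset[of f]) (auto intro!: pdi pf_param)

lemma res_in [simp]: "f \<in> V \<Longrightarrow> d \<in> V \<Longrightarrow> res f d \<in> V"
  and ext_res: "f \<in> V \<Longrightarrow> d \<in> V \<Longrightarrow>
    ext (res f d) = {p \<in> V. p \<in> ext f \<and> (\<exists>z\<in>ext d. \<exists>y\<in>V. p = opair z y)}"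
  using isset_mk[OF isset_res] by (auto simp: res_def)

lemma pf_res [pdi]: "pf K t \<Longrightarrow> pf K s \<Longrightarrow> pf K (\<lambda>e. res (t e) (s e))"
  by (rule pf_subst2[of K res]) (auto simp: res_def intro!: pf_mk pdi isset_res Env_nth)

lemma res_res:
  assumes "f \<in> V" "d \<in> Ord" "z \<in> ext d"
  shows "res (res f d) z = res f z"
proof -
  have "z \<in> V" "ext z \<subseteq> ext d" using assms Ord_subset extD by blast+
  then show ?thesis using assms(1,2) by (intro extensionality) (auto simp: ext_res)
qed

text \<open>These are the attempts in the usual proof of transfinite recursion: \<open>f\<close> is
  a function on \<open>a\<close> whose value at \<open>d\<close> is \<open>G\<close> of its
  restriction to \<open>d\<close>.\<close>

definition good :: "('a \<Rightarrow> 'a) \<Rightarrow> 'a \<Rightarrow> 'a \<Rightarrow> bool"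
  where "good G f a \<longleftrightarrow> (\<forall>p\<in>V. p \<in> ext f \<longleftrightarrow> (\<exists>d\<in>ext a. p = opair d (G (res f d))))"

text \<open>The union of all attempts on \<open>a\<close>. There is exactly one of them, so the
  union describes it by a formula; off the ordinals the guard makes the result empty.\<close>

definition segment :: "('a \<Rightarrow> 'a) \<Rightarrow> 'a \<Rightarrow> 'a"
  where "segment G a = mk {p \<in> V. a \<in> Ord \<and> (\<exists>f\<in>V. good G f a \<and> p \<in> ext f)}"

definition recursor :: "('a \<Rightarrow> 'a) \<Rightarrow> 'a \<Rightarrow> 'a"
  where "recursor G a = G (segment G a)"

lemma pd_good:
  assumes "pf K (\<lambda>e. G (e 0))" "pf K t" "pf K s"
  shows "pd K (\<lambda>e. good G (t e) (s e))"
  by (rule pd_subst2[of K "good G"]) (auto simp: good_def intro!: assms(2,3) pdi pf_subst1[OF assms(1)])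

context
  fixes G
  assumes G: "pf UNIV (\<lambda>e. G (e 0))"
begin

lemma G_in: "x \<in> V \<Longrightarrow> G x \<in> V"
  using pf_in[OF G, of "\<lambda>_. x"] by simp

lemma good_res:
  assumes f: "f \<in> V" "good G f a" and a: "a \<in> Ord" "d \<in> ext a"
  shows "good G (res f d) d"
  unfolding good_def
proof (intro ballI iffI)
  have d: "d \<in> V" "d \<in> Ord" using a Ord_elem by auto
  fix p assume p: "p \<in> V"
  show "\<exists>z\<in>ext d. p = opair z (G (res (res f d) z))" if "p \<in> ext (res f d)"
  proof -
    from that d f obtain z y where z: "p \<in> ext f" "z \<in> ext d" "y \<in> V" "p = opair z y" by (auto simp: ext_res)
    then obtain z' where z': "z' \<in> ext a" "p = opair z' (G (res f z'))" using f p by (auto simp: good_def)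
    then have "z' = z" using z extD f by (auto simp: G_in)
    then show ?thesis using z z' res_res[OF f(1) d(2) z(2)] by (intro bexI[of _ z]) simp_all
  qed
  show "p \<in> ext (res f d)" if "\<exists>z\<in>ext d. p = opair z (G (res (res f d) z))"
  proof -
    from that obtain z where z: "z \<in> ext d" "p = opair z (G (res f z))" using res_res[OF f(1) d(2)] by auto
    then have "z \<in> ext a" "z \<in> V" using Ord_subset[OF a] extD by blast+
    moreover have "p \<in> ext f" using calculation z f(2) p unfolding good_def by blast
    moreover have "G (res f z) \<in> V" using calculation f d by (simp add: G_in)
    ultimately show ?thesis using z d f p by (auto simp: ext_res)
  qed
qed

lemma good_unique:
  assumes "a \<in> Ord" "f \<in> V" "g \<in> V" "good G f a" "good G g a"
  shows "f = g"
proof -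
  have "\<forall>f\<in>V. \<forall>g\<in>V. good G f a \<and> good G g a \<longrightarrow> f = g"
  proof (rule Ord_induct[OF _ assms(1), where P = "\<lambda>a. \<forall>f\<in>V. \<forall>g\<in>V. good G f a \<and> good G g a \<longrightarrow> f = g"])
    show "pd UNIV (\<lambda>e. \<forall>f\<in>V. \<forall>g\<in>V. good G f (e 0) \<and> good G g (e 0) \<longrightarrow> f = g)"
      by (intro pdi pd_good G)
    fix a assume a: "a \<in> Ord" and IH: "\<And>d. d \<in> ext a \<Longrightarrow> \<forall>f\<in>V. \<forall>g\<in>V. good G f d \<and> good G g d \<longrightarrow> f = g"
    show "\<forall>f\<in>V. \<forall>g\<in>V. good G f a \<and> good G g a \<longrightarrow> f = g"
    proof (intro ballI impI)
      fix f g assume fg: "f \<in> V" "g \<in> V" "good G f a \<and> good G g a"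
      have "res f d = res g d" if "d \<in> ext a" for d
        using IH[OF that] good_res[of f a d] good_res[of g a d] fg a that extD by simp
      then have "p \<in> ext f \<longleftrightarrow> p \<in> ext g" if "p \<in> V" for p
        using fg that by (auto simp: good_def)
      then have "ext f = ext g" using extD by blast
      then show "f = g" using extensionality fg by blast
    qed
  qed
  with assms show ?thesis by blast
qed

lemma segment_eq: "a \<in> Ord \<Longrightarrow> f \<in> V \<Longrightarrow> good G f a \<Longrightarrow> segment G a = f"
proof -
  assume f: "a \<in> Ord" "f \<in> V" "good G f a"
  then have "{p \<in> V. a \<in> Ord \<and> (\<exists>f\<in>V. good G f a \<and> p \<in> ext f)} = ext f"
    using good_unique[OF f(1) _ f(2) _ f(3)] extD by blast
  then show ?thesis using f(2) by (simp add: segment_def mk_ext)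
qed

lemma good_segment_aux: "a \<in> Ord \<Longrightarrow> \<exists>f\<in>V. good G f a"
proof (rule Ord_induct[where P = "\<lambda>a. \<exists>f\<in>V. good G f a"])
  show "pd UNIV (\<lambda>e. \<exists>f\<in>V. good G f (e 0))" by (intro pdi pd_good G)
  fix a assume a: "a \<in> Ord" and "\<And>d. d \<in> ext a \<Longrightarrow> \<exists>f\<in>V. good G f d"
  then have IH: "segment G d \<in> V \<and> good G (segment G d) d" if "d \<in> ext a" for d
    using that segment_eq Ord_elem by metis
  \<comment> \<open>The function \<open>segment G\<close> is not yet known to be definable
    everywhere, as totality is what is being proved. The guard by \<open>a\<close> makes this
    variant a set for every \<open>d\<close>, and it agrees with \<open>segment G d\<close> below
    \<open>a\<close>.\<close>
  let ?S = "\<lambda>d. {p \<in> V. d \<in> ext a \<and> (\<exists>f\<in>V. good G f d \<and> p \<in> ext f)}"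
  have eq: "{p \<in> V. p \<in> ext (segment G d)} = ?S d"
    if "d \<in> ext a" for d
  proof -
    have "f = segment G d" if "f \<in> V" "good G f d" for f
      using segment_eq[OF Ord_elem[OF a \<open>d \<in> ext a\<close>] that] by simp
    then have "(\<exists>f\<in>V. good G f d \<and> p \<in> ext f) \<longleftrightarrow> p \<in> ext (segment G d)" for p
      using IH[OF that] by blast
    then show ?thesis using that by simp
  qed
  have iss: "isset (?S d)" for d
  proof (cases "d \<in> ext a")
    case True
    then show ?thesis unfolding eq[OF True, symmetric]
      using isset_ext[of "segment G d"] IH[OF True] ext_subset by (simp add: Collect_conj_eq Int_absorb1)
  next
    case False
    then show ?thesis using isset_zero by simp
  qed
  have "pf UNIV (\<lambda>e. mk (?S (e 0)))"
    by (rule pf_mk, intro pdi pd_good G pf_param Ord_in a) (rule iss)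
  then have "pf UNIV (\<lambda>e. opair (e 0) (G (mk (?S (e 0)))))"
    by (intro pdi pf_subst1[OF G])
  from isset_image[OF Ord_in[OF a] this] obtain f where f: "f \<in> V"
    "ext f = (\<lambda>d. opair d (G (mk (?S d)))) ` ext a"
    by (rule issetE)
  have seg: "mk (?S d) = segment G d" if "d \<in> ext a" for d
    unfolding eq[OF that, symmetric] using IH[OF that] ext_subset
    by (intro mk_eqI) auto
  have f: "f \<in> V" "ext f = (\<lambda>d. opair d (G (segment G d))) ` ext a"
    using f seg by auto
  have "res f d = segment G d" if d: "d \<in> ext a" for d
  proof (rule extensionality)
    have dO: "d \<in> Ord" using d a Ord_elem by blast
    show "res f d \<in> V" "segment G d \<in> V" using f dO IH[OF d] by auto
    have sub: "ext d \<subseteq> ext a" using d a Ord_subset by blast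
    have "res (segment G d) z = segment G z" if "z \<in> ext d" for z
      using good_res[OF _ _ dO that, of "segment G d"] IH[OF d] Ord_elem[OF dO that] segment_eq[of z] that extD
      by (metis res_in)
    then have "ext (segment G d) = (\<lambda>z. opair z (G (segment G z))) ` ext d"
      using IH[OF d] IH sub extD G_in unfolding good_def by (auto simp: image_iff subset_iff)
    moreover have "ext (res f d) = (\<lambda>z. opair z (G (segment G z))) ` ext d"
      using f dO sub IH extD by (auto simp: ext_res G_in subset_iff)
    ultimately show "ext (res f d) = ext (segment G d)" by simp
  qed
  then have "good G f a" using f unfolding good_def by auto
  then show "\<exists>f\<in>V. good G f a" using f(1) by blast
qed

lemma good_segment: "a \<in> Ord \<Longrightarrow> segment G a \<in> V \<and> good G (segment G a) a"
  using good_segment_aux segment_eq by metis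

lemma segment_in: "segment G a \<in> V"
proof (cases "a \<in> Ord")
  case False
  then show ?thesis using isset_zero isset_mk by (simp add: segment_def)
qed (simp add: good_segment)

lemma recursor_in: "recursor G a \<in> V"
  by (simp add: recursor_def G_in segment_in)

lemma ext_segment:
  assumes a: "a \<in> Ord"
  shows "ext (segment G a) = {p \<in> V. \<exists>d\<in>ext a. p = opair d (recursor G d)}"
proof -
  have "res (segment G a) d = segment G d" if "d \<in> ext a" for d
    using good_res[OF _ _ a that] good_segment[OF a] segment_eq Ord_elem[OF a that] that extD
    by (metis res_in)
  then show ?thesis using good_segment[OF a] extD unfolding good_def recursor_def by (auto simp: G_in segment_in)
qed

lemma segment_app:
  assumes "a \<in> Ord" "d \<in> V" "y \<in> V"
  shows "opair d y \<in> ext (segment G a) \<longleftrightarrow> d \<in> ext a \<and> y = recursor G d"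
  using assms extD by (auto simp: ext_segment recursor_in)

lemma ext_ran_segment: "a \<in> Ord \<Longrightarrow> ext (ran (segment G a)) = recursor G ` ext a"
proof -
  assume a: "a \<in> Ord"
  have "ext (ran (segment G a)) = {y \<in> V. \<exists>x\<in>V. x \<in> ext a \<and> y = recursor G x}"
    using a by (auto simp: ext_ran segment_in segment_app)
  also have "\<dots> = recursor G ` ext a" using extD recursor_in by blast
  finally show ?thesis .
qed

lemma isset_segment: "isset {p \<in> V. a \<in> Ord \<and> (\<exists>f\<in>V. good G f a \<and> p \<in> ext f)}"
proof (cases "a \<in> Ord")
  case True
  then have "{p \<in> V. a \<in> Ord \<and> (\<exists>f\<in>V. good G f a \<and> p \<in> ext f)} = ext (segment G a)"
    using good_segment[OF True] segment_eq[OF True] extD by blast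
  then show ?thesis using segment_in isset_ext by simp
next
  case False
  then show ?thesis using isset_zero by simp
qed

end

lemma pf_recursor:
  assumes "pf K (\<lambda>e. G (e 0))" "pf K t"
  shows "pf K (\<lambda>e. recursor G (t e))"
proof -
  have G: "pf UNIV (\<lambda>e. G (e 0))" using pf_mono[OF assms(1)] by simp
  have "pf K (\<lambda>e. segment G (e 0))"
    unfolding segment_def by (rule pf_mk, intro pdi pd_good assms(1)) (rule isset_segment[OF G])
  then show ?thesis unfolding recursor_def by (intro pf_subst1[OF assms(1)] pf_subst1[OF _ assms(2), of "segment G"])
qed

text \<open>The union of the power sets of all earlier values, so \<open>level a\<close> is the
  usual \<open>V_a\<close> without a distinction between successors and limits.\<close>

definition level_step :: "'a \<Rightarrow> 'a"
  where "level_step f = mk {x \<in> V. \<exists>y\<in>ext (ran f). ext x \<subseteq> ext y}"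

definition level :: "'a \<Rightarrow> 'a"
  where "level = recursor level_step"

lemma isset_level_step: "f \<in> V \<Longrightarrow> isset {x \<in> V. \<exists>y\<in>ext (ran f). ext x \<subseteq> ext y}"
  by (rule isset_subset[of "pow (bigcup (ran f))"]) (auto intro!: pdi pf_param)

lemma ext_level_step: "f \<in> V \<Longrightarrow> ext (level_step f) = {x \<in> V. \<exists>y\<in>ext (ran f). ext x \<subseteq> ext y}"
  unfolding level_step_def by (rule ext_mk[OF isset_level_step])

lemma pf_level_step: "pf K (\<lambda>e. level_step (e 0))"
  unfolding level_step_def by (rule pf_mk, intro pdi) (rule isset_level_step, erule Env_nth)

lemma pf_level [pdi]: "pf K t \<Longrightarrow> pf K (\<lambda>e. level (t e))"
  unfolding level_def by (intro pf_recursor pf_level_step)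

lemma level_in_V [simp]: "level a \<in> V"
  unfolding level_def by (rule recursor_in[OF pf_level_step])

lemma ext_level: "a \<in> Ord \<Longrightarrow> ext (level a) = {x \<in> V. \<exists>d\<in>ext a. ext x \<subseteq> ext (level d)}"
proof -
  assume a: "a \<in> Ord"
  note seg = segment_in[OF pf_level_step]
  have "level a = level_step (segment level_step a)" by (simp add: level_def recursor_def)
  then have "ext (level a) = {x \<in> V. \<exists>y\<in>ext (ran (segment level_step a)). ext x \<subseteq> ext y}"
    by (simp add: ext_level_step[OF seg])
  then show ?thesis unfolding ext_ran_segment[OF pf_level_step a] by (simp add: level_def)
qed

lemma level_mono: "a \<in> Ord \<Longrightarrow> d \<in> ext a \<Longrightarrow> ext (level d) \<subseteq> ext (level a)"
proof
  fix x assume a: "a \<in> Ord" "d \<in> ext a" "x \<in> ext (level d)"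
  have "d \<in> Ord" using a Ord_elem by blast
  then obtain z where "z \<in> ext d" "ext x \<subseteq> ext (level z)" "x \<in> V" using a(3) by (auto simp: ext_level)
  moreover have "z \<in> ext a" using calculation(1) a(1,2) Ord_trans by blast
  ultimately show "x \<in> ext (level a)" using a(1) by (auto simp: ext_level)
qed

lemma level_trans: "a \<in> Ord \<Longrightarrow> y \<in> ext (level a) \<Longrightarrow> ext y \<subseteq> ext (level a)"
proof -
  assume a: "a \<in> Ord" "y \<in> ext (level a)"
  then obtain d where "d \<in> ext a" "ext y \<subseteq> ext (level d)" by (auto simp: ext_level)
  then show ?thesis using level_mono[OF a(1)] by blast
qed

lemma level_succ: "a \<in> Ord \<Longrightarrow> x \<in> V \<Longrightarrow> ext x \<subseteq> ext (level a) \<Longrightarrow> x \<in> ext (level (succ a))"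
  by (subst ext_level) auto

text \<open>Stage \<open>n\<close> of the recursion consists of \<open>a\<close> and of all elements
  of members of earlier stages. The union along a set of ordinals that contains zero and is closed
  under successor is transitive; the set may exceed omega, because the recursion runs along all
  ordinals.\<close>

lemma transitive_superset:
  assumes a: "a \<in> V"
  shows "\<exists>U\<in>V. a \<in> ext U \<and> transitive U"
proof -
  define G where "G f = cup (upair a a) (bigcup (bigcup (ran f)))" for f
  have G: "pf UNIV (\<lambda>e. G (e 0))" unfolding G_def by (intro pdi pf_param a)
  note in_V = recursor_in[OF G]
  have T: "ext (recursor G n) = insert a (\<Union>d\<in>ext n. \<Union>y\<in>ext (recursor G d). ext y)" if "n \<in> Ord" for n
    using a that by (simp add: recursor_def[of G n] G_def[of "segment G n"] segment_in[OF G] ext_ran_segment[OF G])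
  obtain w z where w: "w \<in> V" "z \<in> ext w" "ext z = {}" "\<forall>x\<in>ext w. \<exists>y\<in>ext w. ext y = insert x (ext x)"
    using infinity by blast
  have "isset {n \<in> ext w. n \<in> Ord}" by (rule isset_sep[OF w(1)]) (intro pdi)
  then obtain w' where w': "w' \<in> V" "ext w' = {n \<in> ext w. n \<in> Ord}" by (rule issetE)
  have succ: "succ n \<in> ext w'" if n: "n \<in> ext w'" for n
  proof -
    obtain y where y: "y \<in> ext w" "ext y = insert n (ext n)" using w(4) n w'(2) by blast
    then have "y = succ n" using n extD by (intro extensionality) auto
    then show ?thesis using y n w' by auto
  qed
  have "z = zero" using w extD by (intro extensionality) auto
  then have zero: "zero \<in> ext w'" using w w' by simp
  have "isset (\<Union>n\<in>ext w'. ext (recursor G n))"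
    by (rule isset_UN[OF w'(1)]) (intro pf_recursor G pdi)
  then obtain U where U: "U \<in> V" "ext U = (\<Union>n\<in>ext w'. ext (recursor G n))" by (rule issetE)
  have "a \<in> ext (recursor G zero)" unfolding T[OF zero_Ord] by simp
  then have "a \<in> ext U" unfolding U(2) using zero by (rule UN_I[rotated])
  moreover have "x \<in> ext U" if "y \<in> ext U" "x \<in> ext y" for x y
  proof -
    from that(1) obtain n where n: "n \<in> ext w'" "y \<in> ext (recursor G n)" unfolding U(2) by (rule UN_E)
    have nO: "n \<in> Ord" using n(1) w'(2) by blast
    have "\<exists>d\<in>ext (succ n). \<exists>y\<in>ext (recursor G d). x \<in> ext y"
      using n(2) that(2) nO by (intro bexI[of _ n] bexI[of _ y]) simp_all
    then have "x \<in> ext (recursor G (succ n))" unfolding T[OF succ_Ord[OF nO]] by blast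
    then show ?thesis unfolding U(2) using succ[OF n(1)] by (rule UN_I[rotated])
  qed
  ultimately show ?thesis using U(1) unfolding transitive_def by blast
qed

text \<open>Inside a transitive set around \<open>a\<close>, take a membership-minimal set
  \<open>m\<close> that lies in no level. Its elements have least levels, replacement bounds these,
  and so \<open>m\<close> lies in the level after the bound.\<close>

lemma ex_level:
  assumes a: "a \<in> V"
  shows "\<exists>d\<in>Ord. a \<in> ext (level d)"
proof (rule ccontr)
  assume na: "\<not> (\<exists>d\<in>Ord. a \<in> ext (level d))"
  let ?P = "\<lambda>x. \<exists>d\<in>V. d \<in> Ord \<and> x \<in> ext (level d)"
  obtain U where U: "U \<in> V" "a \<in> ext U" "transitive U" using transitive_superset[OF a] by blast
  have "isset {x \<in> ext U. \<not> ?P x}" by (rule isset_sep[OF U(1)]) (intro pdi)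
  then obtain B where B: "B \<in> V" "ext B = {x \<in> ext U. \<not> ?P x}" by (rule issetE)
  have "a \<in> ext B" using B U na by auto
  then obtain m where m: "m \<in> ext B" "ext m \<inter> ext B = {}" using foundation[OF B(1)] by blast
  then have mV: "m \<in> V" using extD by blast
  have *: "?P x" if "x \<in> ext m" for x
    using that m B U(3) unfolding transitive_def by blast
  let ?r = "\<lambda>x. mu (\<lambda>d. x \<in> ext (level d))"
  have r: "?r x \<in> Ord \<and> x \<in> ext (level (?r x))" if "x \<in> ext m" for x
  proof -
    obtain d where d: "d \<in> Ord" "x \<in> ext (level d)" using *[OF \<open>x \<in> ext m\<close>] by blast
    have pd: "pd UNIV (\<lambda>e. x \<in> ext (level (e 0)))" using that extD by (intro pdi pf_param) auto
    show ?thesis using mu(1,2)[OF pd d] by simp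
  qed
  have "pf UNIV (\<lambda>e. ?r (e 0))" by (intro pdi)
  from Ord_bound[OF mV this] r obtain b where b: "b \<in> Ord" "\<forall>x\<in>ext m. ?r x \<in> ext b" by blast
  have "ext m \<subseteq> ext (level b)" using r b level_mono by blast
  then have "m \<in> ext (level (succ b))" using level_succ b mV by blast
  then show False using m B b(1) by auto
qed

text \<open>The least level with a witness is a definable function of \<open>x\<close>, so
  replacement bounds it. No choice of the witnesses themselves is made.\<close>

lemma collection:
  assumes P: "pd UNIV (\<lambda>e. P (e 0) (e 1))" and a: "a \<in> V"
  shows "\<exists>b\<in>Ord. \<forall>x\<in>ext a. (\<exists>y\<in>V. P x y) \<longrightarrow> (\<exists>y\<in>ext (level b). P x y)"
proof -
  note pdP = pd_subst2[OF P]
  have "isset {x \<in> ext a. \<exists>y\<in>V. P x y}" by (rule isset_sep[OF a]) (intro pdi pdP)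
  then obtain A where A: "A \<in> V" "ext A = {x \<in> ext a. \<exists>y\<in>V. P x y}" by (rule issetE)
  let ?r = "\<lambda>x. mu (\<lambda>d. \<exists>y\<in>ext (level d). P x y)"
  have r: "?r x \<in> Ord \<and> (\<exists>y\<in>ext (level (?r x)). P x y)" if x: "x \<in> ext A" for x
  proof -
    obtain y where y: "y \<in> V" "P x y" using x A by blast
    obtain d where d: "d \<in> Ord" "y \<in> ext (level d)" using ex_level[OF y(1)] by blast
    have pd: "pd UNIV (\<lambda>e. \<exists>y\<in>ext (level (e 0)). P x y)" using x extD by (intro pdi pdP pf_param) auto
    have "\<exists>y\<in>ext (level d). P x y" using d y by blast
    from mu(1,2)[OF pd d(1) this] show ?thesis by simp
  qed
  have "pf UNIV (\<lambda>e. ?r (e 0))" by (intro pdi pdP)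
  from Ord_bound[OF A(1) this] r obtain b where b: "b \<in> Ord" "\<forall>x\<in>ext A. ?r x \<in> ext b" by blast
  have "\<exists>y\<in>ext (level b). P x y" if "x \<in> ext A" for x
    using r[OF that] b that level_mono by blast
  then show ?thesis using b(1) A(2) by blast
qed

section \<open>A well-ordered class closed under Goedel operations\<close>

definition diff :: "'a \<Rightarrow> 'a \<Rightarrow> 'a"
  where "diff a b = mk {x \<in> V. x \<in> ext a \<and> x \<notin> ext b}"

definition mem_less :: "'a \<Rightarrow> 'a \<Rightarrow> 'a"
  where "mem_less a b = mk {u \<in> V. \<exists>x\<in>ext a. \<exists>y\<in>ext a. \<exists>c\<in>ext b. u = opair x (opair y c) \<and> x \<in> ext y}"

definition cylinder :: "'a \<Rightarrow> 'a \<Rightarrow> 'a"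
  where "cylinder a b = mk {u \<in> V. \<exists>x\<in>V. \<exists>y\<in>ext a. \<exists>c\<in>V. u = opair x (opair y c) \<and> opair x c \<in> ext b}"

definition fibre :: "'a \<Rightarrow> 'a \<Rightarrow> 'a"
  where "fibre a b = mk {x \<in> V. opair x b \<in> ext a}"

lemma isset_diff: "a \<in> V \<Longrightarrow> b \<in> V \<Longrightarrow> isset {x \<in> V. x \<in> ext a \<and> x \<notin> ext b}"
  by (rule isset_subset[of a]) (auto intro!: pdi pf_param)

lemma isset_mem_less:
  "a \<in> V \<Longrightarrow> b \<in> V \<Longrightarrow> isset {u \<in> V. \<exists>x\<in>ext a. \<exists>y\<in>ext a. \<exists>c\<in>ext b. u = opair x (opair y c) \<and> x \<in> ext y}"
  by (rule isset_subset[of "cprod a (cprod a b)"]) (auto intro!: pdi pf_param simp: extD)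

lemma isset_cylinder:
  assumes "a \<in> V" "b \<in> V"
  shows "isset {u \<in> V. \<exists>x\<in>V. \<exists>y\<in>ext a. \<exists>c\<in>V. u = opair x (opair y c) \<and> opair x c \<in> ext b}"
proof (rule isset_subset[of "cprod (bigcup (bigcup b)) (cprod a (bigcup (bigcup b)))"])
  fix u assume "\<exists>x\<in>V. \<exists>y\<in>ext a. \<exists>c\<in>V. u = opair x (opair y c) \<and> opair x c \<in> ext b"
  then obtain x y c where u: "x \<in> V" "y \<in> ext a" "c \<in> V" "u = opair x (opair y c)" "opair x c \<in> ext b" by blast
  then show "u \<in> ext (cprod (bigcup (bigcup b)) (cprod a (bigcup (bigcup b))))"
    using opair_mem_bigcup[of x c b] assms extD[OF u(2)] by (simp del: ext_bigcup)
qed (use assms in \<open>auto intro!: pdi pf_param\<close>)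

lemma isset_fibre: "a \<in> V \<Longrightarrow> b \<in> V \<Longrightarrow> isset {x \<in> V. opair x b \<in> ext a}"
  by (rule isset_subset[of "bigcup (bigcup a)"])
    (auto intro!: pdi pf_param simp del: ext_bigcup simp: opair_mem_bigcup)

lemma diff_in [simp]: "a \<in> V \<Longrightarrow> b \<in> V \<Longrightarrow> diff a b \<in> V"
  and ext_diff [simp]: "a \<in> V \<Longrightarrow> b \<in> V \<Longrightarrow> ext (diff a b) = ext a - ext b"
  using isset_mk[OF isset_diff] by (auto simp: diff_def dest: extD)

lemma mem_less_in [simp]: "a \<in> V \<Longrightarrow> b \<in> V \<Longrightarrow> mem_less a b \<in> V"
  and ext_mem_less: "a \<in> V \<Longrightarrow> b \<in> V \<Longrightarrow> ext (mem_less a b) =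
    {u \<in> V. \<exists>x\<in>ext a. \<exists>y\<in>ext a. \<exists>c\<in>ext b. u = opair x (opair y c) \<and> x \<in> ext y}"
  using isset_mk[OF isset_mem_less] by (simp_all only: mem_less_def)

lemma cylinder_in [simp]: "a \<in> V \<Longrightarrow> b \<in> V \<Longrightarrow> cylinder a b \<in> V"
  and ext_cylinder: "a \<in> V \<Longrightarrow> b \<in> V \<Longrightarrow> ext (cylinder a b) =
    {u \<in> V. \<exists>x\<in>V. \<exists>y\<in>ext a. \<exists>c\<in>V. u = opair x (opair y c) \<and> opair x c \<in> ext b}"
  using isset_mk[OF isset_cylinder] by (simp_all only: cylinder_def)

lemma fibre_in [simp]: "a \<in> V \<Longrightarrow> b \<in> V \<Longrightarrow> fibre a b \<in> V"
  and ext_fibre: "a \<in> V \<Longrightarrow> b \<in> V \<Longrightarrow> ext (fibre a b) = {x \<in> V. opair x b \<in> ext a}"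
  using isset_mk[OF isset_fibre] by (simp_all only: fibre_def)

lemma pf_diff [pdi]: "pf K t \<Longrightarrow> pf K s \<Longrightarrow> pf K (\<lambda>e. diff (t e) (s e))"
  by (rule pf_subst2[of K diff]) (auto simp: diff_def intro!: pf_mk pdi isset_diff Env_nth)

lemma pf_mem_less [pdi]: "pf K t \<Longrightarrow> pf K s \<Longrightarrow> pf K (\<lambda>e. mem_less (t e) (s e))"
proof (rule pf_subst2[of K mem_less])
  show "pf K (\<lambda>e. mem_less (e 0) (e 1))"
    unfolding mem_less_def by (rule pf_mk, intro pdi) (rule isset_mem_less; erule Env_nth)
qed

lemma pf_cylinder [pdi]: "pf K t \<Longrightarrow> pf K s \<Longrightarrow> pf K (\<lambda>e. cylinder (t e) (s e))"
  by (rule pf_subst2[of K cylinder]) (auto simp: cylinder_def intro!: pf_mk pdi isset_cylinder Env_nth)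

lemma pf_fibre [pdi]: "pf K t \<Longrightarrow> pf K s \<Longrightarrow> pf K (\<lambda>e. fibre (t e) (s e))"
  by (rule pf_subst2[of K fibre]) (auto simp: fibre_def intro!: pf_mk pdi isset_fibre Env_nth)

text \<open>Each serves a syntactic step: \<open>mem_less\<close> the membership atom,
  \<open>cylinder\<close> a dummy variable, \<open>diff\<close> implication, \<open>ran\<close> the
  existential quantifier, \<open>fibre\<close> the insertion of parameters. \<open>upair\<close> and
  \<open>cprod\<close> build tuples, and \<open>bigcup\<close> extracts the element of a
  singleton.\<close>

definition operations :: "('a \<Rightarrow> 'a \<Rightarrow> 'a) list" where
  "operations = [upair, diff, cprod, mem_less, cylinder, fibre, \<lambda>a b. ran a, \<lambda>a b. bigcup a]"

text \<open>A generator gets an index and two enumerated values. Both argument orders are listed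
  because only pairs whose second index is at most the first are processed.\<close>

definition generators :: "'a \<Rightarrow> ('a \<Rightarrow> 'a \<Rightarrow> 'a \<Rightarrow> 'a) list" where
  "generators X = [\<lambda>d a b. level d, \<lambda>d a b. X] @ map (\<lambda>g d a b. g a b) operations
    @ map (\<lambda>g d a b. g b a) operations"

lemma pf_generators:
  assumes "X \<in> V" "X \<in> K" "g \<in> set (generators X)" "pf K t" "pf K s" "pf K u"
  shows "pf K (\<lambda>e. g (t e) (s e) (u e))"
  using assms(3) unfolding generators_def operations_def
  by (auto intro!: pdi pf_const assms)

lemma generators_in:
  "X \<in> V \<Longrightarrow> g \<in> set (generators X) \<Longrightarrow> a \<in> V \<Longrightarrow> b \<in> V \<Longrightarrow> d \<in> V \<Longrightarrow> g d a b \<in> V"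
  unfolding generators_def operations_def by auto

section \<open>A definable enumeration by transfinite recursion\<close>

lemma pd_list_ex:
  "(\<And>g. g \<in> set gs \<Longrightarrow> pd K (\<lambda>e. P g e)) \<Longrightarrow> pd K (\<lambda>e. \<exists>g\<in>set gs. P g e)"
  by (induction gs) (auto intro!: pdi)

lemma pd_list_all:
  "(\<And>g. g \<in> set gs \<Longrightarrow> pd K (\<lambda>e. P g e)) \<Longrightarrow> pd K (\<lambda>e. \<forall>g\<in>set gs. P g e)"
  by (induction gs) (auto intro!: pdi)

text \<open>The list lives outside the model, so choosing a new value unfolds into finitely many
  nested conditionals and stays definable.\<close>

primrec pick :: "('a \<Rightarrow> 'a \<Rightarrow> 'a \<Rightarrow> 'a) list \<Rightarrow> 'a \<Rightarrow> 'a \<Rightarrow> 'a \<Rightarrow> 'a \<Rightarrow> 'a" where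
  "pick [] r d a b = zero"
| "pick (g # gs) r d a b = (if g d a b \<in> ext r then pick gs r d a b else g d a b)"

lemma pick:
  "\<exists>g\<in>set gs. g d a b \<notin> ext r \<Longrightarrow> pick gs r d a b \<notin> ext r \<and> (\<exists>g\<in>set gs. pick gs r d a b = g d a b)"
  by (induction gs) auto

lemma pf_pick:
  assumes "\<And>g. g \<in> set gs \<Longrightarrow> pf K (\<lambda>e. g (t e) (s e) (u e))" "pf K v"
  shows "pf K (\<lambda>e. pick gs (v e) (t e) (s e) (u e))"
  using assms by (induction gs) (auto intro!: pdi)

text \<open>The union of the singleton of the value; it is total, with the empty set off the
  domain.\<close>

definition app :: "'a \<Rightarrow> 'a \<Rightarrow> 'a"
  where "app f d = bigcup (mk {y \<in> V. opair d y \<in> ext f})"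

lemma isset_app: "f \<in> V \<Longrightarrow> d \<in> V \<Longrightarrow> isset {y \<in> V. opair d y \<in> ext f}"
  by (rule isset_subset[of "bigcup (bigcup f)"])
    (auto intro!: pdi pf_param simp del: ext_bigcup simp: opair_mem_bigcup)

lemma pf_app [pdi]: "pf K t \<Longrightarrow> pf K s \<Longrightarrow> pf K (\<lambda>e. app (t e) (s e))"
  by (rule pf_subst2[of K app]) (auto simp: app_def intro!: pf_mk pdi isset_app Env_nth)

lemma app_segment:
  assumes "pf UNIV (\<lambda>e. G (e 0))" "a \<in> Ord" "d \<in> ext a"
  shows "app (segment G a) d = recursor G d"
proof -
  note in_V = recursor_in[OF assms(1)]
  have "{y \<in> V. opair d y \<in> ext (segment G a)} = {recursor G d}"
    using segment_app[OF assms(1,2)] assms(3) extD in_V by auto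
  moreover have "mk {recursor G d} = upair (recursor G d) (recursor G d)"
    by (rule mk_eqI) (simp_all add: in_V)
  ultimately show ?thesis
    by (simp add: app_def) (rule extensionality, simp_all add: in_V)
qed

text \<open>Here \<open>f\<close> is to be the enumeration up to some ordinal. The first conjunct
  expresses that \<open>d\<close> lies below that ordinal, so the stage need not be passed as a
  further argument.\<close>

definition unsaturated :: "'a \<Rightarrow> 'a \<Rightarrow> 'a \<Rightarrow> 'a \<Rightarrow> bool" where
  "unsaturated X f d d' \<longleftrightarrow> (\<exists>y\<in>V. opair d y \<in> ext f) \<and> (d' = d \<or> d' \<in> ext d) \<and>
    (\<exists>g\<in>set (generators X). g d (app f d) (app f d') \<notin> ext (ran f))"

definition first_index :: "'a \<Rightarrow> 'a \<Rightarrow> 'a"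
  where "first_index X f = mu (\<lambda>d. \<exists>d'\<in>V. unsaturated X f d d')"

definition second_index :: "'a \<Rightarrow> 'a \<Rightarrow> 'a"
  where "second_index X f = mu (\<lambda>d'. unsaturated X f (first_index X f) d')"

text \<open>The first index is the larger one, so that only set many values can be chosen while a given
  pair of indices is unsaturated. The other case keeps the enumeration injective.\<close>

definition next_value :: "'a \<Rightarrow> 'a \<Rightarrow> 'a" where
  "next_value X f =
    (if \<exists>d\<in>V. d \<in> Ord \<and> (\<exists>d'\<in>V. unsaturated X f d d')
     then pick (generators X) (ran f) (first_index X f) (app f (first_index X f)) (app f (second_index X f))
     else level (mu (\<lambda>b. level b \<notin> ext (ran f))))"

definition enum :: "'a \<Rightarrow> 'a \<Rightarrow> 'a"
  where "enum X = recursor (next_value X)"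

definition Cl :: "'a \<Rightarrow> 'a set"
  where "Cl X = enum X ` Ord"

context
  fixes X K
  assumes X: "X \<in> V" "X \<in> K"
begin

lemma pd_generators:
  assumes "pf K t" "pf K s" "pf K u" "pf K v"
  shows "pd K (\<lambda>e. \<exists>g\<in>set (generators X). g (t e) (s e) (u e) \<notin> ext (v e))"
proof (rule pd_list_ex)
  fix g assume "g \<in> set (generators X)"
  from pf_generators[OF X this assms(1-3)] show "pd K (\<lambda>e. g (t e) (s e) (u e) \<notin> ext (v e))"
    by (intro pdi assms)
qed

lemma pf_pick_generators:
  "pf K v \<Longrightarrow> pf K t \<Longrightarrow> pf K s \<Longrightarrow> pf K u \<Longrightarrow> pf K (\<lambda>e. pick (generators X) (v e) (t e) (s e) (u e))"
  by (rule pf_pick) (rule pf_generators[OF X])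

lemma pd_unsaturated:
  assumes "pf K t" "pf K s" "pf K u"
  shows "pd K (\<lambda>e. unsaturated X (t e) (s e) (u e))"
  by (rule pd_subst3[of K "unsaturated X", OF _ assms])
    (unfold unsaturated_def, intro pdi pd_generators)

lemma pf_first_index: "pf K t \<Longrightarrow> pf K (\<lambda>e. first_index X (t e))"
  by (rule pf_subst1[of K "first_index X"]) (auto simp: first_index_def intro!: pdi pd_unsaturated)

lemma pf_second_index: "pf K t \<Longrightarrow> pf K (\<lambda>e. second_index X (t e))"
  by (rule pf_subst1[of K "second_index X"])
    (auto simp: second_index_def intro!: pdi pd_unsaturated pf_first_index)

lemma pf_next_value: "pf K (\<lambda>e. next_value X (e 0))"
  unfolding next_value_def
  by (intro pdi pd_unsaturated pf_first_index pf_second_index pf_pick_generators)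

lemma pf_enum: "pf K t \<Longrightarrow> pf K (\<lambda>e. enum X (t e))"
  unfolding enum_def by (rule pf_recursor[OF pf_next_value])

lemma pd_Cl: "pf K t \<Longrightarrow> pd K (\<lambda>e. t e \<in> Cl X)"
proof (rule pd_subst1[of K "\<lambda>x. x \<in> Cl X"])
  have "pd K (\<lambda>e. \<exists>d\<in>V. d \<in> Ord \<and> e 0 = enum X d)" by (intro pdi pf_enum)
  then show "pd K (\<lambda>e. e 0 \<in> Cl X)" by (rule pd_cong) (auto simp: Cl_def)
qed

end

section \<open>Injectivity and closure of the enumeration\<close>

context
  fixes X
  assumes X: "X \<in> V"
begin

lemmas nv = pf_next_value[OF X UNIV_I]

lemma enum_in [simp]: "enum X a \<in> V"
  unfolding enum_def by (rule recursor_in[OF nv])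

lemma enum_eq: "enum X a = next_value X (segment (next_value X) a)"
  by (simp add: enum_def recursor_def)

lemma segment_in_V: "segment (next_value X) a \<in> V"
  by (rule segment_in[OF nv])

lemma ext_ran_enum: "a \<in> Ord \<Longrightarrow> ext (ran (segment (next_value X) a)) = enum X ` ext a"
  unfolding enum_def by (rule ext_ran_segment[OF nv])

lemma unsaturated_segment:
  assumes "a \<in> Ord" "d \<in> V"
  shows "unsaturated X (segment (next_value X) a) d d' \<longleftrightarrow> d \<in> ext a \<and> (d' = d \<or> d' \<in> ext d) \<and>
    (\<exists>g\<in>set (generators X). g d (enum X d) (enum X d') \<notin> enum X ` ext a)"
proof -
  have 1: "(\<exists>y\<in>V. opair d y \<in> ext (segment (next_value X) a)) \<longleftrightarrow> d \<in> ext a"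
    using segment_app[OF nv assms] enum_in[of d] by (auto simp: enum_def)
  have 2: "app (segment (next_value X) a) d = enum X d" if "d \<in> ext a" for d
    unfolding enum_def by (rule app_segment[OF nv assms(1) that])
  have 3: "app (segment (next_value X) a) d' = enum X d'" if "d \<in> ext a" "d' = d \<or> d' \<in> ext d"
    using that 2 Ord_trans[OF assms(1)] by blast
  show ?thesis
    unfolding unsaturated_def 1 ext_ran_enum[OF assms(1)]
    by (intro conj_cong refl) (simp only: 2 3)
qed

text \<open>For the second claim: the first index is minimal, hence at most \<open>d\<close>, and
  the second index is at most the first. So an unsaturated pair confines the next value to what is
  generated from indices up to \<open>d\<close>.\<close>

lemma enum_cases:
  assumes a: "a \<in> Ord"
  shows "enum X a \<notin> enum X ` ext a"
    and "unsaturated X (segment (next_value X) a) d d' \<Longrightarrow> d \<in> Ord \<Longrightarrow>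
      \<exists>g\<in>set (generators X). \<exists>x\<in>ext (succ d). \<exists>y\<in>ext (succ d). enum X a = g x (enum X x) (enum X y)"
proof -
  let ?f = "segment (next_value X) a"
  let ?c = "\<exists>d\<in>V. d \<in> Ord \<and> (\<exists>d'\<in>V. unsaturated X ?f d d')"
  note un = pd_unsaturated[OF X UNIV_I]
  have pd1: "pd UNIV (\<lambda>e. \<exists>d'\<in>V. unsaturated X ?f (e 0) d')"
    by (intro pdi un pf_param segment_in_V)
  have pd2: "pd UNIV (\<lambda>e. unsaturated X ?f (first_index X ?f) (e 0))"
    by (intro pdi un pf_param segment_in_V pf_first_index[OF X UNIV_I])
  have dO': "d' \<in> Ord" if "unsaturated X ?f d d'" "d \<in> Ord" for d d'
    using that Ord_elem unfolding unsaturated_def by blast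
  have *: "\<exists>g\<in>set (generators X). \<exists>x\<in>ext (succ d). \<exists>y\<in>ext (succ d).
      enum X a = g x (enum X x) (enum X y) \<and> enum X a \<notin> enum X ` ext a"
    if u: "unsaturated X ?f d d'" and d: "d \<in> Ord" for d d'
  proof -
    let ?x = "first_index X ?f" and ?y = "second_index X ?f"
    have d': "d' \<in> Ord" using dO' u d by blast
    then have c: ?c using u d by (intro bexI[of _ d] conjI bexI[of _ d']) auto
    have "\<exists>d'\<in>V. unsaturated X ?f d d'" using u d' by (intro bexI[of _ d']) auto
    note mx = mu[OF pd1 d this, folded first_index_def]
    then obtain y where y: "unsaturated X ?f ?x y" by blast
    have "y \<in> Ord" using dO' y mx(1) by blast
    note my = mu[OF pd2 this y, folded second_index_def]
    have xV: "?x \<in> V" using mx(1) by simp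
    from my(2) have s: "?x \<in> ext a" "?y = ?x \<or> ?y \<in> ext ?x"
      "\<exists>g\<in>set (generators X). g ?x (enum X ?x) (enum X ?y) \<notin> ext (ran ?f)"
      unfolding unsaturated_segment[OF a xV] ext_ran_enum[OF a] by blast+
    have sy: "?y \<in> ext a" using s(1,2) Ord_trans[OF a] by metis
    have "enum X a = pick (generators X) (ran ?f) ?x (app ?f ?x) (app ?f ?y)"
      using c by (simp add: enum_eq[of a] next_value_def)
    also have "\<dots> = pick (generators X) (ran ?f) ?x (enum X ?x) (enum X ?y)"
      using app_segment[OF nv a s(1)] app_segment[OF nv a sy] by (simp add: enum_def)
    finally have "enum X a \<notin> ext (ran ?f) \<and> (\<exists>g\<in>set (generators X). enum X a = g ?x (enum X ?x) (enum X ?y))"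
      using pick[OF s(3)] by simp
    moreover have "?x \<in> ext (succ d)" using mx(4) d by auto
    moreover have "?y \<in> ext (succ d)"
      using s(2) calculation(2) Ord_trans[OF succ_Ord[OF d]] by metis
    ultimately show ?thesis unfolding ext_ran_enum[OF a] by blast
  qed
  show "\<exists>g\<in>set (generators X). \<exists>x\<in>ext (succ d). \<exists>y\<in>ext (succ d). enum X a = g x (enum X x) (enum X y)"
    if "unsaturated X ?f d d'" "d \<in> Ord" using *[OF that] by blast
  show "enum X a \<notin> enum X ` ext a"
  proof (cases ?c)
    case True
    then show ?thesis using * by blast
  next
    case False
    have pd: "pd UNIV (\<lambda>e. level (e 0) \<notin> ext (ran ?f))" by (intro pdi pf_param ran_in segment_in_V)
    \<comment> \<open>Some level is still missing from the range: a level that has the range as an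
      element cannot itself belong to the range.\<close>
    obtain b where b: "b \<in> Ord" "ran ?f \<in> ext (level b)" using ex_level[of "ran ?f"] segment_in_V by auto
    have "level b \<notin> ext (ran ?f)" using b(2) not_mem_cycle by blast
    from mu(2)[OF pd b(1) this] have "level (mu (\<lambda>b. level b \<notin> ext (ran ?f))) \<notin> ext (ran ?f)" .
    moreover have "enum X a = level (mu (\<lambda>b. level b \<notin> ext (ran ?f)))"
      unfolding enum_eq[of a] next_value_def[of X ?f] by (rule if_not_P[OF False])
    ultimately show ?thesis unfolding ext_ran_enum[OF a] by (simp only: not_False_eq_True)
  qed
qed

lemma enum_inj:
  assumes "a \<in> Ord" "b \<in> Ord" "enum X a = enum X b"
  shows "a = b"
  using Ord_linear[OF assms(1,2)] enum_cases(1)[OF assms(1)] enum_cases(1)[OF assms(2)] assms(3)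
  by (metis imageI)

text \<open>Collection takes a single argument, hence the coding by pairs. The finitely many values
  at one pair are gathered into a set \<open>z\<close>, and transitivity of the level passes from
  \<open>z\<close> to its elements.\<close>

lemma generators_bound:
  assumes D: "D \<in> V"
  shows "\<exists>b\<in>Ord. \<forall>g\<in>set (generators X). \<forall>x\<in>ext D. \<forall>y\<in>ext D. g x (enum X x) (enum X y) \<in> ext (level b)"
proof -
  let ?P = "\<lambda>p z. \<exists>x\<in>V. \<exists>y\<in>V. p = opair x y \<and> (\<forall>g\<in>set (generators X). g x (enum X x) (enum X y) \<in> ext z)"
  have gen: "pd UNIV (\<lambda>e. \<forall>g\<in>set (generators X). g (t e) (enum X (t e)) (enum X (s e)) \<in> ext (u e))"
    if "pf UNIV t" "pf UNIV s" "pf UNIV u" for t s u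
  proof (rule pd_list_all)
    fix g assume "g \<in> set (generators X)"
    from pf_generators[OF X UNIV_I this that(1) pf_enum[OF X UNIV_I that(1)] pf_enum[OF X UNIV_I that(2)]]
    show "pd UNIV (\<lambda>e. g (t e) (enum X (t e)) (enum X (s e)) \<in> ext (u e))"
      using that(3) by (rule pd_mem_ext)
  qed
  have "pd UNIV (\<lambda>e. ?P (e 0) (e 1))" by (intro pdi gen)
  from collection[OF this, of "cprod D D"] D obtain b where b: "b \<in> Ord"
    "\<forall>p\<in>ext (cprod D D). (\<exists>z\<in>V. ?P p z) \<longrightarrow> (\<exists>z\<in>ext (level b). ?P p z)" by auto
  have fin: "\<exists>z\<in>V. \<forall>g\<in>set gs. h g \<in> ext z" if "\<forall>g\<in>set gs. h g \<in> V" for h and gs :: "('a \<Rightarrow> 'a \<Rightarrow> 'a \<Rightarrow> 'a) list"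
    using that
  proof (induction gs)
    case (Cons g gs)
    then obtain z where "z \<in> V" "\<forall>g\<in>set gs. h g \<in> ext z" by auto
    then show ?case using Cons.prems by (intro bexI[of _ "cup z (upair (h g) (h g))"]) auto
  next
    case Nil
    show ?case by (intro bexI[of _ zero]) auto
  qed
  have "g x (enum X x) (enum X y) \<in> ext (level b)"
    if g: "g \<in> set (generators X)" and xy: "x \<in> ext D" "y \<in> ext D" for g x y
  proof -
    have V: "x \<in> V" "y \<in> V" using xy extD by blast+
    then obtain z where "z \<in> V" "\<forall>g\<in>set (generators X). g x (enum X x) (enum X y) \<in> ext z"
      using fin[of "generators X" "\<lambda>g. g x (enum X x) (enum X y)"] generators_in[OF X] by auto
    then have "\<exists>z\<in>V. ?P (opair x y) z" using V by blast
    moreover have "opair x y \<in> ext (cprod D D)" using xy V D by simp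
    ultimately obtain z x' y' where z: "z \<in> ext (level b)" "x' \<in> V" "y' \<in> V" "opair x y = opair x' y'"
      "\<forall>g\<in>set (generators X). g x' (enum X x') (enum X y') \<in> ext z" using b(2) by blast
    then have "g x (enum X x) (enum X y) \<in> ext z" using V g by simp
    then show ?thesis using level_trans[OF b(1) z(1)] by blast
  qed
  then show ?thesis using b(1) by blast
qed

lemma mu_Ord: "pd UNIV (\<lambda>e. Q (e 0)) \<Longrightarrow> mu Q \<in> Ord"
proof (cases "\<exists>a\<in>Ord. Q a")
  case False
  then have "below Q = {x \<in> V. False}" by blast
  then have "mu Q = zero" unfolding mu_def zero_def by metis
  then show ?thesis by simp
qed (use mu(1) in blast)

text \<open>If the value never appeared, the pair would stay unsaturated at all stages past
  \<open>d\<close>, so all later values would lie in one level, against injectivity of the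
  enumeration.\<close>

lemma Cl_generators_aux:
  assumes d: "d \<in> Ord" "d' \<in> ext (succ d)" and g: "g \<in> set (generators X)"
  shows "g d (enum X d) (enum X d') \<in> Cl X"
proof (rule ccontr)
  assume nC: "g d (enum X d) (enum X d') \<notin> Cl X"
  obtain b where b: "b \<in> Ord" "\<forall>g\<in>set (generators X). \<forall>x\<in>ext (succ d). \<forall>y\<in>ext (succ d).
      g x (enum X x) (enum X y) \<in> ext (level b)"
    using generators_bound[of "succ d"] d by auto
  have late: "enum X a \<in> ext (level b)" if a: "a \<in> Ord" "d \<in> ext a" for a
  proof -
    have "enum X ` ext a \<subseteq> Cl X" using Ord_elem[OF a(1)] unfolding Cl_def by blast
    then have "unsaturated X (segment (next_value X) a) d d'"
      unfolding unsaturated_segment[OF a(1) Ord_in[OF d(1)]] using a d g nC by auto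
    from enum_cases(2)[OF a(1) this d(1)] b(2) show ?thesis by metis
  qed
  \<comment> \<open>The inverse of the enumeration, with value \<open>zero\<close> off its range.
    Replacement bounds it on \<open>level b\<close> by some \<open>c\<close>, and a stage
    \<open>a\<close> beyond \<open>c\<close> gives the contradiction.\<close>
  let ?i = "\<lambda>y. mu (\<lambda>a. enum X a = y)"
  have pd: "pd UNIV (\<lambda>e. enum X (e 0) = y)" if "y \<in> V" for y
    by (intro pdi pf_enum[OF X UNIV_I] pf_param that)
  have "pf UNIV (\<lambda>e. ?i (e 0))" by (intro pdi pf_enum[OF X UNIV_I])
  from Ord_bound[OF _ this, of "level b"] mu_Ord[OF pd] extD
  obtain c where c: "c \<in> Ord" "\<forall>y\<in>ext (level b). ?i y \<in> ext c" by auto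
  obtain a where a: "a \<in> Ord" "c \<in> ext a" "d \<in> ext a" using Ord_max[OF c(1) d(1)] by blast
  have "?i (enum X a) = a"
    using mu(1,2)[OF pd[of "enum X a"] a(1)] enum_inj[OF _ a(1)] by auto
  then have "a \<in> ext c" using late[OF a(1,3)] c(2) by auto
  then show False using a(2) not_mem_cycle by blast
qed

lemma Cl_level: "d \<in> Ord \<Longrightarrow> level d \<in> Cl X"
  using Cl_generators_aux[of d d "\<lambda>d a b. level d"] by (simp add: generators_def)

lemma Cl_param: "X \<in> Cl X"
  using Cl_generators_aux[of zero zero "\<lambda>d a b. X"] by (simp add: generators_def)

lemma Cl_operations:
  assumes "g \<in> set operations" "a \<in> Cl X" "b \<in> Cl X"
  shows "g a b \<in> Cl X"
proof -
  obtain c d where cd: "c \<in> Ord" "d \<in> Ord" "a = enum X c" "b = enum X d" using assms by (auto simp: Cl_def)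
  have 1: "(\<lambda>d a b. g a b) \<in> set (generators X)" "(\<lambda>d a b. g b a) \<in> set (generators X)"
    using assms(1) by (auto simp: generators_def)
  show ?thesis
  proof (cases "d \<in> ext (succ c)")
    case True
    from Cl_generators_aux[OF cd(1) this 1(1)] show ?thesis using cd by simp
  next
    case False
    then have "c \<in> ext (succ d)" using Ord_linear[OF cd(1,2)] cd by auto
    from Cl_generators_aux[OF cd(2) this 1(2)] show ?thesis using cd by simp
  qed
qed

lemma Cl_in_V: "a \<in> Cl X \<Longrightarrow> a \<in> V"
  by (auto simp: Cl_def)

lemma Cl_closed:
  assumes "a \<in> Cl X" "b \<in> Cl X"
  shows "upair a b \<in> Cl X" "diff a b \<in> Cl X" "cprod a b \<in> Cl X" "mem_less a b \<in> Cl X"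
    "cylinder a b \<in> Cl X" "fibre a b \<in> Cl X" "ran a \<in> Cl X" "bigcup a \<in> Cl X"
  using Cl_operations[OF _ assms, of upair] Cl_operations[OF _ assms, of diff]
    Cl_operations[OF _ assms, of cprod] Cl_operations[OF _ assms, of mem_less]
    Cl_operations[OF _ assms, of cylinder]
    Cl_operations[OF _ assms, of fibre] Cl_operations[OF _ assms, of "\<lambda>a b. ran a"]
    Cl_operations[OF _ assms, of "\<lambda>a b. bigcup a"]
  by (simp_all add: operations_def)

end

section \<open>Closure under definability\<close>

text \<open>Ending in \<open>zero\<close> instead of the last component makes every tail a tuple and
  lets length 0 start the inductions.\<close>

primrec tup :: "nat \<Rightarrow> (nat \<Rightarrow> 'a) \<Rightarrow> 'a" where
  "tup 0 e = zero"
| "tup (Suc n) e = opair (e 0) (tup n (\<lambda>i. e (Suc i)))"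

primrec tuples :: "nat \<Rightarrow> 'a \<Rightarrow> 'a" where
  "tuples 0 a = upair zero zero"
| "tuples (Suc n) a = cprod a (tuples n a)"

lemma tup_in [simp]: "e \<in> Env V \<Longrightarrow> tup n e \<in> V"
  by (induction n arbitrary: e) (auto simp: Env_nth Env_ren)

lemma tuples_in [simp]: "a \<in> V \<Longrightarrow> tuples n a \<in> V"
  by (induction n) auto

lemma all_less_Suc: "(\<forall>i<Suc n. P i) \<longleftrightarrow> P 0 \<and> (\<forall>i<n. P (Suc i))"
  using less_Suc_eq_0_disj by auto

lemma tup_eq_iff:
  "e \<in> Env V \<Longrightarrow> e' \<in> Env V \<Longrightarrow> tup n e = tup n e' \<longleftrightarrow> (\<forall>i<n. e i = e' i)"
  by (induction n arbitrary: e e') (simp_all add: all_less_Suc Env_nth Env_ren)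

lemma tup_in_tuples:
  "a \<in> V \<Longrightarrow> e \<in> Env V \<Longrightarrow> tup n e \<in> ext (tuples n a) \<longleftrightarrow> (\<forall>i<n. e i \<in> ext a)"
  by (induction n arbitrary: e) (simp_all add: all_less_Suc Env_nth Env_ren)

lemma tuples_tup:
  "a \<in> V \<Longrightarrow> c \<in> ext (tuples n a) \<Longrightarrow> \<exists>e\<in>Env V. c = tup n e"
proof (induction n arbitrary: c)
  case 0
  then have "c = tup 0 (\<lambda>_. a)" "(\<lambda>_. a) \<in> Env V" by auto
  then show ?case by blast
next
  case (Suc n)
  then obtain x c' where c: "x \<in> ext a" "c' \<in> ext (tuples n a)" "c = opair x c'" by (auto simp: ext_cprod)
  with Suc obtain e where "e \<in> Env V" "c' = tup n e" by blast
  then show ?case using c extD by (intro bexI[of _ "case_nat x e"]) auto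
qed

lemma tup_Suc_case [simp]: "tup (Suc n) (case_nat x e) = opair x (tup n e)"
  by simp

definition cat :: "nat \<Rightarrow> (nat \<Rightarrow> 'a) \<Rightarrow> (nat \<Rightarrow> 'a) \<Rightarrow> nat \<Rightarrow> 'a"
  where "cat n e e' i = (if i < n then e i else e' (i - n))"

lemma cat_in: "e \<in> Env V \<Longrightarrow> e' \<in> Env V \<Longrightarrow> cat n e e' \<in> Env V"
  by (simp add: Env_def cat_def)

text \<open>The length is an outer number, so decoding unfolds into finitely many quantifiers.
  \<open>R\<close> reads the components first and then \<open>e'\<close>, whence the tuple itself
  stands at position \<open>n\<close>.\<close>

lemma pd_tup:
  assumes "pd K R"
  shows "pd K (\<lambda>e'. \<exists>e\<in>Env V. e' 0 = tup n e \<and> R (cat n e e'))"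
  using assms
proof (induction n arbitrary: R)
  case 0
  have "pd K (\<lambda>e. e 0 = zero \<and> R e)" by (intro pdi 0)
  then show ?case by (rule pd_cong) (auto simp: cat_def)
next
  case (Suc n)
  \<comment> \<open>The new head \<open>x\<close> stands at position \<open>n+1\<close>, behind the
    tail \<open>c\<close>; the renaming brings it to the front and skips \<open>c\<close>.\<close>
  let ?k = "case_nat (Suc n) (\<lambda>i. if i < n then i else Suc (Suc i))"
  define S where "S = (\<lambda>e'. \<exists>e\<in>Env V. e' 0 = tup n e \<and> R (\<lambda>i. cat n e e' (?k i)))"
  have S: "pd K S" unfolding S_def using Suc.IH[OF pd_ren[OF Suc.prems, of ?k]] .
  have "pd K (\<lambda>e. \<exists>c\<in>V. e 1 = opair (e 0) c \<and> S (case_nat c e))"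
    by (rule pd_ex, unfold case_nat_eta) (intro pd_conj pd_eq pf_opair pf_var S)
  then have "pd K (\<lambda>e. \<exists>x\<in>V. \<exists>c\<in>V. e 0 = opair x c \<and> S (case_nat c (case_nat x e)))"
    by (intro pd_ex[where P = "\<lambda>x e. \<exists>c\<in>V. e 0 = opair x c \<and> S (case_nat c (case_nat x e))"])
      (simp only: case_nat_eta One_nat_def)
  then show ?case
  proof (rule pd_cong)
    fix e' assume e': "e' \<in> Env V"
    have "(\<lambda>i. cat n e (case_nat c (case_nat x e')) (?k i)) = cat (Suc n) (case_nat x e) e'" for e c x
      by (auto simp: fun_eq_iff cat_def Suc_diff_le split: nat.split)
    then have S': "S (case_nat c (case_nat x e')) \<longleftrightarrow> (\<exists>e\<in>Env V. c = tup n e \<and> R (cat (Suc n) (case_nat x e) e'))" for c x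
      by (simp add: S_def)
    show "(\<exists>x\<in>V. \<exists>c\<in>V. e' 0 = opair x c \<and> S (case_nat c (case_nat x e')))
        \<longleftrightarrow> (\<exists>e\<in>Env V. e' 0 = tup (Suc n) e \<and> R (cat (Suc n) e e'))" (is "?L \<longleftrightarrow> ?R")
    proof
      assume "?L"
      then obtain x e where "x \<in> V" "e \<in> Env V" "e' 0 = opair x (tup n e)" "R (cat (Suc n) (case_nat x e) e')"
        unfolding S' by blast
      then show "?R"
        by (intro bexI[of _ "case_nat x e"]) auto
    next
      assume "?R"
      then obtain e where e: "e \<in> Env V" "e' 0 = opair (e 0) (tup n (\<lambda>i. e (Suc i)))" "R (cat (Suc n) e e')" by auto
      then have "R (cat (Suc n) (case_nat (e 0) (\<lambda>i. e (Suc i))) e')" by (simp only: case_nat_eta)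
      then have "S (case_nat (tup n (\<lambda>i. e (Suc i))) (case_nat (e 0) e'))"
        unfolding S' using Env_ren[OF e(1)] by blast
      then show "?L"
        using e Env_ren[OF e(1)] Env_nth[OF e(1)] tup_in by blast
    qed
  qed
qed

definition depends :: "nat \<Rightarrow> ((nat \<Rightarrow> 'a) \<Rightarrow> bool) \<Rightarrow> bool"
  where "depends n P \<longleftrightarrow> (\<forall>e\<in>Env V. \<forall>e'\<in>Env V. (\<forall>i<n. e i = e' i) \<longrightarrow> P e = P e')"

lemma dependsD:
  "depends n P \<Longrightarrow> e \<in> Env V \<Longrightarrow> e' \<in> Env V \<Longrightarrow> (\<And>i. i < n \<Longrightarrow> e i = e' i) \<Longrightarrow> P e \<longleftrightarrow> P e'"
  unfolding depends_def by blast

definition tupset :: "nat \<Rightarrow> 'a \<Rightarrow> ((nat \<Rightarrow> 'a) \<Rightarrow> bool) \<Rightarrow> 'a set"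
  where "tupset n a P = {tup n e | e. e \<in> Env V \<and> (\<forall>i<n. e i \<in> ext a) \<and> P e}"

lemma tup_in_tupset:
  assumes "depends n P" "e \<in> Env V"
  shows "tup n e \<in> tupset n a P \<longleftrightarrow> (\<forall>i<n. e i \<in> ext a) \<and> P e"
proof
  assume "tup n e \<in> tupset n a P"
  then obtain e' where e': "tup n e = tup n e'" "e' \<in> Env V" "\<forall>i<n. e' i \<in> ext a" "P e'"
    by (auto simp: tupset_def)
  then have eq: "\<forall>i<n. e i = e' i" using assms(2) tup_eq_iff by blast
  have "P e = P e'" using assms(1)[unfolded depends_def, rule_format, OF assms(2) e'(2)] eq by blast
  then show "(\<forall>i<n. e i \<in> ext a) \<and> P e" using e' eq by simp
qed (use assms in \<open>auto simp: tupset_def\<close>)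

lemma tupset_subset: "a \<in> V \<Longrightarrow> tupset n a P \<subseteq> ext (tuples n a)"
  by (auto simp: tupset_def tup_in_tuples)

lemma tupset_eqI:
  assumes "a \<in> V" "depends n P" "ext z \<subseteq> ext (tuples n a)"
    and "\<And>e. e \<in> Env V \<Longrightarrow> (\<And>i. i < n \<Longrightarrow> e i \<in> ext a) \<Longrightarrow> tup n e \<in> ext z \<longleftrightarrow> P e"
  shows "ext z = tupset n a P"
proof (intro equalityI subsetI)
  fix c assume c: "c \<in> ext z"
  then obtain e where e: "e \<in> Env V" "c = tup n e" using assms(1,3) tuples_tup by blast
  then show "c \<in> tupset n a P" using c assms tup_in_tuples by (auto simp: tup_in_tupset)
next
  fix c assume "c \<in> tupset n a P"
  then show "c \<in> ext z" using assms(4) by (auto simp: tupset_def)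
qed

section \<open>Relations whose restrictions to all levels lie in the class\<close>

context
  fixes X
  assumes X: "X \<in> V"
begin

text \<open>Only the tuples are restricted to a level; \<open>P\<close> itself is evaluated in all
  of \<open>V\<close>. Demanding this for every level lets the quantifier step move to a larger
  one.\<close>

definition represented :: "nat \<Rightarrow> ((nat \<Rightarrow> 'a) \<Rightarrow> bool) \<Rightarrow> bool" where
  "represented n P \<longleftrightarrow> depends n P \<and> (\<forall>d\<in>Ord. \<exists>z\<in>Cl X. ext z = tupset n (level d) P)"

lemma representedI:
  assumes "depends n P"
    and "\<And>d. d \<in> Ord \<Longrightarrow> \<exists>z\<in>Cl X. ext z \<subseteq> ext (tuples n (level d)) \<and>
      (\<forall>e\<in>Env V. (\<forall>i<n. e i \<in> ext (level d)) \<longrightarrow> (tup n e \<in> ext z \<longleftrightarrow> P e))"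
  shows "represented n P"
  unfolding represented_def
proof (intro conjI ballI assms(1))
  fix d assume "d \<in> Ord"
  from assms(2)[OF this] obtain z where "z \<in> Cl X" "ext z \<subseteq> ext (tuples n (level d))"
      "\<forall>e\<in>Env V. (\<forall>i<n. e i \<in> ext (level d)) \<longrightarrow> (tup n e \<in> ext z \<longleftrightarrow> P e)" by blast
  then show "\<exists>z\<in>Cl X. ext z = tupset n (level d) P"
    using tupset_eqI[OF level_in_V assms(1)] by blast
qed

definition represents :: "'a \<Rightarrow> nat \<Rightarrow> 'a \<Rightarrow> ((nat \<Rightarrow> 'a) \<Rightarrow> bool) \<Rightarrow> bool" where
  "represents z n d P \<longleftrightarrow> z \<in> Cl X \<and> z \<in> V \<and> ext z \<subseteq> ext (tuples n (level d)) \<and>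
    (\<forall>e\<in>Env V. tup n e \<in> ext z \<longleftrightarrow> (\<forall>i<n. e i \<in> ext (level d)) \<and> P e)"

lemma representsD:
  assumes "represents z n d P"
  shows "z \<in> Cl X" "z \<in> V" "ext z \<subseteq> ext (tuples n (level d))"
    "\<forall>e\<in>Env V. tup n e \<in> ext z \<longleftrightarrow> (\<forall>i<n. e i \<in> ext (level d)) \<and> P e"
  using assms by (simp_all add: represents_def)

lemma representedE:
  assumes "represented n P" "d \<in> Ord"
  shows "\<exists>z. represents z n d P"
proof -
  obtain z where z: "z \<in> Cl X" "ext z = tupset n (level d) P"
    using assms unfolding represented_def by blast
  have "depends n P" using assms(1) by (simp add: represented_def)
  then show ?thesis
    using z Cl_in_V[OF X z(1)] tupset_subset[OF level_in_V] tup_in_tupset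
    by (intro exI[of _ z]) (auto simp: represents_def)
qed

lemma represented_cong: "represented n P \<Longrightarrow> (\<And>e. e \<in> Env V \<Longrightarrow> P e \<longleftrightarrow> Q e) \<Longrightarrow> represented n Q"
proof -
  assume P: "represented n P" and eq: "\<And>e. e \<in> Env V \<Longrightarrow> P e \<longleftrightarrow> Q e"
  have "tupset n a P = tupset n a Q" for a using eq by (auto simp: tupset_def)
  moreover have "depends n Q"
    unfolding depends_def
  proof (intro ballI impI)
    fix e e' assume e: "e \<in> Env V" "e' \<in> Env V" "\<forall>i<n. e i = e' i"
    have "P e = P e'"
      using P[unfolded represented_def depends_def, THEN conjunct1, rule_format, OF e(1,2)] e(3) by blast
    then show "Q e = Q e'" using eq[OF e(1)] eq[OF e(2)] by blast
  qed
  ultimately show "represented n Q" using P by (simp add: represented_def)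
qed

lemma zero_Cl: "zero \<in> Cl X"
proof -
  have "diff X X = zero" using X by (intro extensionality) auto
  then show ?thesis using Cl_closed(2)[OF X Cl_param[OF X] Cl_param[OF X]] by simp
qed

lemma tuples_Cl: "d \<in> Ord \<Longrightarrow> tuples n (level d) \<in> Cl X"
  by (induction n) (auto intro: Cl_closed[OF X] zero_Cl Cl_level[OF X])

lemma represented_cylinder:
  assumes "represented (Suc n) P"
  shows "represented (Suc (Suc n)) (\<lambda>e. P (case_nat (e 0) (\<lambda>i. e (Suc (Suc i)))))"
proof (rule representedI)
  show "depends (Suc (Suc n)) (\<lambda>e. P (case_nat (e 0) (\<lambda>i. e (Suc (Suc i)))))"
    unfolding depends_def
  proof (intro ballI impI)
    have P: "depends (Suc n) P" using assms by (simp add: represented_def)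
    fix e e' assume e: "e \<in> Env V" "e' \<in> Env V" "\<forall>i<Suc (Suc n). e i = e' i"
    show "P (case_nat (e 0) (\<lambda>i. e (Suc (Suc i)))) \<longleftrightarrow> P (case_nat (e' 0) (\<lambda>i. e' (Suc (Suc i))))"
      by (rule dependsD[OF P]) (use e in \<open>auto simp: Env_def split: nat.split\<close>)
  qed
  fix d assume d: "d \<in> Ord"
  obtain z where "represents z (Suc n) d P"
    using representedE[OF assms d] by blast
  note z = representsD[OF this]
  show "\<exists>z\<in>Cl X. ext z \<subseteq> ext (tuples (Suc (Suc n)) (level d)) \<and>
      (\<forall>e\<in>Env V. (\<forall>i<Suc (Suc n). e i \<in> ext (level d)) \<longrightarrow>
        (tup (Suc (Suc n)) e \<in> ext z \<longleftrightarrow> P (case_nat (e 0) (\<lambda>i. e (Suc (Suc i))))))"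
  proof (intro bexI conjI ballI impI)
    show "cylinder (level d) z \<in> Cl X" using z(1) d by (intro Cl_closed[OF X] Cl_level[OF X])
    show "ext (cylinder (level d) z) \<subseteq> ext (tuples (Suc (Suc n)) (level d))"
    proof
      fix u assume "u \<in> ext (cylinder (level d) z)"
      then obtain x y c where u: "x \<in> V" "y \<in> ext (level d)" "c \<in> V" "u = opair x (opair y c)" "opair x c \<in> ext z"
        using z(2) by (auto simp: ext_cylinder)
      then have "x \<in> ext (level d) \<and> c \<in> ext (tuples n (level d))" using z(3) by auto
      then show "u \<in> ext (tuples (Suc (Suc n)) (level d))" using u extD[OF u(2)] by simp
    qed
    fix e assume e: "e \<in> Env V" "\<forall>i<Suc (Suc n). e i \<in> ext (level d)"
    let ?c = "tup n (\<lambda>i. e (Suc (Suc i)))"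
    have c: "?c \<in> V" "e 0 \<in> V" "e 1 \<in> V" "e 1 \<in> ext (level d)" using e tup_in[of "\<lambda>i. e (Suc (Suc i))" n] by (auto simp: Env_def)
    have "tup (Suc (Suc n)) e \<in> ext (cylinder (level d) z) \<longleftrightarrow> opair (e 0) ?c \<in> ext z"
      using c z(2) extD by (auto simp: ext_cylinder)
    also have "\<dots> \<longleftrightarrow> tup (Suc n) (case_nat (e 0) (\<lambda>i. e (Suc (Suc i)))) \<in> ext z" by simp
    also have "\<dots> \<longleftrightarrow> P (case_nat (e 0) (\<lambda>i. e (Suc (Suc i))))"
      using e by (subst z(4)[rule_format]) (auto simp: Env_def all_less_Suc split: nat.split)
    finally show "tup (Suc (Suc n)) e \<in> ext (cylinder (level d) z) \<longleftrightarrow> P (case_nat (e 0) (\<lambda>i. e (Suc (Suc i))))" .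
  qed
qed

lemma represented_False: "represented n (\<lambda>e. False)"
  by (rule representedI) (auto simp: depends_def intro!: bexI[of _ zero] zero_Cl)

lemma represented_imp:
  assumes "represented n P" "represented n Q"
  shows "represented n (\<lambda>e. P e \<longrightarrow> Q e)"
proof (rule representedI)
  show "depends n (\<lambda>e. P e \<longrightarrow> Q e)"
    using assms unfolding represented_def depends_def by blast
  fix d assume d: "d \<in> Ord"
  obtain z where "represents z n d P"
    using representedE[OF assms(1) d] by blast
  note z = representsD[OF this]
  obtain y where "represents y n d Q"
    using representedE[OF assms(2) d] by blast
  note y = representsD[OF this]
  show "\<exists>z\<in>Cl X. ext z \<subseteq> ext (tuples n (level d)) \<and>
      (\<forall>e\<in>Env V. (\<forall>i<n. e i \<in> ext (level d)) \<longrightarrow> (tup n e \<in> ext z \<longleftrightarrow> (P e \<longrightarrow> Q e)))"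
  proof (intro bexI conjI ballI impI)
    show "diff (tuples n (level d)) (diff z y) \<in> Cl X"
      using z(1) y(1) d by (intro Cl_closed[OF X] tuples_Cl)
    fix e assume "e \<in> Env V" "\<forall>i<n. e i \<in> ext (level d)"
    then show "tup n e \<in> ext (diff (tuples n (level d)) (diff z y)) \<longleftrightarrow> (P e \<longrightarrow> Q e)"
      using z y by (simp add: tup_in_tuples)
  qed (use z y in auto)
qed

lemma represented_not: "represented n P \<Longrightarrow> represented n (\<lambda>e. \<not> P e)"
  using represented_imp[OF _ represented_False, of n P] by simp

text \<open>By collection, the counterexamples for all tuples over level \<open>d\<close> already
  occur in a level \<open>b\<close>. Representing \<open>P\<close> on a level above both,
  complementing and projecting away the head gives exactly the tuples with a counterexample in
  \<open>V\<close>. Definability of \<open>P\<close> is needed for collection.\<close>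

lemma represented_all:
  assumes P: "represented (Suc n) P" "pd UNIV P"
  shows "represented n (\<lambda>e. \<forall>x\<in>V. P (case_nat x e))"
proof (rule representedI)
  have dep: "depends (Suc n) P" using P by (simp add: represented_def)
  then show "depends n (\<lambda>e. \<forall>x\<in>V. P (case_nat x e))"
    unfolding depends_def
  proof (intro ballI impI)
    fix e e' assume e: "e \<in> Env V" "e' \<in> Env V" "\<forall>i<n. e i = e' i"
    have "P (case_nat x e) \<longleftrightarrow> P (case_nat x e')" if "x \<in> V" for x
      by (rule dependsD[OF dep]) (use e that in \<open>auto split: nat.split\<close>)
    then show "(\<forall>x\<in>V. P (case_nat x e)) \<longleftrightarrow> (\<forall>x\<in>V. P (case_nat x e'))" by blast
  qed
  fix d assume d: "d \<in> Ord"
  let ?Q = "\<lambda>c x. \<exists>e\<in>Env V. c = tup n e \<and> \<not> P (case_nat x e)"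
  have "pd UNIV (\<lambda>e. ?Q (e 0) (e 1))"
  proof (rule pd_cong)
    \<comment> \<open>In the concatenation, the value \<open>x\<close> is \<open>e' 1\<close> and so
      stands at position \<open>n+1\<close>; the renaming moves it to the front. Positions beyond
      \<open>n\<close> of the result do not matter because of \<open>dep\<close>.\<close>
    let ?R = "\<lambda>f. \<not> P (\<lambda>i. f (case_nat (Suc n) (\<lambda>i. i) i))"
    show "pd UNIV (\<lambda>e'. \<exists>e\<in>Env V. e' 0 = tup n e \<and> ?R (cat n e e'))"
      using pd_tup[OF pd_not[OF pd_ren[OF P(2), of "case_nat (Suc n) (\<lambda>i. i)"]], of n] .
    fix e' assume e': "e' \<in> Env V"
    have "P (\<lambda>i. cat n e e' (case_nat (Suc n) (\<lambda>i. i) i)) \<longleftrightarrow> P (case_nat (e' 1) e)" if e: "e \<in> Env V" for e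
    proof -
      have "(\<lambda>i. cat n e e' (case_nat (Suc n) (\<lambda>i. i) i)) \<in> Env V" by (intro Env_ren[OF cat_in] e e')
      moreover have "case_nat (e' 1) e \<in> Env V" using e e' by (simp add: Env_nth)
      ultimately show ?thesis
        by (rule dependsD[OF dep]) (auto simp: cat_def split: nat.split)
    qed
    then show "(\<exists>e\<in>Env V. e' 0 = tup n e \<and> ?R (cat n e e')) \<longleftrightarrow> ?Q (e' 0) (e' 1)" by auto
  qed
  from collection[OF this, of "tuples n (level d)"] obtain b where b: "b \<in> Ord"
    "\<forall>c\<in>ext (tuples n (level d)). (\<exists>x\<in>V. ?Q c x) \<longrightarrow> (\<exists>x\<in>ext (level b). ?Q c x)" by auto
  obtain b' where b': "b' \<in> Ord" "d \<in> ext b'" "b \<in> ext b'" using Ord_max[OF d b(1)] by blast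
  obtain z where "represents z (Suc n) b' P"
    using representedE[OF P(1) b'(1)] by blast
  note z = representsD[OF this]
  \<comment> \<open>The tuples that violate \<open>P\<close>; \<open>ran\<close> drops the head,
    which is the first component of the outermost pair.\<close>
  let ?w = "diff (tuples (Suc n) (level b')) z"
  show "\<exists>z\<in>Cl X. ext z \<subseteq> ext (tuples n (level d)) \<and>
      (\<forall>e\<in>Env V. (\<forall>i<n. e i \<in> ext (level d)) \<longrightarrow> (tup n e \<in> ext z \<longleftrightarrow> (\<forall>x\<in>V. P (case_nat x e))))"
  proof (intro bexI conjI ballI impI)
    have wCl: "?w \<in> Cl X" using z(1) b'(1) by (intro Cl_closed[OF X] tuples_Cl)
    show "diff (tuples n (level d)) (ran ?w) \<in> Cl X"
      by (rule Cl_closed(2)[OF X tuples_Cl[OF d] Cl_closed(7)[OF X wCl wCl]])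
    have w: "?w \<in> V" using z(2) by (intro diff_in tuples_in level_in_V)
    show "ext (diff (tuples n (level d)) (ran ?w)) \<subseteq> ext (tuples n (level d))"
      using w by (simp del: tuples.simps)
    fix e assume e: "e \<in> Env V" "\<forall>i<n. e i \<in> ext (level d)"
    have eb: "\<forall>i<n. e i \<in> ext (level b')" using e(2) level_mono[OF b'(1,2)] by blast
    have tupin: "tup n e \<in> ext (tuples n (level d))" using e by (simp add: tup_in_tuples)
    have *: "opair x (tup n e) \<in> ext ?w \<longleftrightarrow> x \<in> ext (level b') \<and> \<not> P (case_nat x e)" if x: "x \<in> V" for x
    proof -
      have xe: "case_nat x e \<in> Env V" using x e by simp
      have 1: "(\<forall>i<Suc n. case_nat x e i \<in> ext (level b')) \<longleftrightarrow> x \<in> ext (level b')"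
        unfolding all_less_Suc nat.case using eb by blast
      have 2: "opair x (tup n e) \<in> ext (tuples (Suc n) (level b')) \<longleftrightarrow> x \<in> ext (level b')"
        using tup_in_tuples[OF level_in_V xe, of "Suc n" b'] unfolding 1 tup_Suc_case .
      have 3: "opair x (tup n e) \<in> ext z \<longleftrightarrow> x \<in> ext (level b') \<and> P (case_nat x e)"
        using z(4)[rule_format, OF xe] unfolding 1 tup_Suc_case .
      show ?thesis
        unfolding ext_diff[OF tuples_in[OF level_in_V] z(2)] Diff_iff 2 3 by blast
    qed
    have "tup n e \<in> ext (ran ?w) \<longleftrightarrow> (\<exists>x\<in>ext (level b'). \<not> P (case_nat x e))"
    proof -
      have "tup n e \<in> ext (ran ?w) \<longleftrightarrow> (\<exists>x\<in>V. opair x (tup n e) \<in> ext ?w)"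
        unfolding ext_ran[OF w] using tup_in[OF e(1)] by blast
      then show ?thesis using * extD by blast
    qed
    also have "\<dots> \<longleftrightarrow> (\<exists>x\<in>V. \<not> P (case_nat x e))"
    proof
      assume "\<exists>x\<in>V. \<not> P (case_nat x e)"
      then have "\<exists>x\<in>V. ?Q (tup n e) x" using e(1) by blast
      then obtain x e' where x: "x \<in> ext (level b)" "e' \<in> Env V" "tup n e = tup n e'" "\<not> P (case_nat x e')"
        using b(2) tupin by blast
      then have xV: "x \<in> V" using extD by blast
      have "\<forall>i<Suc n. case_nat x e i = case_nat x e' i"
        using x(2,3) e(1) by (simp add: tup_eq_iff all_less_Suc)
      then have "\<not> P (case_nat x e)" using dep x(2,4) e(1) xV unfolding depends_def by (metis Env_case_nat)
      then show "\<exists>x\<in>ext (level b'). \<not> P (case_nat x e)" using x(1) level_mono[OF b'(1,3)] by blast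
    qed (use extD in blast)
    finally show "tup n e \<in> ext (diff (tuples n (level d)) (ran ?w)) \<longleftrightarrow> (\<forall>x\<in>V. P (case_nat x e))"
      using w tupin by (simp del: tuples.simps)
  qed
qed

lemma opair_in_mem_less:
  assumes "a \<in> V" "b \<in> V" "x \<in> V" "y \<in> V" "c \<in> V"
  shows "opair x (opair y c) \<in> ext (mem_less a b) \<longleftrightarrow> x \<in> ext a \<and> y \<in> ext a \<and> c \<in> ext b \<and> x \<in> ext y"
proof
  assume "opair x (opair y c) \<in> ext (mem_less a b)"
  then obtain x' y' c' where *: "x' \<in> ext a" "y' \<in> ext a" "c' \<in> ext b"
      "opair x (opair y c) = opair x' (opair y' c')" "x' \<in> ext y'"
    using assms by (auto simp: ext_mem_less)
  then show "x \<in> ext a \<and> y \<in> ext a \<and> c \<in> ext b \<and> x \<in> ext y"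
    using assms extD[OF *(1)] extD[OF *(2)] extD[OF *(3)] by simp
qed (use assms in \<open>auto simp: ext_mem_less\<close>)

lemma represented_mem_less: "represented (Suc (Suc n)) (\<lambda>e. E (e 0) (e 1))"
proof (rule representedI)
  show "depends (Suc (Suc n)) (\<lambda>e. E (e 0) (e 1))" by (simp add: depends_def all_less_Suc)
  fix d assume d: "d \<in> Ord"
  show "\<exists>z\<in>Cl X. ext z \<subseteq> ext (tuples (Suc (Suc n)) (level d)) \<and>
      (\<forall>e\<in>Env V. (\<forall>i<Suc (Suc n). e i \<in> ext (level d)) \<longrightarrow> (tup (Suc (Suc n)) e \<in> ext z \<longleftrightarrow> E (e 0) (e 1)))"
  proof (intro bexI conjI ballI impI)
    show "mem_less (level d) (tuples n (level d)) \<in> Cl X"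
      using d by (intro Cl_closed[OF X] tuples_Cl Cl_level[OF X])
    show "ext (mem_less (level d) (tuples n (level d))) \<subseteq> ext (tuples (Suc (Suc n)) (level d))"
      using extD by (auto simp: ext_mem_less)
    fix e assume e: "e \<in> Env V" "\<forall>i<Suc (Suc n). e i \<in> ext (level d)"
    have c: "tup n (\<lambda>i. e (Suc (Suc i))) \<in> ext (tuples n (level d))"
      using e by (subst tup_in_tuples) (auto simp: Env_def)
    then show "tup (Suc (Suc n)) e \<in> ext (mem_less (level d) (tuples n (level d))) \<longleftrightarrow> E (e 0) (e 1)"
      using e extD[OF c] by (simp add: opair_in_mem_less Env_nth) (simp add: ext_def Env_nth)
  qed
qed

text \<open>Each use of \<open>represented_cylinder\<close> inserts a coordinate after the first and
  so pushes the right variable of the atom one place further.\<close>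

lemma represented_head: "j < m \<Longrightarrow> represented (Suc m) (\<lambda>e. E (e 0) (e (Suc j)))"
proof (induction j arbitrary: m)
  case 0
  then show ?case using represented_mem_less by (cases m) auto
next
  case (Suc j)
  then obtain k where k: "m = Suc k" "j < k" by (cases m) auto
  from represented_cylinder[OF Suc.IH[OF k(2)]] show ?case by (simp add: k(1))
qed

text \<open>Only atoms whose left variable is the first component are primitive; quantifiers reduce the
  others to these.\<close>

lemma represented_eq:
  assumes "i < n" "j < n"
  shows "represented n (\<lambda>e. e i = e j)"
proof -
  let ?P = "\<lambda>e. \<not> ((E (e 0) (e (Suc i)) \<longrightarrow> E (e 0) (e (Suc j))) \<longrightarrow> \<not> (E (e 0) (e (Suc j)) \<longrightarrow> E (e 0) (e (Suc i))))"
  have "represented (Suc n) ?P"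
    using assms by (intro represented_not represented_imp represented_head)
  moreover have "pd UNIV ?P" by (intro pdi pd_E)
  ultimately have "represented n (\<lambda>e. \<forall>x\<in>V. ?P (case_nat x e))" by (rule represented_all)
  then show ?thesis
  proof (rule represented_cong)
    fix e assume e: "e \<in> Env V"
    have "e i = e j" if "\<forall>x\<in>V. E x (e i) \<longleftrightarrow> E x (e j)"
      using that e by (intro extensionality) (auto simp: ext_def Env_nth)
    then show "(\<forall>x\<in>V. ?P (case_nat x e)) \<longleftrightarrow> e i = e j" by auto
  qed
qed

lemma represented_mem:
  assumes "i < n" "j < n"
  shows "represented n (\<lambda>e. E (e i) (e j))"
proof -
  let ?P = "\<lambda>e. e 0 = e (Suc i) \<longrightarrow> \<not> E (e 0) (e (Suc j))"
  have "represented (Suc n) ?P"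
    using assms by (intro represented_not represented_imp represented_head represented_eq) auto
  moreover have "pd UNIV ?P" by (intro pdi pd_E)
  ultimately have "represented n (\<lambda>e. \<forall>x\<in>V. ?P (case_nat x e))" by (rule represented_all)
  from represented_not[OF this] show ?thesis
    by (rule represented_cong) (auto simp: Env_nth)
qed

lemma represented_sat: "(\<And>i. i \<in> fv p \<Longrightarrow> i < n) \<Longrightarrow> represented n (\<lambda>e. sat V E e p)"
proof (induction p arbitrary: n)
  case (Forall p)
  have "i < Suc n" if "i \<in> fv p" for i using that Forall.prems by (cases i) auto
  from represented_all[OF Forall.IH[OF this] pd_sat] show ?case by simp
qed (auto intro: represented_mem represented_eq represented_False represented_imp)

text \<open>The defining formula has finitely many parameters. Over a level containing them and
  \<open>a\<close>, its solution set of tuples lies in the class; the fibre over the parameter tuple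
  is the singleton of \<open>a\<close>, and its union is \<open>a\<close>.\<close>

theorem Cl_definable:
  assumes P: "pd (Cl X) (\<lambda>e. P (e 0))" and a: "a \<in> V" "P a" "\<And>b. b \<in> V \<Longrightarrow> P b \<Longrightarrow> b = a"
  shows "a \<in> Cl X"
proof -
  from P obtain p r where r: "\<And>i c. r i = Inr c \<Longrightarrow> c \<in> Cl X \<and> c \<in> V"
    and p: "\<And>e. e \<in> Env V \<Longrightarrow> P (e 0) \<longleftrightarrow> sat V E (asg e r) p"
    by (rule pdE) blast
  \<comment> \<open>\<open>P\<close> reads position 0 only, so all position variables may be merged
    into variable 0. Slots without a parameter are filled with \<open>X\<close>, which is a member
    of the class.\<close>
  let ?k = "\<lambda>i. case r i of Inl _ \<Rightarrow> 0 | Inr _ \<Rightarrow> Suc i"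
  let ?q = "\<lambda>i. case r i of Inl _ \<Rightarrow> X | Inr c \<Rightarrow> c"
  have q: "?q i \<in> Cl X" "?q i \<in> V" for i
    using r X Cl_param[OF X] by (auto split: sum.split)
  then have qE: "?q \<in> Env V" by (simp add: Env_def)
  have sat: "sat V E (case_nat b ?q) (ren ?k p) \<longleftrightarrow> P b" if "b \<in> V" for b
  proof -
    have "case_nat b ?q \<circ> ?k = asg (\<lambda>_. b) r"
      by (auto simp: fun_eq_iff split: sum.split)
    then show ?thesis using p[of "\<lambda>_. b"] that by (simp add: sat_ren)
  qed
  obtain m where m: "\<And>i. i \<in> fv (ren ?k p) \<Longrightarrow> i < Suc m"
    using finite_fv finite_nat_set_iff_bounded by (metis less_Suc_eq)
  have "\<exists>d\<in>Ord. a \<in> ext (level d) \<and> (\<forall>i<n. ?q i \<in> ext (level d))" for n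
  proof (induction n)
    case 0
    show ?case using ex_level[OF a(1)] by auto
  next
    case (Suc n)
    then obtain d where d: "d \<in> Ord" "a \<in> ext (level d)" "\<forall>i<n. ?q i \<in> ext (level d)" by blast
    obtain b where b: "b \<in> Ord" "?q n \<in> ext (level b)" using ex_level[OF q(2)] by blast
    obtain c where "c \<in> Ord" "d \<in> ext c" "b \<in> ext c" using Ord_max[OF d(1) b(1)] by blast
    then show ?case using d b level_mono[of c d] level_mono[of c b]
      by (intro bexI[of _ c]) (auto simp: less_Suc_eq)
  qed
  then obtain d where d: "d \<in> Ord" "a \<in> ext (level d)" "\<forall>i<m. ?q i \<in> ext (level d)" by blast
  obtain z where "represents z (Suc m) d (\<lambda>e. sat V E e (ren ?k p))"
    using representedE[OF represented_sat[OF m] d(1)] by blast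
  note z = representsD[OF this]
  have c: "tup m e \<in> Cl X" if "\<And>i. e i \<in> Cl X" for e
    using that by (induction m arbitrary: e) (auto simp: opair_def intro!: Cl_closed[OF X] zero_Cl)
  have f: "fibre z (tup m ?q) \<in> Cl X" using z(1) c q by (intro Cl_closed[OF X]) auto
  have "x \<in> ext (fibre z (tup m ?q)) \<longleftrightarrow> x = a" if x: "x \<in> V" for x
  proof -
    have xE: "case_nat x ?q \<in> Env V" using x qE by simp
    have "x \<in> ext (fibre z (tup m ?q)) \<longleftrightarrow> tup (Suc m) (case_nat x ?q) \<in> ext z"
      using x z(2) qE by (simp add: ext_fibre)
    also have "\<dots> \<longleftrightarrow> x \<in> ext (level d) \<and> P x"
      unfolding z(4)[rule_format, OF xE] sat[OF x] using d(3) by (simp add: all_less_Suc)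
    finally show ?thesis using a d(2) x by blast
  qed
  then have "ext (fibre z (tup m ?q)) = {a}" using extD a(1) by blast
  then have "bigcup (fibre z (tup m ?q)) = a"
    using a(1) z(2) qE by (intro extensionality) auto
  then show ?thesis using Cl_closed(8)[OF X f f] by simp
qed

end

end

section \<open>The inner model\<close>

context struct begin

lemma sat_choice:
  "sat V E e ax_choice \<longleftrightarrow> (\<forall>a\<in>V. (\<forall>x\<in>ext a. ext x \<noteq> {}) \<and>
      (\<forall>x\<in>ext a. \<forall>y\<in>ext a. x \<noteq> y \<longrightarrow> ext x \<inter> ext y = {}) \<longrightarrow>
      (\<exists>c\<in>V. \<forall>x\<in>ext a. \<exists>!u. u \<in> V \<and> u \<in> ext x \<and> u \<in> ext c))"
proof -
  have ball: "(\<forall>x\<in>ext a. P x) \<longleftrightarrow> (\<forall>x\<in>V. E x a \<longrightarrow> P x)" for a P by (auto simp: ext_def)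
  have int: "ext x \<inter> ext y = {} \<longleftrightarrow> \<not> (\<exists>z\<in>V. E z x \<and> E z y)" for x y by (auto simp: ext_def)
  have mem: "u \<in> V \<and> u \<in> ext x \<and> u \<in> ext c \<longleftrightarrow> u \<in> V \<and> E u x \<and> E u c" for u x c by (auto simp: ext_def)
  show ?thesis
    unfolding ball int mem ax_choice_def
    by (simp add: sat_empty sat_Exists1 del: ex_simps all_simps ball_simps bex_simps)
qed

end

context ZF_axioms begin

lemma pd_sections:
  assumes "pd K P" "e \<in> Env V" "\<And>i. e i \<in> K"
  shows "pd K (\<lambda>e'. P (case_nat (e' 0) (case_nat (e' 1) e)))"
proof -
  let ?s = "case_nat (Inl 0) (case_nat (Inl 1) (\<lambda>i. Inr (e i)))"
  have "pd K (\<lambda>e'. P (asg e' ?s))"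
    using assms by (intro pd_subst_sum) (auto simp: Env_nth split: nat.split_asm)
  moreover have eq: "asg e' ?s = case_nat (e' 0) (case_nat (e' 1) e)" for e'
    by (auto split: nat.split)
  ultimately show ?thesis unfolding eq by simp
qed

text \<open>Hereditary membership in \<open>Cl X\<close>, expressed by some transitive set around
  \<open>a\<close>, so that it is definable without a transitive closure operation.\<close>

definition Inn :: "'a \<Rightarrow> 'a set"
  where "Inn X = {a \<in> V. \<exists>t\<in>V. transitive t \<and> a \<in> ext t \<and> (\<forall>x\<in>ext t. x \<in> Cl X)}"

context
  fixes X
  assumes X: "X \<in> V"
begin

lemma pd_Inn:
  assumes "X \<in> K" "pf K t"
  shows "pd K (\<lambda>e. t e \<in> Inn X)"
proof -
  have "pd K (\<lambda>e. \<exists>s\<in>V. transitive s \<and> t e \<in> ext s \<and> (\<forall>x\<in>ext s. x \<in> Cl X))"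
    by (intro pdi pd_Cl[OF X assms(1)] pf_ren[OF assms(2), of Suc])
  then show ?thesis by (rule pd_cong) (auto simp: Inn_def pf_in[OF assms(2)])
qed

lemma Inn_in_V: "a \<in> Inn X \<Longrightarrow> a \<in> V"
  by (simp add: Inn_def)

lemma Inn_Cl: "a \<in> Inn X \<Longrightarrow> a \<in> Cl X"
  by (auto simp: Inn_def)

lemma Inn_trans: "a \<in> Inn X \<Longrightarrow> x \<in> ext a \<Longrightarrow> x \<in> Inn X"
  using extD unfolding Inn_def transitive_def by blast

text \<open>The transitive witness is the part of a level around \<open>a\<close> that lies in the
  inner model, with \<open>a\<close> added.\<close>

lemma InnI:
  assumes "a \<in> Cl X" "\<And>x. x \<in> ext a \<Longrightarrow> x \<in> Inn X"
  shows "a \<in> Inn X"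
proof -
  have a: "a \<in> V" using assms(1) Cl_in_V[OF X] by blast
  obtain d where d: "d \<in> Ord" "a \<in> ext (level d)" using ex_level[OF a] by blast
  have "isset {x \<in> ext (level d). x \<in> Inn X \<or> x = a}"
    by (rule isset_sep[OF level_in_V]) (intro pdi pd_Inn pf_param a UNIV_I)
  then obtain t where t: "t \<in> V" "ext t = {x \<in> ext (level d). x \<in> Inn X \<or> x = a}" by (rule issetE)
  have "transitive t"
    unfolding transitive_def t(2) using assms(2) Inn_trans level_trans[OF d(1)] by blast
  moreover have "\<forall>x\<in>ext t. x \<in> Cl X" using t(2) assms(1) Inn_Cl by blast
  moreover have "a \<in> ext t" using t(2) d(2) by blast
  ultimately show ?thesis using a t(1) unfolding Inn_def by blast
qed

lemma X_Cl: "X \<in> Cl X"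
  by (rule Cl_param[OF X])

text \<open>The bound \<open>B\<close> only has to be a set of \<open>V\<close>. The set
  \<open>z\<close> is the unique solution of a condition with parameters in the class, so
  \<open>Cl_definable\<close> applies.\<close>

lemma Inn_comprehension:
  assumes P: "pd (Cl X) (\<lambda>e. P (e 0))" and B: "B \<in> V" "\<And>u. u \<in> V \<Longrightarrow> P u \<Longrightarrow> u \<in> ext B"
    and M: "\<And>u. u \<in> V \<Longrightarrow> P u \<Longrightarrow> u \<in> Inn X"
  shows "\<exists>z\<in>Inn X. ext z = {u \<in> V. P u}"
proof -
  have "isset {u \<in> V. P u}"
    using isset_subset[OF B(1) _ B(2), of P] pd_mono[OF P] by blast
  then obtain z where z: "z \<in> V" "ext z = {u \<in> V. P u}" by (rule issetE)
  have "z \<in> Cl X"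
  proof (rule Cl_definable[OF X, where P = "\<lambda>z. \<forall>u\<in>V. u \<in> ext z \<longleftrightarrow> P u"])
    show "pd (Cl X) (\<lambda>e. \<forall>u\<in>V. u \<in> ext (e 0) \<longleftrightarrow> P u)" by (intro pdi pd_subst1[OF P])
    show "\<forall>u\<in>V. u \<in> ext z \<longleftrightarrow> P u" using z(2) by blast
    fix b assume "b \<in> V" "\<forall>u\<in>V. u \<in> ext b \<longleftrightarrow> P u"
    then show "b = z" using z extD by (intro extensionality) blast+
  qed (rule z(1))
  then have "z \<in> Inn X" by (rule InnI) (use z M in blast)
  then show ?thesis using z(2) by blast
qed

lemma upair_Inn: "a \<in> Inn X \<Longrightarrow> b \<in> Inn X \<Longrightarrow> upair a b \<in> Inn X"
  by (rule InnI) (auto simp: Inn_in_V Inn_Cl intro: Cl_closed[OF X])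

lemma opair_Inn: "a \<in> Inn X \<Longrightarrow> b \<in> Inn X \<Longrightarrow> opair a b \<in> Inn X"
  unfolding opair_def by (intro upair_Inn)

lemma bigcup_Inn: "a \<in> Inn X \<Longrightarrow> bigcup a \<in> Inn X"
  by (rule InnI) (auto simp: Inn_in_V Inn_Cl intro: Cl_closed(8)[OF X _ Inn_Cl] Inn_trans)

lemma succ_Inn: "a \<in> Inn X \<Longrightarrow> succ a \<in> Inn X"
  unfolding succ_def cup_def by (intro bigcup_Inn upair_Inn)

lemma zero_Inn: "zero \<in> Inn X"
  by (rule InnI) (auto intro: zero_Cl[OF X])

lemma ext_Inn: "a \<in> Inn X \<Longrightarrow> struct.ext (Inn X) E a = ext a"
proof -
  assume a: "a \<in> Inn X"
  have "x \<in> Inn X" if "x \<in> V" "E x a" for x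
    using Inn_trans[OF a] that by (simp add: ext_def)
  then show ?thesis using Inn_in_V unfolding struct.ext_def by blast
qed

text \<open>Relativization of quantifiers to a definable class; the only parameter is
  \<open>X\<close>.\<close>

lemma pd_sat_Inn: "pd (Cl X) (\<lambda>e. sat (Inn X) E e p)"
proof (induction p)
  case (Forall p)
  have "pd (Cl X) (\<lambda>e. \<forall>x\<in>V. x \<in> Inn X \<longrightarrow> sat (Inn X) E (case_nat x e) p)"
    by (rule pd_all, unfold case_nat_eta) (intro pdi pd_Inn X_Cl Forall)
  then show ?case by (rule pd_cong) (auto simp: Inn_in_V)
qed (auto intro!: pdi pd_E)

text \<open>The intersection of all inductive sets is definable without parameters. Its elements lie
  in the inner model because cutting an inductive set down to the inner model leaves an inductive
  set of \<open>V\<close>.\<close>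

lemma infinity_Inn: "\<exists>w\<in>Inn X. (\<exists>z\<in>ext w. ext z = {}) \<and> (\<forall>x\<in>ext w. \<exists>y\<in>ext w. ext y = insert x (ext x))"
proof -
  let ?I = "\<lambda>w. zero \<in> ext w \<and> (\<forall>x\<in>ext w. succ x \<in> ext w)"
  let ?P = "\<lambda>u. \<forall>w\<in>V. ?I w \<longrightarrow> u \<in> ext w"
  obtain w z where w: "w \<in> V" "z \<in> ext w" "ext z = {}" "\<forall>x\<in>ext w. \<exists>y\<in>ext w. ext y = insert x (ext x)"
    using infinity by blast
  have "z = zero" using w(2,3) extD by (intro extensionality) auto
  moreover have "succ x \<in> ext w" if x: "x \<in> ext w" for x
  proof -
    obtain y where "y \<in> ext w" "ext y = insert x (ext x)" using w(4)[rule_format, OF x] by blast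
    moreover from this have "y = succ x" using x extD by (intro extensionality) auto
    ultimately show ?thesis by simp
  qed
  ultimately have I: "?I w" using w(2) by blast
  have "\<exists>u\<in>Inn X. ext u = {u \<in> V. ?P u}"
  proof (rule Inn_comprehension[OF _ w(1)])
    show "pd (Cl X) (\<lambda>e. ?P (e 0))" by (intro pdi)
    show "u \<in> ext w" if "?P u" for u using that I w(1) by blast
    fix u assume u: "?P u"
    have "isset {x \<in> ext w. x \<in> Inn X}" by (rule isset_sep[OF w(1)]) (intro pd_Inn pdi UNIV_I)
    then obtain v where v: "v \<in> V" "ext v = {x \<in> ext w. x \<in> Inn X}" by (rule issetE)
    have "?I v" unfolding v(2) using I zero_Inn succ_Inn by blast
    then have "u \<in> ext v" using u v(1) by blast
    then show "u \<in> Inn X" using v(2) by blast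
  qed
  then obtain v where v: "v \<in> Inn X" "ext v = {u \<in> V. ?P u}" by blast
  have "?P zero" by blast
  then have "zero \<in> ext v" using v(2) zero_in by blast
  moreover have "succ x \<in> ext v" if "x \<in> ext v" for x
  proof -
    have "x \<in> V" "?P x" using that v(2) by blast+
    then have "succ x \<in> V" "?P (succ x)" using succ_in by blast+
    then show ?thesis using v(2) by blast
  qed
  moreover have "ext (succ x) = insert x (ext x)" if "x \<in> ext v" for x using that extD by simp
  ultimately show ?thesis using v(1) ext_zero by blast
qed

theorem Inn_ZF: "ZF_axioms (Inn X) E"
proof -
  interpret I: struct "Inn X" E .
  note [simp] = ext_Inn
  have trans: "x \<in> Inn X" if "a \<in> Inn X" "x \<in> ext a" for x a using Inn_trans that by blast
  show ?thesis
  proof (intro ZF_axioms.intro)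
    show "Inn X \<noteq> {}" using zero_Inn by blast
    show "a = b" if "a \<in> Inn X" "b \<in> Inn X" "I.ext a = I.ext b" for a b
      using that by (intro extensionality) (auto simp: Inn_in_V)
    show "\<exists>x\<in>I.ext a. I.ext x \<inter> I.ext a = {}" if a: "a \<in> Inn X" "I.ext a \<noteq> {}" for a
    proof -
      obtain x where x: "x \<in> ext a" "ext x \<inter> ext a = {}" using foundation[of a] a by (auto simp: Inn_in_V)
      then show ?thesis using a trans[OF a(1) x(1)] by (intro bexI[of _ x]) auto
    qed
    show "\<exists>c\<in>Inn X. I.ext c = {a, b}" if "a \<in> Inn X" "b \<in> Inn X" for a b
      using that upair_Inn[OF that] by (intro bexI[of _ "upair a b"]) (auto simp: Inn_in_V)
    show "\<exists>c\<in>Inn X. I.ext c = \<Union>(I.ext ` I.ext a)" if a: "a \<in> Inn X" for a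
    proof (rule bexI[of _ "bigcup a"])
      have "I.ext ` ext a = ext ` ext a" using trans[OF a] by (intro image_cong) auto
      then show "I.ext (bigcup a) = \<Union>(I.ext ` I.ext a)" using a bigcup_Inn[OF a] by (simp add: Inn_in_V)
    qed (rule bigcup_Inn[OF a])
    show "\<exists>c\<in>Inn X. I.ext c = {x \<in> Inn X. I.ext x \<subseteq> I.ext a}" if a: "a \<in> Inn X" for a
    proof -
      have "\<exists>c\<in>Inn X. ext c = {x \<in> V. x \<in> Inn X \<and> ext x \<subseteq> ext a}"
        by (rule Inn_comprehension[of _ "pow a"])
          (use a in \<open>auto intro!: pdi pd_Inn X_Cl pf_const simp: Inn_Cl Inn_in_V\<close>)
      then obtain c where c: "c \<in> Inn X" "ext c = {x \<in> V. x \<in> Inn X \<and> ext x \<subseteq> ext a}" by blast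
      then have "I.ext c = {x \<in> Inn X. I.ext x \<subseteq> I.ext a}" using a Inn_in_V by auto
      then show ?thesis using c(1) by blast
    qed
    show "\<exists>w\<in>Inn X. (\<exists>z\<in>I.ext w. I.ext z = {}) \<and> (\<forall>x\<in>I.ext w. \<exists>y\<in>I.ext w. I.ext y = insert x (I.ext x))"
    proof -
      obtain w where w: "w \<in> Inn X" "\<exists>z\<in>ext w. ext z = {}" "\<forall>x\<in>ext w. \<exists>y\<in>ext w. ext y = insert x (ext x)"
        using infinity_Inn by blast
      then show ?thesis using trans[OF w(1)] by (intro bexI[of _ w]) auto
    qed
    fix p
    have envs: "e \<in> Env V" "\<And>i. e i \<in> Cl X" if "e \<in> Env (Inn X)" for e
      using that Inn_in_V Inn_Cl by (auto simp: Env_def)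
    show "I.separation p"
      unfolding I.separation_def
    proof (intro ballI)
      fix e a assume e: "e \<in> Env (Inn X)" and a: "a \<in> Inn X"
      let ?P = "\<lambda>x. x \<in> ext a \<and> sat (Inn X) E (case_nat x (case_nat a e)) p"
      have pd: "pd (Cl X) (\<lambda>e'. sat (Inn X) E (case_nat (e' 0) (case_nat (e' 1) e)) p)"
        by (rule pd_sections[OF pd_sat_Inn]) (use envs[OF e] in auto)
      have "\<exists>b\<in>Inn X. ext b = {x \<in> V. ?P x}"
        by (rule Inn_comprehension[of _ a], intro pdi pd_subst2[OF pd] pf_const)
          (use a trans in \<open>auto simp: Inn_Cl Inn_in_V\<close>)
      then obtain b where "b \<in> Inn X" "ext b = {x \<in> V. ?P x}" by blast
      then show "\<exists>b\<in>Inn X. I.ext b = {x \<in> I.ext a. sat (Inn X) E (case_nat x (case_nat a e)) p}"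
        using a extD by (intro bexI[of _ b]) auto
    qed
    show "I.replacement p"
      unfolding I.replacement_def
    proof (intro ballI impI)
      fix e a assume e: "e \<in> Env (Inn X)" and a: "a \<in> Inn X"
      let ?R = "\<lambda>x y. y \<in> Inn X \<and> sat (Inn X) E (case_nat y (case_nat x (case_nat a e))) p"
      assume "\<forall>x\<in>I.ext a. \<exists>!y. ?R x y"
      then have un: "\<forall>x\<in>ext a. \<exists>!y. ?R x y" using a by simp
      have ae: "case_nat a e \<in> Env (Inn X)" using a e by simp
      have pd1: "pd (Cl X) (\<lambda>e'. sat (Inn X) E (case_nat (e' 0) (case_nat (e' 1) (case_nat a e))) p)"
        by (rule pd_sections[OF pd_sat_Inn]) (rule envs[OF ae])+
      have pd: "pd (Cl X) (\<lambda>e'. ?R (e' 0) (e' 1))"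
        by (intro pdi pd_subst2[OF pd1] pd_Inn X_Cl)
      \<comment> \<open>Collection takes place in \<open>V\<close>. Since values are unique, the
        witness found in the level is the value itself, so the whole image is bounded and
        comprehension yields it.\<close>
      obtain d where d: "d \<in> Ord" "\<forall>x\<in>ext a. (\<exists>y\<in>V. ?R x y) \<longrightarrow> (\<exists>y\<in>ext (level d). ?R x y)"
        using collection[OF pd_mono[OF pd] Inn_in_V[OF a]] by blast
      have "\<exists>b\<in>Inn X. ext b = {y \<in> V. \<exists>x\<in>ext a. ?R x y}"
      proof (rule Inn_comprehension[OF _ level_in_V])
        show "pd (Cl X) (\<lambda>e. \<exists>x\<in>ext a. ?R x (e 0))"
          by (intro pd_ex_ext pd_subst2[OF pd] pf_var pf_const Inn_Cl[OF a] Inn_in_V[OF a])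
        show "y \<in> ext (level d)" if y: "y \<in> V" "\<exists>x\<in>ext a. ?R x y" for y
        proof -
          from y(2) obtain x where x: "x \<in> ext a" "?R x y" by blast
          then obtain y' where "y' \<in> ext (level d)" "?R x y'" using d(2) y(1) by blast
          then show ?thesis using un x by blast
        qed
      qed blast
      then obtain b where b: "b \<in> Inn X" "ext b = {y \<in> V. \<exists>x\<in>ext a. ?R x y}" by blast
      have "\<exists>y\<in>ext b. sat (Inn X) E (case_nat y (case_nat x (case_nat a e))) p" if x: "x \<in> ext a" for x
      proof -
        obtain y where y: "?R x y" using un x by blast
        then have "y \<in> ext b" unfolding b(2) using x Inn_in_V by blast
        then show ?thesis using y by blast
      qed
      then show "\<exists>b\<in>Inn X. \<forall>x\<in>I.ext a. \<exists>y\<in>I.ext b. sat (Inn X) E (case_nat y (case_nat x (case_nat a e))) p"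
        using b(1) a by (intro bexI[of _ b]) auto
    qed
  qed
qed

text \<open>The transversal consists of the elements of least index in the enumeration, one from
  each member of the family. It is definable from \<open>a\<close> and \<open>X\<close>, and
  disjointness excludes a second element in any member.\<close>

theorem Inn_choice: "sat (Inn X) E e ax_choice"
proof -
  interpret I: struct "Inn X" E .
  note [simp] = ext_Inn
  have "\<exists>c\<in>Inn X. \<forall>x\<in>ext a. \<exists>!u. u \<in> Inn X \<and> u \<in> ext x \<and> u \<in> ext c"
    if a: "a \<in> Inn X" and ne: "\<forall>x\<in>ext a. ext x \<noteq> {}"
      and dis: "\<forall>x\<in>ext a. \<forall>y\<in>ext a. x \<noteq> y \<longrightarrow> ext x \<inter> ext y = {}" for a
  proof -
    let ?f = "\<lambda>b. enum X (mu (\<lambda>d. enum X d \<in> ext b))"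
    have f: "?f b \<in> ext b" if b: "b \<in> ext a" for b
    proof -
      obtain y where y: "y \<in> ext b" using ne b by blast
      then have "y \<in> Cl X" using Inn_trans a b Inn_Cl by blast
      then obtain d where d: "d \<in> Ord" "enum X d \<in> ext b" using y unfolding Cl_def by blast
      have "pd UNIV (\<lambda>e. enum X (e 0) \<in> ext b)"
        by (intro pdi pf_enum[OF X UNIV_I] pf_param extD[OF b])
      from mu(2)[OF this d] show ?thesis .
    qed
    have "\<exists>c\<in>Inn X. ext c = {u \<in> V. \<exists>b\<in>ext a. u = ?f b}"
    proof (rule Inn_comprehension[of _ "bigcup a"])
      show "pd (Cl X) (\<lambda>e. \<exists>b\<in>ext a. e 0 = ?f b)"
        by (intro pd_ex_ext pd_eq pf_var pf_enum[OF X X_Cl] pf_mu pd_mem_ext pf_const Inn_Cl[OF a] Inn_in_V[OF a])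
      show "u \<in> Inn X" if "\<exists>b\<in>ext a. u = ?f b" for u using that f Inn_trans a by blast
      show "u \<in> ext (bigcup a)" if "\<exists>b\<in>ext a. u = ?f b" for u using that f Inn_in_V[OF a] by auto
    qed (use a Inn_in_V in auto)
    then obtain c where c: "c \<in> Inn X" "ext c = {u \<in> V. \<exists>b\<in>ext a. u = ?f b}" by blast
    have "\<exists>!u. u \<in> Inn X \<and> u \<in> ext x \<and> u \<in> ext c" if x: "x \<in> ext a" for x
    proof (rule ex1I[of _ "?f x"])
      show "?f x \<in> Inn X \<and> ?f x \<in> ext x \<and> ?f x \<in> ext c"
        using f[OF x] x c(2) Inn_trans[OF Inn_trans[OF a x]] extD by blast
      fix u assume u: "u \<in> Inn X \<and> u \<in> ext x \<and> u \<in> ext c"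
      then obtain b where b: "b \<in> ext a" "u = ?f b" using c(2) by blast
      then have "b = x" using f[OF b(1)] u dis x by blast
      then show "u = ?f x" using b(2) by simp
    qed
    then show ?thesis using c(1) by blast
  qed
  note * = this
  show ?thesis
    unfolding I.sat_choice
  proof (intro ballI impI)
    fix a assume a: "a \<in> Inn X" "(\<forall>x\<in>I.ext a. I.ext x \<noteq> {}) \<and>
      (\<forall>x\<in>I.ext a. \<forall>y\<in>I.ext a. x \<noteq> y \<longrightarrow> I.ext x \<inter> I.ext y = {})"
    have eq: "I.ext x = ext x" if "x \<in> ext a" for x using that Inn_trans[OF a(1)] by simp
    from a(2) have "\<forall>x\<in>ext a. ext x \<noteq> {}" "\<forall>x\<in>ext a. \<forall>y\<in>ext a. x \<noteq> y \<longrightarrow> ext x \<inter> ext y = {}"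
      using eq a(1) by auto
    from *[OF a(1) this] obtain c where c: "c \<in> Inn X"
      "\<forall>x\<in>ext a. \<exists>!u. u \<in> Inn X \<and> u \<in> ext x \<and> u \<in> ext c" by blast
    then show "\<exists>c\<in>Inn X. \<forall>x\<in>I.ext a. \<exists>!u. u \<in> Inn X \<and> u \<in> I.ext x \<and> u \<in> I.ext c"
      using eq a(1) by (intro bexI[of _ c]) auto
  qed
qed

text \<open>The enumeration provides levels rather than ordinals. For the least \<open>d\<close>
  whose level includes \<open>a\<close>, the ordinals in that level are exactly those in
  \<open>a\<close>: a further one would put \<open>a\<close> into \<open>level d\<close>, hence make
  \<open>a\<close> a subset of an earlier level.\<close>

lemma Ord_Inn: "a \<in> Ord \<Longrightarrow> a \<in> Inn X"
proof (rule Ord_induct[where P = "\<lambda>a. a \<in> Inn X"])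
  show "pd UNIV (\<lambda>e. e 0 \<in> Inn X)" by (intro pd_Inn pdi UNIV_I)
  fix a assume a: "a \<in> Ord" and IH: "\<And>c. c \<in> ext a \<Longrightarrow> c \<in> Inn X"
  let ?Q = "\<lambda>d. ext a \<subseteq> ext (level d)"
  obtain b where b: "b \<in> Ord" "a \<in> ext (level b)" using ex_level Ord_in[OF a] by blast
  have "?Q b" by (rule level_trans[OF b])
  moreover have "pd UNIV (\<lambda>e. ?Q (e 0))" by (intro pdi pf_param Ord_in a)
  ultimately obtain d where d: "d \<in> Ord" "?Q d" "\<forall>c\<in>ext d. \<not> ?Q c" using Ord_least[of ?Q] b(1) by blast
  have "u \<in> ext a" if u: "u \<in> Ord" "u \<in> ext (level d)" for u
  proof (rule ccontr)
    assume "u \<notin> ext a"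
    then have "a = u \<or> a \<in> ext u" using Ord_linear[OF a u(1)] by blast
    then have "a \<in> ext (level d)" using u(2) level_trans[OF d(1) u(2)] by blast
    then show False using d(3) unfolding ext_level[OF d(1)] by blast
  qed
  then have *: "u \<in> ext a \<longleftrightarrow> u \<in> Ord \<and> u \<in> ext (level d)" for u
    using d(2) Ord_elem[OF a] by blast
  have "a \<in> Cl X"
  proof (rule Cl_definable[OF X, where P = "\<lambda>z. \<forall>u\<in>V. u \<in> ext z \<longleftrightarrow> u \<in> Ord \<and> u \<in> ext (level d)"])
    show "pd (Cl X) (\<lambda>e. \<forall>u\<in>V. u \<in> ext (e 0) \<longleftrightarrow> u \<in> Ord \<and> u \<in> ext (level d))"
      by (intro pd_all pd_iff pd_conj pd_mem_ext pd_Ord pf_var pf_const Cl_level[OF X d(1)] level_in_V)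
    show "\<forall>u\<in>V. u \<in> ext a \<longleftrightarrow> u \<in> Ord \<and> u \<in> ext (level d)" using * by blast
    fix c assume "c \<in> V" "\<forall>u\<in>V. u \<in> ext c \<longleftrightarrow> u \<in> Ord \<and> u \<in> ext (level d)"
    then show "c = a" using * a extD by (intro extensionality) (auto simp del: ext_level)
  qed (use a in simp)
  then show "a \<in> Inn X" using IH by (rule InnI)
qed

end

section \<open>Absoluteness of finite tuples of ordinals\<close>

lemma sat_ordinal:
  assumes e: "e \<in> Env V"
  shows "sat V E e (fm_ordinal x) \<longleftrightarrow> e x \<in> Ord"
proof -
  let ?a = "e x"
  have V: "?a \<in> V" using Env_nth[OF e] .
  have ball: "(\<forall>y\<in>V. E y b \<longrightarrow> P y) \<longleftrightarrow> (\<forall>y\<in>ext b. P y)" for b P by (auto simp: ext_def)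
  have bex: "(\<exists>y\<in>V. E y b \<and> P y) \<longleftrightarrow> (\<exists>y\<in>ext b. P y)" for b P by (auto simp: ext_def)
  have "sat V E e (fm_ordinal x) \<longleftrightarrow>
      (\<forall>y\<in>ext ?a. ext y \<subseteq> ext ?a) \<and> (\<forall>y\<in>ext ?a. \<not> E y y) \<and>
      (\<forall>y\<in>ext ?a. \<forall>z\<in>ext ?a. \<forall>w\<in>ext ?a. E y z \<and> E z w \<longrightarrow> E y w) \<and>
      (\<forall>y\<in>ext ?a. \<forall>z\<in>ext ?a. E y z \<or> y = z \<or> E z y) \<and>
      (\<forall>s\<in>V. ext s \<subseteq> ext ?a \<and> ext s \<noteq> {} \<longrightarrow> (\<exists>m\<in>ext s. \<forall>y\<in>ext s. m = y \<or> E m y))"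
    (is "_ \<longleftrightarrow> ?R")
    by (simp add: fm_ordinal_def sat_subset sat_empty ball bex del: ex_simps all_simps ball_simps bex_simps)
  also have "\<dots> \<longleftrightarrow> ?a \<in> Ord"
  proof
    assume *: "?R"
    note tr = *[THEN conjunct1, rule_format]
      and tot = *[THEN conjunct2, THEN conjunct2, THEN conjunct2, THEN conjunct1, rule_format]
    show "?a \<in> Ord"
    proof (rule OrdI[OF V])
      show "z \<in> ext ?a" if "y \<in> ext ?a" "z \<in> ext y" for y z using tr[OF that(1)] that(2) by blast
      show "y \<in> ext z \<or> y = z \<or> z \<in> ext y" if "y \<in> ext ?a" "z \<in> ext ?a" for y z
        using tot[OF that] extD[OF that(1)] extD[OF that(2)] by (auto simp: ext_def)
    qed
  next
    assume a: "?a \<in> Ord"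
    have mem: "E y z \<longleftrightarrow> y \<in> ext z" if "y \<in> ext ?a" for y z using extD[OF that] by (simp add: ext_def)
    have least: "\<exists>m\<in>ext s. \<forall>y\<in>ext s. m = y \<or> m \<in> ext y" if s: "s \<in> V" "ext s \<subseteq> ext ?a" "ext s \<noteq> {}" for s
    proof -
      obtain m where m: "m \<in> ext s" "ext m \<inter> ext s = {}" using foundation[OF s(1,3)] by blast
      have "m = y \<or> m \<in> ext y" if "y \<in> ext s" for y
        using Ord_comparable[OF a, of m y] m that s(2) by blast
      then show ?thesis using m(1) by blast
    qed
    show "?R"
    proof (intro conjI ballI impI)
      show "ext y \<subseteq> ext ?a" if "y \<in> ext ?a" for y by (rule Ord_subset[OF a that])
      show "\<not> E y y" if "y \<in> ext ?a" for y using mem[OF that] not_mem_self extD[OF that] by blast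
      show "E y w" if "y \<in> ext ?a" "z \<in> ext ?a" "w \<in> ext ?a" "E y z \<and> E z w" for y z w
        using that mem Ord_trans[OF Ord_elem[OF a that(3)]] by blast
      show "E y z \<or> y = z \<or> E z y" if "y \<in> ext ?a" "z \<in> ext ?a" for y z
        using Ord_comparable[OF a that] mem that by blast
      show "\<exists>m\<in>ext s. \<forall>y\<in>ext s. m = y \<or> E m y" if "s \<in> V" "ext s \<subseteq> ext ?a \<and> ext s \<noteq> {}" for s
        using least[of s] that mem by blast
    qed
  qed
  finally show ?thesis .
qed

lemma ordinals_eq: "ordinals V E = Ord"
  unfolding ordinals_def sat_at_def using sat_ordinal[of "\<lambda>_. a" for a] by (auto simp: Ord_in)

lemma sat_opair:
  assumes "e \<in> Env V"
  shows "sat V E e (fm_opair x y z) \<longleftrightarrow> e z = opair (e x) (e y)"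
proof -
  have V: "e x \<in> V" "e y \<in> V" "e z \<in> V" using Env_nth[OF assms] by auto
  have "sat V E e (fm_opair x y z) \<longleftrightarrow>
      (\<exists>a\<in>V. \<exists>b\<in>V. ext a = {e x} \<and> ext b = {e x, e y} \<and> ext (e z) = {a, b})" (is "_ \<longleftrightarrow> ?R")
    using V by (simp add: fm_opair_def sat_upair)
  also have "\<dots> \<longleftrightarrow> e z = opair (e x) (e y)"
  proof
    assume "?R"
    then obtain a b where ab: "a \<in> V" "b \<in> V" "ext a = {e x}" "ext b = {e x, e y}" "ext (e z) = {a, b}" by blast
    then have "a = upair (e x) (e x)" "b = upair (e x) (e y)" using V by (auto intro!: extensionality)
    then show "e z = opair (e x) (e y)" using V ab(5) by (intro extensionality) (auto simp: ext_opair)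
  next
    assume "e z = opair (e x) (e y)"
    then show "?R"
      using V by (intro bexI[of _ "upair (e x) (e x)"] bexI[of _ "upair (e x) (e y)"]) (auto simp: ext_opair)
  qed
  finally show ?thesis .
qed

lemma sat_related:
  assumes "e \<in> Env V"
  shows "sat V E e (fm_related x y r) \<longleftrightarrow> opair (e x) (e y) \<in> ext (e r)"
proof -
  have "sat V E e (fm_related x y r) \<longleftrightarrow> (\<exists>p\<in>V. E p (e r) \<and> p = opair (e x) (e y))"
    using assms by (simp add: fm_related_def sat_opair)
  then show ?thesis using assms by (auto simp: ext_def Env_nth)
qed

section \<open>Finite tuples of ordinals, semantically\<close>

definition zero_or_succ :: "'a \<Rightarrow> bool"
  where "zero_or_succ x \<longleftrightarrow> ext x = {} \<or> (\<exists>y\<in>V. ext x = insert y (ext y))"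

definition finite_ordinal :: "'a \<Rightarrow> bool"
  where "finite_ordinal n \<longleftrightarrow> n \<in> Ord \<and> zero_or_succ n \<and> (\<forall>x\<in>ext n. zero_or_succ x)"

definition ord_tuple :: "'a \<Rightarrow> bool" where
  "ord_tuple f \<longleftrightarrow> (\<forall>p\<in>ext f. \<exists>x\<in>V. \<exists>y\<in>V. p = opair x y) \<and>
    (\<forall>x\<in>V. \<forall>y\<in>V. \<forall>z\<in>V. opair x y \<in> ext f \<and> opair x z \<in> ext f \<longrightarrow> y = z) \<and>
    (\<exists>n\<in>V. finite_ordinal n \<and> (\<forall>x\<in>V. x \<in> ext n \<longleftrightarrow> (\<exists>y\<in>V. opair x y \<in> ext f))) \<and>
    (\<forall>x\<in>V. \<forall>y\<in>V. opair x y \<in> ext f \<longrightarrow> y \<in> Ord)"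

lemma ord_tuple_pairs: "ord_tuple f \<Longrightarrow> p \<in> ext f \<Longrightarrow> \<exists>x\<in>V. \<exists>y\<in>V. p = opair x y"
  unfolding ord_tuple_def by (elim conjE) (erule (1) bspec)

lemma ord_tuple_fun:
  "ord_tuple f \<Longrightarrow> x \<in> V \<Longrightarrow> y \<in> V \<Longrightarrow> z \<in> V \<Longrightarrow> opair x y \<in> ext f \<Longrightarrow> opair x z \<in> ext f \<Longrightarrow> y = z"
  by (simp only: ord_tuple_def)

lemma ord_tuple_dom:
  "ord_tuple f \<Longrightarrow> \<exists>n\<in>V. finite_ordinal n \<and> (\<forall>x\<in>V. x \<in> ext n \<longleftrightarrow> (\<exists>y\<in>V. opair x y \<in> ext f))"
  by (simp only: ord_tuple_def)

lemma ord_tuple_ord: "ord_tuple f \<Longrightarrow> x \<in> V \<Longrightarrow> y \<in> V \<Longrightarrow> opair x y \<in> ext f \<Longrightarrow> y \<in> Ord"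
  by (simp only: ord_tuple_def)

lemma sat_finite_ordinal:
  assumes "e \<in> Env V"
  shows "sat V E e (fm_finite_ordinal x) \<longleftrightarrow> finite_ordinal (e x)"
proof -
  have zs: "sat V E e (fm_zero_or_succ x) \<longleftrightarrow> zero_or_succ (e x)" if "e \<in> Env V" for e x
    using that by (simp add: fm_zero_or_succ_def zero_or_succ_def sat_empty sat_succ Env_nth)
  show ?thesis using assms
    by (auto simp: fm_finite_ordinal_def finite_ordinal_def zs sat_ordinal ext_def[of "e x"])
qed

lemma sat_ord_tuple:
  assumes e: "e \<in> Env V"
  shows "sat V E e (fm_ord_tuple f) \<longleftrightarrow> ord_tuple (e f)"
proof -
  have 1: "sat V E e (fm_function f) \<longleftrightarrow> (\<forall>p\<in>ext (e f). \<exists>x\<in>V. \<exists>y\<in>V. p = opair x y) \<and>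
      (\<forall>x\<in>V. \<forall>y\<in>V. \<forall>z\<in>V. opair x y \<in> ext (e f) \<and> opair x z \<in> ext (e f) \<longrightarrow> y = z)"
  proof -
    have ball: "(\<forall>y\<in>ext b. P y) \<longleftrightarrow> (\<forall>y\<in>V. E y b \<longrightarrow> P y)" for b P by (auto simp: ext_def)
    show ?thesis
      unfolding ball using e
      by (simp add: fm_function_def sat_opair sat_related eval_nat_numeral
        del: ex_simps all_simps ball_simps bex_simps)
  qed
  have 2: "sat V E e (Exists (fm_finite_ordinal 0 \<^bold>\<and> fm_domain (f+1) 0)) \<longleftrightarrow>
      (\<exists>n\<in>V. finite_ordinal n \<and> (\<forall>x\<in>V. x \<in> ext n \<longleftrightarrow> (\<exists>y\<in>V. opair x y \<in> ext (e f))))"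
  proof -
    have mem: "x \<in> ext n \<longleftrightarrow> E x n" if "x \<in> V" for x n using that by (simp add: ext_def)
    show ?thesis
      using e by (simp add: sat_finite_ordinal fm_domain_def sat_related mem
        del: ex_simps all_simps ball_simps bex_simps)
  qed
  have 3: "sat V E e (Forall (Forall (fm_related 1 0 (f+2) \<^bold>\<longrightarrow> fm_ordinal 0))) \<longleftrightarrow>
      (\<forall>x\<in>V. \<forall>y\<in>V. opair x y \<in> ext (e f) \<longrightarrow> y \<in> Ord)"
    using e by (simp add: sat_related sat_ordinal)
  show ?thesis
    unfolding fm_ord_tuple_def sat_connectives(3) 1 2 3 ord_tuple_def by (simp only: conj_assoc)
qed

context
  fixes X
  assumes X: "X \<in> V"
begin

text \<open>The length \<open>n\<close> may be nonstandard, so the restrictions of \<open>f\<close>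
  to \<open>k\<close> up to \<open>n\<close> are shown to lie in the class by induction inside
  \<open>V\<close>, which is possible because \<open>Cl X\<close> is definable. A successor step
  adjoins one pair of ordinals.\<close>

lemma ord_tuple_Inn:
  assumes f: "f \<in> V" "ord_tuple f"
  shows "f \<in> Inn X"
proof -
  note pairs = ord_tuple_pairs[OF f(2)] and fn = ord_tuple_fun[OF f(2)] and ord = ord_tuple_ord[OF f(2)]
  obtain n where n: "finite_ordinal n" "\<And>x. x \<in> V \<Longrightarrow> x \<in> ext n \<longleftrightarrow> (\<exists>y\<in>V. opair x y \<in> ext f)"
    using ord_tuple_dom[OF f(2)] by blast
  have nO: "n \<in> Ord" and zs: "\<And>k. k \<in> ext (succ n) \<Longrightarrow> zero_or_succ k"
    using n(1) unfolding finite_ordinal_def by auto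
  have sub: "p \<in> Inn X" if p: "p \<in> ext f" for p
  proof -
    obtain x y where xy: "x \<in> V" "y \<in> V" "p = opair x y" using pairs[OF p] by blast
    then have "x \<in> ext n" "y \<in> Ord" using n(2) ord p by blast+
    then show ?thesis unfolding xy(3) using Ord_elem[OF nO] by (intro opair_Inn[OF X] Ord_Inn[OF X])
  qed
  have "k \<in> ext (succ n) \<longrightarrow> res f k \<in> Cl X" if "k \<in> Ord" for k
  proof (rule Ord_induct[OF _ that, where P = "\<lambda>k. k \<in> ext (succ n) \<longrightarrow> res f k \<in> Cl X"])
    show "pd UNIV (\<lambda>e. e 0 \<in> ext (succ n) \<longrightarrow> res f (e 0) \<in> Cl X)"
      by (intro pd_imp pd_mem_ext pd_Cl[OF X UNIV_I] pf_res pf_var pf_param succ_in Ord_in nO f(1))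
    fix k assume k: "k \<in> Ord" and IH: "\<And>j. j \<in> ext k \<Longrightarrow> j \<in> ext (succ n) \<longrightarrow> res f j \<in> Cl X"
    show "k \<in> ext (succ n) \<longrightarrow> res f k \<in> Cl X"
    proof
      assume kn: "k \<in> ext (succ n)"
      from zs[OF kn] consider "ext k = {}" | j where "j \<in> V" "ext k = insert j (ext j)"
        unfolding zero_or_succ_def by blast
      then show "res f k \<in> Cl X"
      proof cases
        case 1
        then have "res f k = zero" using f(1) k by (intro extensionality) (auto simp: ext_res)
        then show ?thesis using zero_Cl[OF X] by simp
      next
        case (2 j)
        have jk: "j \<in> ext k" using 2 by blast
        have "j \<in> ext n" using kn jk Ord_trans[OF nO] Ord_in[OF nO] by auto
        then obtain y where y: "y \<in> V" "opair j y \<in> ext f" using n(2)[OF 2(1)] by blast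
        have "j \<in> ext (succ n)" using \<open>j \<in> ext n\<close> Ord_in[OF nO] by simp
        then have IHj: "res f j \<in> Cl X" using IH[OF jk] by blast
        let ?p = "opair j y"
        have pV: "?p \<in> V" using 2 y by simp
        have "p \<in> ext (res f k) \<longleftrightarrow> p \<in> ext (cup (res f j) (upair ?p ?p))" for p
        proof -
          have "p \<in> ext (res f k) \<longleftrightarrow> p \<in> V \<and> p \<in> ext f \<and> (\<exists>z\<in>insert j (ext j). \<exists>y\<in>V. p = opair z y)"
            using f(1) k 2 by (simp add: ext_res)
          also have "\<dots> \<longleftrightarrow> p \<in> ext (res f j) \<or> (p \<in> ext f \<and> (\<exists>y\<in>V. p = opair j y))"
            using f(1) 2 extD by (auto simp: ext_res)
          also have "(p \<in> ext f \<and> (\<exists>y\<in>V. p = opair j y)) \<longleftrightarrow> p = ?p"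
            using y fn[OF 2(1) y(1)] by blast
          finally show ?thesis using f(1) 2(1) pV by auto
        qed
        then have "ext (res f k) = ext (cup (res f j) (upair ?p ?p))" by blast
        then have eq: "res f k = cup (res f j) (upair ?p ?p)"
          using f(1) k 2(1) pV by (intro extensionality) auto
        have p: "?p \<in> Cl X" using Inn_Cl sub y(2) X by blast
        show ?thesis unfolding eq cup_def
          by (intro Cl_closed(8)[OF X _ X_Cl[OF X]] Cl_closed(1)[OF X] IHj p)
      qed
    qed
  qed
  then have "res f n \<in> Cl X" using nO by simp
  moreover have "res f n = f"
  proof (rule extensionality)
    have "p \<in> ext (res f n)" if p: "p \<in> ext f" for p
    proof -
      obtain x y where xy: "x \<in> V" "y \<in> V" "p = opair x y" using pairs[OF p] by blast
      then have "x \<in> ext n" using n(2)[OF xy(1)] p by blast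
      then show ?thesis
        unfolding ext_res[OF f(1) Ord_in[OF nO]] using xy(2,3) p extD[OF p]
        by (intro CollectI conjI bexI[of _ x] bexI[of _ y])
    qed
    moreover have "ext (res f n) \<subseteq> ext f"
      unfolding ext_res[OF f(1) Ord_in[OF nO]] by (rule subsetI, elim CollectE conjE)
    ultimately show "ext (res f n) = ext f" by blast
  qed (use f nO in auto)
  ultimately have "f \<in> Cl X" by (simp only:)
  then show ?thesis by (rule InnI[OF X _ sub])
qed

section \<open>Comparison of the inner model with the whole model\<close>

interpretation I: ZF_axioms "Inn X" E
  by (rule Inn_ZF[OF X])

lemma transitive_in_Inn: "transitive_in (Inn X) V E"
  unfolding transitive_in_def
proof (intro conjI ballI impI)
  show "Inn X \<subseteq> V" using Inn_in_V[OF X] by blast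
  fix x y assume "x \<in> Inn X" "y \<in> V" "E y x"
  then show "y \<in> Inn X" using Inn_trans[OF X, of x y] by (simp add: ext_def)
qed

lemma I_Ord: "I.Ord = Ord"
proof -
  have "I.Ord = {a \<in> Inn X. transitive a \<and> (\<forall>x\<in>ext a. \<forall>y\<in>ext a. x \<in> ext y \<or> x = y \<or> y \<in> ext x)}"
    unfolding I.Ord_def I.transitive_def transitive_def
    using ext_Inn[OF X] Inn_trans[OF X] by (intro Collect_cong conj_cong refl) auto
  also have "\<dots> = Ord"
    using Ord_Inn[OF X] Inn_in_V[OF X] unfolding Ord_def by blast
  finally show ?thesis .
qed

lemma ordinals_Inn: "ordinals (Inn X) E = ordinals V E"
  using I.ordinals_eq ordinals_eq I_Ord by simp

lemma I_opair: "a \<in> Inn X \<Longrightarrow> b \<in> Inn X \<Longrightarrow> I.opair a b = opair a b"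
proof -
  have up: "I.upair a b = upair a b" if "a \<in> Inn X" "b \<in> Inn X" for a b
    using that I.ext_upair[OF that] I.upair_in[OF that] ext_Inn[OF X] Inn_in_V[OF X]
    by (intro extensionality) auto
  then show "a \<in> Inn X \<Longrightarrow> b \<in> Inn X \<Longrightarrow> I.opair a b = opair a b"
    unfolding I.opair_def opair_def using upair_Inn[OF X] by simp
qed

lemma opair_InnD:
  assumes "x \<in> V" "y \<in> V" "opair x y \<in> Inn X"
  shows "x \<in> Inn X" "y \<in> Inn X"
proof -
  have "upair x y \<in> Inn X" using Inn_trans[OF X assms(3)] assms by (simp add: ext_opair)
  then show "x \<in> Inn X" "y \<in> Inn X" using Inn_trans[OF X] assms by (auto simp: ext_upair)
qed

text \<open>This makes \<open>X\<close> a legitimate value of the ordinal bounded quantifier in the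
  inner model. Entries, indices and length lie there by transitivity and \<open>Ord_Inn\<close>, so
  every existential witness survives.\<close>

lemma I_ord_tuple:
  assumes f: "f \<in> Inn X" "ord_tuple f"
  shows "I.ord_tuple f"
proof -
  note ext [simp] = ext_Inn[OF X]
  have zs: "I.zero_or_succ x" if "x \<in> Inn X" "zero_or_succ x" for x
  proof -
    have "y \<in> Inn X" if "y \<in> V" "ext x = insert y (ext y)" for y
      using Inn_trans[OF X \<open>x \<in> Inn X\<close>] that by blast
    then show ?thesis using that unfolding I.zero_or_succ_def zero_or_succ_def by auto
  qed
  note pairs = ord_tuple_pairs[OF f(2)] and fn = ord_tuple_fun[OF f(2)] and ord = ord_tuple_ord[OF f(2)]
  obtain n where n: "finite_ordinal n" "\<And>x. x \<in> V \<Longrightarrow> x \<in> ext n \<longleftrightarrow> (\<exists>y\<in>V. opair x y \<in> ext f)"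
    using ord_tuple_dom[OF f(2)] by blast
  have V: "x \<in> V" if "x \<in> Inn X" for x using Inn_in_V[OF X that] .
  have comp: "x \<in> Inn X \<and> y \<in> Inn X" if "x \<in> V" "y \<in> V" "opair x y \<in> ext f" for x y
    using opair_InnD[OF that(1,2)] Inn_trans[OF X f(1) that(3)] by blast
  have nI: "n \<in> Inn X" "n \<in> Ord" using n(1) Ord_Inn[OF X] unfolding finite_ordinal_def by auto
  have fin: "I.finite_ordinal n"
    using n(1) nI zs Inn_trans[OF X nI(1)] unfolding I.finite_ordinal_def finite_ordinal_def I_Ord by auto
  show ?thesis
    unfolding I.ord_tuple_def ext[OF f(1)] I_Ord
  proof (intro conjI ballI impI)
    show "\<exists>x\<in>Inn X. \<exists>y\<in>Inn X. p = I.opair x y" if p: "p \<in> ext f" for p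
    proof -
      obtain x y where xy: "x \<in> V" "y \<in> V" "p = opair x y" using pairs[OF p] by blast
      then have "x \<in> Inn X" "y \<in> Inn X" using comp p by auto
      then show ?thesis using xy(3) by (intro bexI[of _ x] bexI[of _ y]) (simp_all add: I_opair)
    qed
    show "y = z" if "x \<in> Inn X" "y \<in> Inn X" "z \<in> Inn X" "I.opair x y \<in> ext f \<and> I.opair x z \<in> ext f" for x y z
      using that fn[of x y z] I_opair V by simp
    show "y \<in> Ord" if "x \<in> Inn X" "y \<in> Inn X" "I.opair x y \<in> ext f" for x y
      using that ord[of x y] I_opair V by simp
    show "\<exists>n\<in>Inn X. I.finite_ordinal n \<and> (\<forall>x\<in>Inn X. x \<in> I.ext n \<longleftrightarrow> (\<exists>y\<in>Inn X. I.opair x y \<in> ext f))"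
    proof (intro bexI[OF _ nI(1)] conjI ballI fin)
      fix x assume x: "x \<in> Inn X"
      have "(\<exists>y\<in>V. opair x y \<in> ext f) \<longleftrightarrow> (\<exists>y\<in>Inn X. I.opair x y \<in> ext f)"
        using comp[OF V[OF x]] I_opair[OF x] V by metis
      then show "x \<in> I.ext n \<longleftrightarrow> (\<exists>y\<in>Inn X. I.opair x y \<in> ext f)"
        unfolding ext[OF nI(1)] n(2)[OF V[OF x]] .
    qed
  qed
qed

lemma ord_tuples_Inn:
  assumes "\<And>f. f \<in> ext X \<Longrightarrow> ord_tuple f"
  shows "X \<in> Inn X" "\<forall>f\<in>I.ext X. I.ord_tuple f"
proof -
  have *: "f \<in> Inn X" if "f \<in> ext X" for f using assms that ord_tuple_Inn extD by blast
  then show XI: "X \<in> Inn X" by (rule InnI[OF X X_Cl[OF X]])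
  show "\<forall>f\<in>I.ext X. I.ord_tuple f" unfolding ext_Inn[OF X XI] using * assms I_ord_tuple by blast
qed

lemma is_model_Inn: "is_model (Inn X) E ZFC"
proof -
  have "is_model (Inn X) E ZF" by (rule struct.is_model_iff[OF I.nonempty, THEN iffD2, OF Inn_ZF[OF X]])
  then show ?thesis using Inn_choice[OF X] unfolding is_model_def ZFC_def by blast
qed

end

lemma sat_ForallOrd:
  assumes "fv p \<subseteq> {0}" "e \<in> Env V"
  shows "sat V E e (ForallOrd p) \<longleftrightarrow> (\<forall>x\<in>V. (\<forall>f\<in>ext x. ord_tuple f) \<longrightarrow> sat_at V E p x)"
proof -
  have p: "sat V E (case_nat x e) p \<longleftrightarrow> sat_at V E p x" for x
    unfolding sat_at_def by (rule sat_cong) (use assms(1) in auto)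
  have ball: "(\<forall>y\<in>ext b. P y) \<longleftrightarrow> (\<forall>y\<in>V. E y b \<longrightarrow> P y)" for b P by (auto simp: ext_def)
  show ?thesis
    unfolding ForallOrd_def ball using assms(2) by (simp add: sat_ord_tuple p)
qed

end

section \<open>From the inner model to provability\<close>

lemma sentence_ZF: "p \<in> ZF \<Longrightarrow> sentence p"
  unfolding ZF_def universal_closures_def
  by (auto simp: sentence_def ax_extensionality_def ax_foundation_def ax_pairing_def ax_union_def
    ax_power_set_def ax_infinity_def Neg_def Or_def And_def Iff_def Exists_def ForallIn_def
    ExistsIn_def fm_empty_def fm_upair_def fm_subset_def fm_succ_def eval_nat_numeral)

theorem theorem3:
  fixes \<phi> \<psi> :: fm
  assumes "sentence \<phi>"
    and "\<phi> = ForallOrd \<psi>"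
    and "infinite (UNIV :: 'a set)"
    and "upwards_absolute TYPE('a) \<psi>"
  shows "(ZF \<turnstile> \<phi>) \<longleftrightarrow> (ZFC \<turnstile> \<phi>)"
proof
  show "ZFC \<turnstile> \<phi>" if "ZF \<turnstile> \<phi>"
    using that by (rule weakening) (auto simp: ZFC_def)
  assume ZFC: "ZFC \<turnstile> \<phi>"
  show "ZF \<turnstile> \<phi>"
  proof (rule ccontr)
    assume "\<not> (ZF \<turnstile> \<phi>)"
    \<comment> \<open>The countermodel has to live in the type over which
      \<open>upwards_absolute\<close> quantifies; this is why that type is assumed infinite.\<close>
    then obtain V :: "'a set" and E where V: "is_model V E (insert (\<^bold>\<not> \<phi>) ZF)"
      using completeness assms(1,3) sentence_ZF by blast
    then have ZF: "is_model V E ZF" and ne: "V \<noteq> {}" by (auto simp: is_model_def)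
    interpret ZF_axioms V E
      by (rule struct.is_model_iff[THEN iffD1, OF ne ZF])
    have fv: "fv \<psi> \<subseteq> {0}"
    proof
      fix i assume "i \<in> fv \<psi>"
      then show "i \<in> {0}" using assms(1,2) by (cases i) (auto simp: sentence_def ForallOrd_def)
    qed
    obtain v where v: "v \<in> V" using ne by blast
    then have "range (\<lambda>_. v) \<subseteq> V" by auto
    then have "\<not> sat V E (\<lambda>_. v) \<phi>" using V unfolding is_model_def by (metis insertI1 sat_connectives(1))
    then obtain X where X: "X \<in> V" "\<forall>f\<in>ext X. ord_tuple f" "\<not> sat_at V E \<psi> X"
      unfolding assms(2) using sat_ForallOrd[OF fv, of "\<lambda>_. v"] v by auto
    interpret I: ZF_axioms "Inn X" E by (rule Inn_ZF[OF X(1)])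
    have XI: "X \<in> Inn X" "\<forall>f\<in>I.ext X. I.ord_tuple f" using ord_tuples_Inn[OF X(1)] X(2) by blast+
    have mod: "is_model (Inn X) E ZFC" by (rule is_model_Inn[OF X(1)])
    then have "is_model (Inn X) E ZF" by (auto simp: is_model_def ZFC_def)
    then have "\<not> sat_at (Inn X) E \<psi> X"
      using assms(4) ZF transitive_in_Inn[OF X(1)] ordinals_Inn[OF X(1)] XI(1) X(3)
      unfolding upwards_absolute_def by blast
    then have "\<not> sat (Inn X) E (\<lambda>_. X) \<phi>"
      unfolding assms(2) using I.sat_ForallOrd[OF fv, of "\<lambda>_. X"] XI by auto
    moreover have "sat (Inn X) E (\<lambda>_. X) \<phi>"
      using soundness[OF ZFC, of "\<lambda>_. X" "Inn X" E] mod XI(1) unfolding is_model_def by (auto simp: image_subset_iff)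
    ultimately show False by blast
  qed
qed

end
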